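(* For any fixed positive real $\epsilon>0$ there exists a polynomial-time algorithm which, when $f_1,\dots,f_n$ are monotone submodular and $\mathcal{I}$ is given by a $\mu$-matroid intersection, outputs $p\in\Delta(\mathcal{I})$ with $\min_{k\in[n]}\sum_{X\in\mathcal{I}}p_Xf_k(X)\ge\frac{1}{\mu+\epsilon}\nu^*$.
   Context: $E$ finite, $f_1,\dots,f_n\colon2^E\to\mathbb{R}_{\ge0}$ monotone submodular with $f_k(\emptyset)=0$ given by value oracles. A $\mu$-matroid intersection is $(E,\bigcap_{i=1}^\mu\mathcal{I}_i)$ for matroids $(E,\mathcal{I}_i)$. $\Delta(\mathcal{I})$ is the set of probability distributions over $\mathcal{I}$ and $\nu^*=\max_{p\in\Delta(\mathcal{I})}\min_{k}\sum_Xp_Xf_k(X)$.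
   Formalization: Proved for μ ≥ 2; for μ = 1 and small ε the claim fails, since with n = 1 it would beat 1−1/e for monotone submodular maximization over a matroid with polynomially many value-oracle calls (Nemhauser–Wolsey). *)

theory Defs
  imports "HOL-Probability.Probability"
begin

section \<open>Matroids and set functions\<close>

definition matroid :: "'a set \<Rightarrow> 'a set set \<Rightarrow> bool" where
  "matroid E \<I> \<longleftrightarrow>
     finite E \<and> (\<forall>X\<in>\<I>. X \<subseteq> E) \<and> {} \<in> \<I> \<and>
     (\<forall>X Y. X \<subseteq> Y \<and> Y \<in> \<I> \<longrightarrow> X \<in> \<I>) \<and>
     (\<forall>X\<in>\<I>. \<forall>Y\<in>\<I>. card X < card Y \<longrightarrow> (\<exists>e\<in>Y - X. insert e X \<in> \<I>))"

definition matroid_intersection :: "nat \<Rightarrow> (nat \<Rightarrow> 'a set set) \<Rightarrow> 'a set set" where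
  "matroid_intersection \<mu> Ind = (\<Inter>i<\<mu>. Ind i)"

definition monotone_setfun :: "'a set \<Rightarrow> ('a set \<Rightarrow> real) \<Rightarrow> bool" where
  "monotone_setfun E f \<longleftrightarrow> (\<forall>X Y. X \<subseteq> Y \<and> Y \<subseteq> E \<longrightarrow> f X \<le> f Y)"

definition submodular :: "'a set \<Rightarrow> ('a set \<Rightarrow> real) \<Rightarrow> bool" where
  "submodular E f \<longleftrightarrow>
     (\<forall>X Y. X \<subseteq> E \<and> Y \<subseteq> E \<longrightarrow> f (X \<union> Y) + f (X \<inter> Y) \<le> f X + f Y)"


section \<open>Randomized strategies\<close>

definition \<Delta> :: "'a set set \<Rightarrow> 'a set pmf set" where
  "\<Delta> \<I> = {p. set_pmf p \<subseteq> \<I>}"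

text \<open>The functions \<open>f\<^sub>1, \<dots>, f\<^sub>n\<close> are indexed by \<open>k < n\<close>.\<close>

definition robust_value ::
    "'a set set \<Rightarrow> nat \<Rightarrow> (nat \<Rightarrow> 'a set \<Rightarrow> real) \<Rightarrow> 'a set pmf \<Rightarrow> real" where
  "robust_value \<I> n f p = Min ((\<lambda>k. \<Sum>X\<in>\<I>. pmf p X * f k X) ` {..<n})"

text \<open>The maximum is written as a supremum; lemma \<open>nu_star_is_max\<close> below shows that it is attained.\<close>

definition nu_star :: "'a set set \<Rightarrow> nat \<Rightarrow> (nat \<Rightarrow> 'a set \<Rightarrow> real) \<Rightarrow> real" where
  "nu_star \<I> n f = (SUP p\<in>\<Delta> \<I>. robust_value \<I> n f p)"

lemma continuous_on_Min_image:
  fixes g :: "'k \<Rightarrow> 'b::topological_space \<Rightarrow> real"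
  assumes "finite K" "K \<noteq> {}" "\<And>k. k \<in> K \<Longrightarrow> continuous_on S (g k)"
  shows "continuous_on S (\<lambda>x. Min ((\<lambda>k. g k x) ` K))"
  using assms
proof (induction K rule: finite_ne_induct)
  case (insert k K)
  then have "continuous_on S (\<lambda>x. min (g k x) (Min ((\<lambda>k. g k x) ` K)))"
    by (intro continuous_on_min) auto
  with insert show ?case by simp
qed simp

lemma nu_star_is_max:
  fixes \<I> :: "'a set set"
  assumes fin: "finite \<I>" and ne: "\<I> \<noteq> {}" and n: "n \<ge> 1"
  shows "\<exists>p\<in>\<Delta> \<I>. robust_value \<I> n f p = nu_star \<I> n f \<and>
           (\<forall>q\<in>\<Delta> \<I>. robust_value \<I> n f q \<le> nu_star \<I> n f)"
proof -
  define S where "S = {x :: 'a set \<Rightarrow> real. x \<in> Pi\<^sub>E UNIV (\<lambda>X. if X \<in> \<I> then {0..1} else {0}) \<and> (\<Sum>X\<in>\<I>. x X) = 1}"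
  define v where "v x = Min ((\<lambda>k. \<Sum>X\<in>\<I>. x X * f k X) ` {..<n})" for x :: "'a set \<Rightarrow> real"
  have cont: "continuous_on UNIV v"
    unfolding v_def using n
    by (intro continuous_on_Min_image continuous_on_sum continuous_on_mult_right
          continuous_on_product_coordinates) (auto simp: lessThan_empty_iff)
  have comp1: "compact (Pi\<^sub>E UNIV (\<lambda>X. if X \<in> \<I> then {0..1} else {0}) :: ('a set \<Rightarrow> real) set)"
  proof -
    have "compactin (product_topology (\<lambda>_. euclidean) UNIV)
            (Pi\<^sub>E UNIV (\<lambda>X. if X \<in> \<I> then {0..1} else {0}) :: ('a set \<Rightarrow> real) set)"
      unfolding compactin_PiE by auto
    then show ?thesis
      by (simp add: euclidean_product_topology)
  qed
  have closed: "closed {x :: 'a set \<Rightarrow> real. (\<Sum>X\<in>\<I>. x X) = 1}"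
    by (intro closed_Collect_eq continuous_intros) auto
  have compS: "compact S"
  proof -
    have "S = Pi\<^sub>E UNIV (\<lambda>X. if X \<in> \<I> then {0..1} else {0}) \<inter> {x. (\<Sum>X\<in>\<I>. x X) = 1}"
      by (auto simp: S_def)
    then show ?thesis using comp1 closed compact_Int_closed by metis
  qed
  have pmf_S: "pmf p \<in> S" if "p \<in> \<Delta> \<I>" for p
  proof -
    have "(\<Sum>X\<in>\<I>. pmf p X) = 1"
      using that fin by (intro sum_pmf_eq_1) (auto simp: \<Delta>_def)
    moreover have "pmf p X = 0" if "X \<notin> \<I>" for X
      using that \<open>p \<in> \<Delta> \<I>\<close> by (auto simp: \<Delta>_def pmf_eq_0_set_pmf)
    ultimately show ?thesis
      by (auto simp: S_def PiE_iff pmf_le_1)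
  qed
  have S_pmf: "\<exists>p\<in>\<Delta> \<I>. pmf p = x" if "x \<in> S" for x
  proof -
    have x0: "x X \<ge> 0" and x1: "X \<notin> \<I> \<Longrightarrow> x X = 0" for X
      using that by (auto simp: S_def PiE_iff split: if_splits)
    have "(\<integral>\<^sup>+X. ennreal (x X) \<partial>count_space UNIV) = (\<Sum>X\<in>\<I>. ennreal (x X))"
      using fin x1 by (intro nn_integral_count_space') auto
    also have "\<dots> = ennreal (\<Sum>X\<in>\<I>. x X)"
      using x0 by (simp add: sum_ennreal)
    also have "\<dots> = 1" using that by (simp add: S_def)
    finally have nn: "(\<integral>\<^sup>+X. ennreal (x X) \<partial>count_space UNIV) = 1" .
    have "pmf (embed_pmf x) = x"
      using pmf_embed_pmf[OF x0 nn] by auto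
    moreover have "set_pmf (embed_pmf x) \<subseteq> \<I>"
      using set_embed_pmf[OF x0 nn] x1 by auto
    ultimately show ?thesis by (auto simp: \<Delta>_def)
  qed
  from ne obtain X0 where "X0 \<in> \<I>" by auto
  then have "return_pmf X0 \<in> \<Delta> \<I>" by (auto simp: \<Delta>_def)
  then have "S \<noteq> {}" using pmf_S by auto
  then obtain x where x: "x \<in> S" and xmax: "\<forall>y\<in>S. v y \<le> v x"
    using continuous_attains_sup[OF compS _ continuous_on_subset[OF cont]] by auto
  obtain p where p: "p \<in> \<Delta> \<I>" "pmf p = x" using S_pmf[OF x] by auto
  have rv: "robust_value \<I> n f q = v (pmf q)" for q
    by (simp add: robust_value_def v_def)
  have le: "robust_value \<I> n f q \<le> robust_value \<I> n f p" if "q \<in> \<Delta> \<I>" for q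
    using xmax pmf_S[OF that] p by (simp add: rv)
  have "nu_star \<I> n f = robust_value \<I> n f p"
    unfolding nu_star_def using p le by (intro cSup_eq_maximum) auto
  then show ?thesis using p le by auto
qed


section \<open>Model of computation\<close>

text \<open>
  Algorithms are programs of a small imperative language over a random-access memory with
  natural-number arrays (counters, indices, characteristic vectors) and real arrays (the function
  values are arbitrary reals).  A scalar is cell 0 of an array.

  Each command costs one unit of time, and so does each oracle call.  The expressions inside a
  program have fixed size, so counting their operations individually would change the running time
  by a constant factor only.  There is deliberately no multiplication on natural numbers, so after
  \<open>t\<close> steps the numbers in memory have \<open>O(t)\<close> bits more than those at the start.  Real arithmetic
  (\<open>+, -, *, /\<close> and comparison, with rational constants) has unit cost, as in the real RAM; there is
  no rounding operation and no way back from real to natural numbers other than branching.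
\<close>

datatype nexp =
    NConst nat
  | NCell string nexp
  | NAdd nexp nexp
  | NSub nexp nexp

datatype rexp =
    RConst rat
  | RNat nexp
  | RCell string nexp
  | RAdd rexp rexp
  | RSub rexp rexp
  | RMul rexp rexp
  | RDiv rexp rexp

datatype bexp =
    NLess nexp nexp
  | RLess rexp rexp
  | Neg bexp
  | Conj bexp bexp

datatype com =
    Skip
  | NAssign string nexp nexp
  | RAssign string nexp rexp
  | ValueQuery string nexp nexp string nexp
  | IndepQuery string nexp nexp string nexp
  | Seq com com
  | Cond bexp com com
  | While bexp com

record state =
  nmem :: "string \<Rightarrow> nat \<Rightarrow> nat"
  rmem :: "string \<Rightarrow> nat \<Rightarrow> real"

fun nval :: "nexp \<Rightarrow> state \<Rightarrow> nat" where
  "nval (NConst c) s = c"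
| "nval (NCell x a) s = nmem s x (nval a s)"
| "nval (NAdd a b) s = nval a s + nval b s"
| "nval (NSub a b) s = nval a s - nval b s"

fun rval :: "rexp \<Rightarrow> state \<Rightarrow> real" where
  "rval (RConst c) s = of_rat c"
| "rval (RNat a) s = real (nval a s)"
| "rval (RCell x a) s = rmem s x (nval a s)"
| "rval (RAdd a b) s = rval a s + rval b s"
| "rval (RSub a b) s = rval a s - rval b s"
| "rval (RMul a b) s = rval a s * rval b s"
| "rval (RDiv a b) s = rval a s / rval b s"

fun bval :: "bexp \<Rightarrow> state \<Rightarrow> bool" where
  "bval (NLess a b) s \<longleftrightarrow> nval a s < nval b s"
| "bval (RLess a b) s \<longleftrightarrow> rval a s < rval b s"
| "bval (Neg b) s \<longleftrightarrow> \<not> bval b s"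
| "bval (Conj a b) s \<longleftrightarrow> bval a s \<and> bval b s"

definition nupd :: "state \<Rightarrow> string \<Rightarrow> nat \<Rightarrow> nat \<Rightarrow> state" where
  "nupd s x i c = s\<lparr>nmem := (nmem s)(x := (nmem s x)(i := c))\<rparr>"

definition rupd :: "state \<Rightarrow> string \<Rightarrow> nat \<Rightarrow> real \<Rightarrow> state" where
  "rupd s x i r = s\<lparr>rmem := (rmem s)(x := (rmem s x)(i := r))\<rparr>"

text \<open>
  What a program can access besides its memory: value oracles for the functions and independence
  oracles for the matroids.  The program knows the ground set only through an enumeration \<open>es\<close> of
  its elements, and passes a subset \<open>X\<close> as the block of \<open>length es\<close> cells of a natural-number
  array \<open>x\<close>, starting at address \<open>a\<close>, that holds the characteristic vector of \<open>X\<close>.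
\<close>

record 'a oracles =
  elements :: "'a list"
  value_oracle :: "nat \<Rightarrow> 'a set \<Rightarrow> real"
  indep_oracle :: "nat \<Rightarrow> 'a set set"

definition decode :: "'a list \<Rightarrow> state \<Rightarrow> string \<Rightarrow> nat \<Rightarrow> 'a set" where
  "decode es s x a = {es ! e | e. e < length es \<and> nmem s x (a + e) \<noteq> 0}"

text \<open>\<open>exec \<Omega> c s t s'\<close>: started in \<open>s\<close>, program \<open>c\<close> halts in \<open>s'\<close> after \<open>t\<close> units of time.\<close>

inductive exec :: "'a oracles \<Rightarrow> com \<Rightarrow> state \<Rightarrow> nat \<Rightarrow> state \<Rightarrow> bool" for \<Omega> where
  Skip: "exec \<Omega> Skip s 1 s"
| NAssign: "exec \<Omega> (NAssign x i a) s 1 (nupd s x (nval i s) (nval a s))"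
| RAssign: "exec \<Omega> (RAssign x i r) s 1 (rupd s x (nval i s) (rval r s))"
| ValueQuery: "exec \<Omega> (ValueQuery x i k y a) s 1
    (rupd s x (nval i s)
       (value_oracle \<Omega> (nval k s) (decode (elements \<Omega>) s y (nval a s))))"
| IndepQuery: "exec \<Omega> (IndepQuery x i k y a) s 1
    (nupd s x (nval i s)
       (if decode (elements \<Omega>) s y (nval a s) \<in> indep_oracle \<Omega> (nval k s) then 1 else 0))"
| Seq: "exec \<Omega> c1 s t1 s1 \<Longrightarrow> exec \<Omega> c2 s1 t2 s2 \<Longrightarrow> exec \<Omega> (Seq c1 c2) s (t1 + t2) s2"
| CondTrue: "bval b s \<Longrightarrow> exec \<Omega> c1 s t s' \<Longrightarrow> exec \<Omega> (Cond b c1 c2) s (t + 1) s'"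
| CondFalse: "\<not> bval b s \<Longrightarrow> exec \<Omega> c2 s t s' \<Longrightarrow> exec \<Omega> (Cond b c1 c2) s (t + 1) s'"
| WhileFalse: "\<not> bval b s \<Longrightarrow> exec \<Omega> (While b c) s 1 s"
| WhileTrue: "bval b s \<Longrightarrow> exec \<Omega> c s t1 s1 \<Longrightarrow> exec \<Omega> (While b c) s1 t2 s2 \<Longrightarrow>
    exec \<Omega> (While b c) s (t1 + t2 + 1) s2"

lemma exec_deterministic:
  "exec \<Omega> c s t s1 \<Longrightarrow> exec \<Omega> c s u s2 \<Longrightarrow> u = t \<and> s2 = s1"
proof (induction arbitrary: u s2 rule: exec.induct)
  case (Skip s)
  from Skip.prems show ?case by cases auto
next
  case (NAssign x i a s)
  from NAssign.prems show ?case by cases auto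
next
  case (RAssign x i r s)
  from RAssign.prems show ?case by cases auto
next
  case (ValueQuery x i k y a s)
  from ValueQuery.prems show ?case by cases auto
next
  case (IndepQuery x i k y a s)
  from IndepQuery.prems show ?case by cases auto
next
  case (Seq c1 s t1 s1 c2 t2 s2')
  from Seq.prems show ?case by cases (auto dest!: Seq.IH)
next
  case (CondTrue b s c1 t s' c2)
  from CondTrue.prems CondTrue.hyps show ?case by cases (auto dest!: CondTrue.IH)
next
  case (CondFalse b s c2 t s' c1)
  from CondFalse.prems CondFalse.hyps show ?case by cases (auto dest!: CondFalse.IH)
next
  case (WhileFalse b s c)
  from WhileFalse.prems WhileFalse.hyps show ?case by cases auto
next
  case (WhileTrue b s c t1 s1 t2 s2')
  from WhileTrue.prems WhileTrue.hyps show ?case by cases (auto dest!: WhileTrue.IH)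
qed

text \<open>The program is given \<open>|E|\<close>, \<open>n\<close> and \<open>\<mu>\<close>; all other cells are zero.\<close>

definition initial_state :: "nat \<Rightarrow> nat \<Rightarrow> nat \<Rightarrow> state" where
  "initial_state m n \<mu> =
     nupd (nupd (nupd \<lparr>nmem = (\<lambda>_ _. 0), rmem = (\<lambda>_ _. 0)\<rparr>
       ''m'' 0 m) ''n'' 0 n) ''mu'' 0 \<mu>"

text \<open>
  The output is an explicit list of sets with probabilities: its length is in \<open>len\<close>, the probability
  of the \<open>j\<close>-th set in cell \<open>j\<close> of \<open>prob\<close>, and the characteristic vector of the \<open>j\<close>-th set in
  the \<open>j\<close>-th block of \<open>supp\<close>.  If a set is listed repeatedly, its probabilities are added up.
\<close>

definition outputs :: "'a list \<Rightarrow> state \<Rightarrow> 'a set pmf \<Rightarrow> bool" where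
  "outputs es s p \<longleftrightarrow>
     (\<forall>X. pmf p X =
        (\<Sum>j | j < nmem s ''len'' 0 \<and> decode es s ''supp'' (j * length es) = X.
           rmem s ''prob'' j))"

end

theory Submission
  imports Defs
begin

text \<open>
  Multiplicative weights reduce the max-min problem to the approximate maximization of a weighted
  sum of the \<open>f k\<close>, truncated at a threshold \<open>\<theta>\<close>.  Let \<open>\<beta>\<close> be the minimum over \<open>k\<close> of the largest
  value of \<open>f k\<close> on a feasible singleton.  Then \<open>\<beta> / n \<le> \<nu>\<^sup>* \<le> |E| \<beta>\<close>, so a threshold that exceeds
  \<open>|E| \<beta>\<close> by a factor of order \<open>n\<close> costs little, while the width of the game becomes polynomial.

  The weighted sums are maximized by local search with additive slack, exchanging boundedly many
  elements.  For the ratio \<open>1 / (\<mu> + 1 / p)\<close>, compare a local optimum \<open>S\<close> with \<open>J \<in> \<I>\<close>: chains of marginal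
  values replace the submodular function by weights on \<open>S\<close> and on \<open>J - S\<close>, and all matroids but two
  are charged to additive weights on \<open>J - S\<close> of total at most \<open>f S\<close> each.  For the remaining two
  matroids, perfect matchings between \<open>J\<close> and \<open>S\<close> in the exchange graphs form closed walks.  If the
  matchings along a walk are unique, then all its segments are feasible exchanges, and a segment
  with \<open>p\<close> elements of \<open>J\<close> meets only \<open>p + 1\<close> elements of \<open>S\<close>.  Otherwise a second matching provides
  chords, which cut the walk into shorter ones that cover it evenly.
\<close>

section \<open>Exchange properties of a matroid\<close>

text \<open>The function values are arbitrary reals, so no step count may depend on their size, and
  the program has no access to the optimal value. It can compute \<open>\<beta>\<close> with
  polynomially many queries, so threshold and slack are taken as multiples of
  \<open>\<beta>\<close>; their ratio bounds the number of accepted exchanges. Since some feasible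
  singleton already earns \<open>\<beta> / n\<close> per unit of weight, slack and regret become
  relative errors, and the number of rounds is polynomial as well. The ratio arises as follows. When
  p consecutive elements of J on a walk enter S, one matroid asks for the removal of the p elements
  of S before them, the other for the p elements behind them, together p + 1; averaging over all
  segments gives 1 + 1 / p. Each of the other \<mu> - 2 matroids adds f S, and f S is lost once more
  in passing from marginal values of J to f J, in total \<mu> + 1 / p. Uniqueness of the matchings
  matters because exchanges that are feasible one by one need not be feasible together.\<close>

lemma card_swap':
  assumes "finite A" "x \<in> A" "y \<notin> A - {x}"
  shows "card (insert y (A - {x})) = card A"
  using assms by (metis card_Suc_Diff1 card_insert_disjoint finite_Diff)

lemma card_swap:
  assumes "finite A" "x \<in> A" "y \<notin> A"
  shows "card (insert y (A - {x})) = card A"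
  using assms by (intro card_swap') auto

lemma matroid_mono:
  assumes "matroid E Ind" "Y \<in> Ind" "X \<subseteq> Y"
  shows "X \<in> Ind"
  using assms unfolding matroid_def by blast

lemma matroid_augment:
  assumes "matroid E Ind" "X \<in> Ind" "Y \<in> Ind" "card X < card Y"
  obtains e where "e \<in> Y - X" "insert e X \<in> Ind"
  using assms unfolding matroid_def by blast

lemma matroid_finite:
  assumes "matroid E Ind" "X \<in> Ind"
  shows "finite X"
  using assms unfolding matroid_def by (meson finite_subset)

lemma matroid_extend:
  assumes M: "matroid E Ind" and "X \<in> Ind" and Y: "Y \<in> Ind" and "card X \<le> card Y"
  shows "\<exists>Z\<in>Ind. X \<subseteq> Z \<and> Z \<subseteq> X \<union> Y \<and> card Z = card Y"
  using assms(2,4)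
proof (induction "card Y - card X" arbitrary: X)
  case 0
  then show ?case by (intro bexI[of _ X]) auto
next
  case (Suc k)
  then have "card X < card Y" by linarith
  then obtain e where e: "e \<in> Y - X" "insert e X \<in> Ind"
    using matroid_augment[OF M _ Y] Suc.prems by blast
  have "card (insert e X) = Suc (card X)"
    using e matroid_finite[OF M Suc.prems(1)] by simp
  then obtain Z where "Z \<in> Ind" "insert e X \<subseteq> Z" "Z \<subseteq> insert e X \<union> Y" "card Z = card Y"
    using Suc.hyps(1)[of "insert e X"] Suc.hyps(2) e(2) \<open>card X < card Y\<close> by (metis Suc_leI diff_Suc_1 diff_Suc_Suc Suc_diff_Suc)
  then show ?case using e by (intro bexI[of _ Z]) auto
qed

text \<open>In terms of spans: \<open>K\<close> consists of those j that s can replace in J. If no j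
  worked, then T = S - {s} would span \<open>K\<close>, while \<open>K\<close> spans s, so T would
  span s although S is independent. Spanning is expressed through sizes of independent sets, since S
  and J are merely independent sets of equal size.\<close>

lemma matroid_symmetric_exchange:
  assumes M: "matroid E Ind" and S: "S \<in> Ind" and J: "J \<in> Ind"
    and card: "card S = card J" and s: "s \<in> S - J"
  shows "\<exists>j\<in>J - S. insert j (S - {s}) \<in> Ind \<and> insert s (J - {j}) \<in> Ind"
proof (rule ccontr)
  assume neg: "\<not> ?thesis"
  define K where "K = {j \<in> J. insert s (J - {j}) \<in> Ind}"
  define T where "T = S - {s}"
  have finS: "finite S" and finJ: "finite J" using matroid_finite[OF M] S J by auto
  have T: "T \<in> Ind" using matroid_mono[OF M S] by (auto simp: T_def)
  have cT: "Suc (card T) = card S" unfolding T_def using s finS by (meson DiffD1 card_Suc_Diff1)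
  have KJ: "K \<subseteq> J" by (auto simp: K_def)
  have K: "K \<in> Ind" using matroid_mono[OF M J KJ] .
  have Ks: "insert s K \<notin> Ind"
  proof
    assume a: "insert s K \<in> Ind"
    have "K \<noteq> J"
    proof
      \<comment> \<open>If s can replace every element of J, any element of J that augments S - {s}
        serves both purposes.\<close>
      assume "K = J"
      moreover have "card (insert s J) = Suc (card J)" using s finJ by auto
      moreover have "card T < card J" using cT card by simp
      then obtain e where "e \<in> J - T" "insert e T \<in> Ind"
        using matroid_augment[OF M T J] by blast
      ultimately show False using neg s by (auto simp: T_def K_def)
    qed
    then have "card K < card J" using KJ finJ by (simp add: psubset_card_mono psubset_eq)
    then have "card (insert s K) \<le> card J"
      using s KJ finJ by (simp add: card_insert_if finite_subset)
    \<comment> \<open>\<open>Z\<close> arises from J by exchanging some j for s. Then j lies in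
      \<open>K\<close>, although \<open>Z\<close> contains \<open>K\<close> and misses j.\<close>
    then obtain Z where Z: "Z \<in> Ind" "insert s K \<subseteq> Z" "Z \<subseteq> insert s K \<union> J" "card Z = card J"
      using matroid_extend[OF M a J] by blast
    have "\<not> J \<subseteq> Z"
    proof
      assume "J \<subseteq> Z"
      then have "insert s J \<subseteq> Z" using Z by auto
      then have "card (insert s J) \<le> card Z" using matroid_finite[OF M Z(1)] card_mono by blast
      then show False using Z(4) s finJ by simp
    qed
    then obtain j where j: "j \<in> J" "j \<notin> Z" by auto
    have "Z \<subseteq> insert s (J - {j})" using Z KJ j by auto
    moreover have "card (insert s (J - {j})) = card J"
      using card_swap[of J j s] j s finJ by simp
    ultimately have "Z = insert s (J - {j})"
      using Z(4) finJ by (intro card_subset_eq) auto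
    then have "j \<in> K" using Z(1) j by (auto simp: K_def)
    then show False using Z(2) j by auto
  qed
  have small: "card Y \<le> card T" if Y: "Y \<in> Ind" "Y \<subseteq> K \<union> T" for Y
  proof (rule ccontr)
    assume "\<not> card Y \<le> card T"
    then obtain e where e: "e \<in> Y - T" "insert e T \<in> Ind"
      using matroid_augment[OF M T Y(1)] by (metis not_le)
    then have "e \<in> K" "e \<noteq> s" using Y(2) s KJ by auto
    then show False using neg e by (auto simp: K_def T_def)
  qed
  then have "card K \<le> card T" using K by auto
  then obtain Z where Z: "Z \<in> Ind" "K \<subseteq> Z" "Z \<subseteq> K \<union> T" "card Z = card T"
    using matroid_extend[OF M K T] by blast
  then obtain e where e: "e \<in> S - Z" "insert e Z \<in> Ind"
    using matroid_augment[OF M Z(1) S] cT by (metis lessI)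
  show False
  proof (cases "e = s")
    case True
    then show ?thesis using Ks matroid_mono[OF M e(2), of "insert s K"] Z(2) by auto
  next
    case False
    then have "insert e Z \<subseteq> K \<union> T" using e Z by (auto simp: T_def)
    then have "card (insert e Z) \<le> card T" using small e by blast
    then show False using Z e matroid_finite[OF M Z(1)] by simp
  qed
qed

text \<open>The edges of the exchange graph refer to S only, so J may be changed: a symmetric
  exchange matches j with s and leaves an independent set \<open>J'\<close> of the same size that is
  closer to S, to which induction applies.\<close>

lemma matroid_exchange_bijection:
  assumes M: "matroid E Ind" and S: "S \<in> Ind" and "J \<in> Ind" "card S = card J"
  shows "\<exists>\<sigma>. bij_betw \<sigma> (J - S) (S - J) \<and> (\<forall>j\<in>J - S. insert j (S - {\<sigma> j}) \<in> Ind)"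
  using assms(3,4)
proof (induction "card (S - J)" arbitrary: J)
  case 0
  have fin: "finite S" "finite J" using matroid_finite[OF M] S 0 by auto
  then have "S \<subseteq> J" using 0 by auto
  then have "S = J" using 0 fin by (intro card_subset_eq) auto
  then show ?case by auto
next
  case (Suc k)
  have fin: "finite S" "finite J" using matroid_finite[OF M] S Suc.prems by auto
  from Suc.hyps(2) obtain s where s: "s \<in> S - J" by (metis card.empty equals0I nat.distinct(1))
  obtain j where j: "j \<in> J - S" "insert j (S - {s}) \<in> Ind" "insert s (J - {j}) \<in> Ind"
    using matroid_symmetric_exchange[OF M S Suc.prems s] by blast
  define J' where "J' = insert s (J - {j})"
  have SJ': "S - J' = (S - J) - {s}" and J'S: "J' - S = (J - S) - {j}"
    using s j by (auto simp: J'_def)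
  have "k = card (S - J')" using Suc.hyps(2) s fin by (simp add: SJ')
  moreover have "card S = card J'"
    using Suc.prems card_swap[of J j s] s j fin by (simp add: J'_def)
  ultimately obtain \<sigma> where \<sigma>: "bij_betw \<sigma> (J' - S) (S - J')"
    "\<forall>j\<in>J' - S. insert j (S - {\<sigma> j}) \<in> Ind"
    using Suc.hyps(1)[of J'] j by (auto simp: J'_def)
  have "bij_betw (\<sigma>(j := s)) (J' - S) (S - J')"
    using \<sigma>(1) by (subst bij_betw_cong[of _ _ \<sigma>]) (auto simp: J'S)
  then have "bij_betw (\<sigma>(j := s)) ((J' - S) \<union> {j}) ((S - J') \<union> {s})"
    by (intro bij_betw_combine) (auto simp: SJ')
  moreover have "(J' - S) \<union> {j} = J - S" "(S - J') \<union> {s} = S - J"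
    using s j by (auto simp: SJ' J'S)
  ultimately have "bij_betw (\<sigma>(j := s)) (J - S) (S - J)" by simp
  moreover have "\<forall>i\<in>J - S. insert i (S - {(\<sigma>(j := s)) i}) \<in> Ind"
    using \<sigma>(2) j J'S by auto
  ultimately show ?case by blast
qed

text \<open>A minimal nonempty set that \<open>\<phi>\<close> maps into itself is mapped onto
  itself, hence permuted, and outside of it \<open>\<rho>\<close> is the identity. With
  \<open>\<phi>\<close> choosing a second neighbour for every vertex, \<open>\<rho>\<close>
  describes a second perfect matching.\<close>

lemma finite_cycle_of_map:
  assumes "finite I" "I \<noteq> {}" "\<And>i. i \<in> I \<Longrightarrow> \<phi> i \<in> I \<and> \<phi> i \<noteq> i"
  shows "\<exists>\<rho>. \<rho> permutes I \<and> \<rho> \<noteq> id \<and> (\<forall>i\<in>I. \<rho> i = \<phi> i \<or> \<rho> i = i)"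
proof -
  define \<Z> where "\<Z> = {Z. Z \<subseteq> I \<and> Z \<noteq> {} \<and> \<phi> ` Z \<subseteq> Z}"
  have "finite \<Z>" "I \<in> \<Z>" using assms by (auto simp: \<Z>_def)
  then obtain Z where Z: "Z \<in> \<Z>" "\<And>Y. Y \<in> \<Z> \<Longrightarrow> Y \<subseteq> Z \<Longrightarrow> Z = Y"
    using finite_has_minimal[of \<Z>] by blast
  have ZI: "Z \<subseteq> I" "Z \<noteq> {}" "\<phi> ` Z \<subseteq> Z" using Z(1) by (auto simp: \<Z>_def)
  then have "\<phi> ` Z \<in> \<Z>" by (auto simp: \<Z>_def)
  then have im: "\<phi> ` Z = Z" using Z(2)[of "\<phi> ` Z"] ZI by simp
  define \<rho> where "\<rho> i = (if i \<in> Z then \<phi> i else i)" for i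
  have "finite Z" using ZI assms finite_subset by blast
  then have "inj_on \<phi> Z" using im by (simp add: eq_card_imp_inj_on)
  then have "bij_betw \<phi> Z Z" using im by (simp add: bij_betw_def)
  then have "bij_betw \<rho> Z Z" by (subst bij_betw_cong[of _ _ \<phi>]) (auto simp: \<rho>_def)
  then have "\<rho> permutes Z" by (rule bij_imp_permutes) (auto simp: \<rho>_def)
  then have "\<rho> permutes I" using ZI permutes_subset by blast
  moreover from ZI obtain z where "z \<in> Z" by auto
  then have "\<rho> z \<noteq> z" using assms(3)[of z] ZI by (auto simp: \<rho>_def)
  then have "\<rho> \<noteq> id" by auto
  ultimately show ?thesis by (intro exI[of _ \<rho>]) (auto simp: \<rho>_def)
qed

text \<open>Uniqueness yields some \<open>a i\<close> whose only neighbour among the matched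
  elements is \<open>b i\<close>; otherwise second neighbours could be chosen everywhere, and a
  cycle of such choices would give another matching. The exchanges at all other indices are carried
  out first, and the one at i remains possible.\<close>

lemma unique_matching_exchange:
  assumes M: "matroid E Ind" and S: "S \<in> Ind" and base: "\<And>Y. Y \<in> Ind \<Longrightarrow> card Y \<le> card S"
    and "finite I" "inj_on a I" "a ` I \<inter> S = {}" "inj_on b I" "b ` I \<subseteq> S"
    and "\<And>i. i \<in> I \<Longrightarrow> insert (a i) (S - {b i}) \<in> Ind"
    and "\<And>\<rho>. \<rho> permutes I \<Longrightarrow> (\<And>i. i \<in> I \<Longrightarrow> insert (a i) (S - {b (\<rho> i)}) \<in> Ind) \<Longrightarrow> \<rho> = id"
  shows "(S - b ` I) \<union> a ` I \<in> Ind"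
  using assms(4-)
proof (induction "card I" arbitrary: I)
  case 0
  then show ?case using S by auto
next
  case (Suc k)
  note edge = Suc.prems(6) and uniq = Suc.prems(7)
  have finS: "finite S" using matroid_finite[OF M S] .
  have "\<exists>i\<in>I. \<forall>k\<in>I. k \<noteq> i \<longrightarrow> insert (a i) (S - {b k}) \<notin> Ind"
  proof (rule ccontr)
    assume "\<not> ?thesis"
    then have "\<forall>i\<in>I. \<exists>k. k \<in> I \<and> k \<noteq> i \<and> insert (a i) (S - {b k}) \<in> Ind" by blast
    then obtain \<phi> where \<phi>: "\<And>i. i \<in> I \<Longrightarrow> \<phi> i \<in> I \<and> \<phi> i \<noteq> i \<and> insert (a i) (S - {b (\<phi> i)}) \<in> Ind"
      by metis
    have "I \<noteq> {}" using Suc.hyps(2) by auto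
    then obtain \<rho> where \<rho>: "\<rho> permutes I" "\<rho> \<noteq> id" "\<forall>i\<in>I. \<rho> i = \<phi> i \<or> \<rho> i = i"
      using finite_cycle_of_map[of I \<phi>] \<phi> Suc.prems(1) by auto
    have "insert (a i) (S - {b (\<rho> i)}) \<in> Ind" if "i \<in> I" for i
      using \<rho>(3) \<phi>[OF that] edge[OF that] that by metis
    then show False using uniq \<rho> by blast
  qed
  then obtain i where i: "i \<in> I" "\<And>k. k \<in> I \<Longrightarrow> k \<noteq> i \<Longrightarrow> insert (a i) (S - {b k}) \<notin> Ind" by blast
  define I' where "I' = I - {i}"
  have I: "I = insert i I'" "i \<notin> I'" using i by (auto simp: I'_def)
  have "k = card I'" using Suc.hyps(2) Suc.prems(1) i by (simp add: I'_def)
  then have X: "(S - b ` I') \<union> a ` I' \<in> Ind" (is "?X \<in> Ind")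
  proof (rule Suc.hyps(1))
    fix \<rho> assume \<rho>: "\<rho> permutes I'" "\<And>j. j \<in> I' \<Longrightarrow> insert (a j) (S - {b (\<rho> j)}) \<in> Ind"
    have "\<rho> i = i" using \<rho>(1) I(2) by (simp add: permutes_not_in)
    then show "\<rho> = id"
      using \<rho> I edge by (intro uniq) (auto intro: permutes_subset)
  qed (use Suc.prems I in \<open>auto simp: inj_on_def\<close>)
  have cX: "card ?X = card S"
  proof -
    have "finite I'" using Suc.prems(1) I by auto
    have card_le: "card I' \<le> card S"
      using Suc.prems I finS card_inj_on_le[of b I' S] by (auto simp: inj_on_def)
    have "card ?X = card (S - b ` I') + card (a ` I')"
      using Suc.prems(3) I finS \<open>finite I'\<close> by (intro card_Un_disjoint) auto
    also have "card (S - b ` I') = card S - card I'"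
      using Suc.prems I finS by (subst card_Diff_subset) (auto simp: card_image inj_on_def)
    also have "card (a ` I') = card I'"
      using Suc.prems(2) I by (intro card_image) (auto simp: inj_on_def)
    finally show ?thesis using card_le by simp
  qed
  define Y where "Y = insert (a i) (S - b ` I)"
  have Y: "Y \<in> Ind"
    unfolding Y_def using i(1) by (intro matroid_mono[OF M edge[OF i(1)]]) auto
  \<comment> \<open>Here the choice of i enters: a set of size \<open>card S\<close> containing
    \<open>Y\<close> and \<open>b i\<close> would come from S by exchanging \<open>a i\<close> for
    some other \<open>b k\<close>.\<close>
  have nY: "insert (b i) Y \<notin> Ind"
  proof
    assume a: "insert (b i) Y \<in> Ind"
    obtain Z where Z: "Z \<in> Ind" "insert (b i) Y \<subseteq> Z" "Z \<subseteq> insert (b i) Y \<union> S" "card Z = card S"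
      using matroid_extend[OF M a S base[OF a]] by blast
    have aS: "a i \<notin> S" using Suc.prems(3) i by auto
    have "\<not> S \<subseteq> Z"
    proof
      assume "S \<subseteq> Z"
      then have "insert (a i) S \<subseteq> Z" using Z by (auto simp: Y_def)
      then have "card (insert (a i) S) \<le> card Z" using matroid_finite[OF M Z(1)] card_mono by blast
      then show False using Z(4) aS finS by simp
    qed
    then obtain c where c: "c \<in> S" "c \<notin> Z" by auto
    then have "c \<in> b ` I'" using Z(2) I by (auto simp: Y_def)
    then obtain k where k: "k \<in> I" "k \<noteq> i" "c = b k" using I by auto
    have "b i \<in> S" using Suc.prems(5) i by auto
    then have "Z \<subseteq> insert (a i) (S - {c})" using Z(3) c by (auto simp: Y_def)
    moreover have "card (insert (a i) (S - {c})) = card S"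
      using card_swap[of S c "a i"] aS c finS by simp
    ultimately have "Z = insert (a i) (S - {c})"
      using Z(4) finS by (intro card_subset_eq) auto
    then show False using i(2) k Z(1) by auto
  qed
  \<comment> \<open>The extension cannot use \<open>b i\<close>, so by its size it must be the
    desired set.\<close>
  obtain Z where Z: "Z \<in> Ind" "Y \<subseteq> Z" "Z \<subseteq> Y \<union> ?X" "card Z = card ?X"
    using matroid_extend[OF M Y X] base[OF Y] cX by auto
  have "b i \<notin> Z" using nY Z matroid_mono[OF M Z(1)] by auto
  have sub: "Z \<subseteq> (S - b ` I) \<union> a ` I" (is "_ \<subseteq> ?T")
    using Z(3) \<open>b i \<notin> Z\<close> I by (auto simp: Y_def)
  have bi: "b i \<in> ?X"
    using Suc.prems(4,5) I by (auto simp: inj_on_def)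
  have ai: "a i \<notin> ?X - {b i}"
    using Suc.prems(2,3) I by (auto simp: inj_on_def)
  have "?T = insert (a i) (?X - {b i})"
    using Suc.prems(3,5) I bi by (auto simp: inj_on_def)
  moreover have "card (insert (a i) (?X - {b i})) = card ?X"
    using card_swap'[of ?X "b i" "a i"] bi ai matroid_finite[OF M X] by blast
  ultimately have "Z = ?T"
    using Z(4) sub matroid_finite[OF M X] by (intro card_subset_eq) auto
  then show ?case using Z(1) by simp
qed

section \<open>Closed walks in the exchange graphs of two matroids\<close>

text \<open>The vertices alternate as b i, a i, b (i + 1), along edges of \<open>G2\<close> and
  \<open>G1\<close> in turn. Periodic sequences over the integers can be shifted and reversed
  freely, and a vertex may occur several times within a period.\<close>

definition closed_walk :: "('b \<Rightarrow> 'b \<Rightarrow> bool) \<Rightarrow> ('b \<Rightarrow> 'b \<Rightarrow> bool) \<Rightarrow> nat \<Rightarrow> (int \<Rightarrow> 'b) \<Rightarrow> (int \<Rightarrow> 'b) \<Rightarrow> bool" where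
  "closed_walk G1 G2 L a b \<longleftrightarrow> L > 0 \<and>
     (\<forall>i. a (i + int L) = a i \<and> b (i + int L) = b i \<and> G1 (a i) (b (i + 1)) \<and> G2 (a i) (b i))"

lemma periodic_mod:
  fixes F :: "int \<Rightarrow> 'c"
  assumes "\<And>i. F (i + L) = F i"
  shows "F (i mod L) = F i"
proof -
  have up: "F (i + int n * L) = F i" for i n
  proof (induction n)
    case (Suc n)
    then show ?case using assms[of "i + int n * L"] by (simp add: algebra_simps)
  qed simp
  have all: "F (i + k * L) = F i" for i k
  proof (cases "k \<ge> 0")
    case True
    then show ?thesis using up[of i "nat k"] by simp
  next
    case False
    then show ?thesis using up[of "i + k * L" "nat (- k)"] by simp
  qed
  have "i mod L = i + (- (i div L)) * L" by (simp add: minus_div_mult_eq_mod [symmetric])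
  then show ?thesis using all by metis
qed

lemma sum_periodic_shift:
  fixes F :: "int \<Rightarrow> real"
  assumes per: "\<And>i. F (i + int L) = F i" and L: "L > 0"
  shows "(\<Sum>i\<in>{0..<int L}. F (i + s)) = (\<Sum>i\<in>{0..<int L}. F i)"
proof (rule sum.reindex_bij_witness[of _ "\<lambda>j. (j - s) mod int L" "\<lambda>i. (i + s) mod int L"])
  fix i assume i: "i \<in> {0..<int L}"
  show "((i + s) mod int L - s) mod int L = i"
    using i by (simp add: mod_diff_left_eq)
  show "(i + s) mod int L \<in> {0..<int L}" using L by simp
  show "F ((i + s) mod int L) = F (i + s)" using periodic_mod[of F, OF per] .
next
  fix i assume i: "i \<in> {0..<int L}"
  show "((i - s) mod int L + s) mod int L = i" using i by (simp add: mod_add_left_eq)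
  show "(i - s) mod int L \<in> {0..<int L}" using L by simp
qed

lemma sum_int_shift:
  fixes F :: "int \<Rightarrow> real"
  shows "(\<Sum>i\<in>{0..<n}. F (y + i)) = (\<Sum>i\<in>{y..<y + n}. F i)"
  by (rule sum.reindex_bij_witness[of _ "\<lambda>j. j - y" "\<lambda>i. y + i"]) auto

text \<open>The displacements sum to zero, so they cannot all be nonpositive unless all of them
  vanish.\<close>

lemma permutes_not_id_greater:
  fixes \<rho> :: "int \<Rightarrow> int"
  assumes "finite I" "\<rho> permutes I" "\<rho> \<noteq> id"
  shows "\<exists>x\<in>I. \<rho> x > x"
proof (rule ccontr)
  assume "\<not> ?thesis"
  then have le: "\<rho> x \<le> x" if "x \<in> I" for x using that by force
  have "(\<Sum>x\<in>I. \<rho> x) = (\<Sum>x\<in>I. x)"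
    using sum.permute[OF assms(2), of "\<lambda>x. x"] by (simp add: o_def)
  then have "(\<Sum>x\<in>I. x - \<rho> x) = 0" by (simp add: sum_subtractf)
  then have "\<forall>x\<in>I. x - \<rho> x = 0"
    using le assms(1) by (subst (asm) sum_nonneg_eq_0_iff) auto
  then have "\<rho> x = x" for x using assms(2) by (cases "x \<in> I") (auto simp: permutes_not_in)
  then show False using assms(3) by auto
qed

lemma closed_walk_shift:
  assumes "closed_walk G1 G2 L a b"
  shows "closed_walk G1 G2 L (\<lambda>i. a (i + s)) (\<lambda>i. b (i + s))"
  unfolding closed_walk_def
proof (intro conjI allI)
  show "L > 0" using assms by (auto simp: closed_walk_def)
  fix i
  have *: "a (i + s + int L) = a (i + s)" "b (i + s + int L) = b (i + s)"
    "G1 (a (i + s)) (b (i + s + 1))" "G2 (a (i + s)) (b (i + s))"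
    using assms by (auto simp: closed_walk_def)
  then show "a (i + int L + s) = a (i + s)" "b (i + int L + s) = b (i + s)"
    "G1 (a (i + s)) (b (i + 1 + s))" "G2 (a (i + s)) (b (i + s))"
    by (simp_all add: algebra_simps)
qed

text \<open>Reversal interchanges the two graphs, which reduces chords in \<open>G2\<close> to
  chords in \<open>G1\<close>. The offset in \<open>b\<close> reflects that a i lies between b i and
  b (i + 1).\<close>

lemma closed_walk_reverse:
  assumes "closed_walk G1 G2 L a b"
  shows "closed_walk G2 G1 L (\<lambda>i. a (- i)) (\<lambda>i. b (1 - i))"
  unfolding closed_walk_def
proof (intro conjI allI)
  show "L > 0" using assms by (auto simp: closed_walk_def)
  fix i
  have per: "a (j + int L) = a j" "b (j + int L) = b j" for j
    using assms by (auto simp: closed_walk_def)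
  show "a (- (i + int L)) = a (- i)" using per(1)[of "- i - int L"] by simp
  show "b (1 - (i + int L)) = b (1 - i)" using per(2)[of "1 - i - int L"] by (simp add: algebra_simps)
  show "G2 (a (- i)) (b (1 - (i + 1)))" using assms by (simp add: closed_walk_def)
  have "G1 (a (- i)) (b (- i + 1))" using assms unfolding closed_walk_def by blast
  then show "G1 (a (- i)) (b (1 - i))" by (simp add: algebra_simps)
qed

text \<open>
  The chord from \<open>a x\<close> to \<open>b (\<rho> x + 1)\<close> and the stretch of the walk from position \<open>\<rho> x + 1\<close> on to
  position \<open>x\<close> form a closed walk; over all \<open>x\<close> these stretches cover every position equally often.
\<close>

lemma closed_walk_shortcut:
  fixes g :: "'b \<Rightarrow> 'b \<Rightarrow> real"
  assumes walk: "closed_walk G1 G2 L a b"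
    and \<rho>: "\<rho> permutes {0..<int L}" "\<rho> \<noteq> id"
    and chord: "\<And>x. x \<in> {0..<int L} \<Longrightarrow> G1 (a x) (b (\<rho> x + 1))"
    and IH: "\<And>L' a' b'. closed_walk G1 G2 L' a' b' \<Longrightarrow> L' < L \<Longrightarrow>
               (\<Sum>i\<in>{0..<int L'}. g (a' i) (b' i)) \<le> 0"
  shows "(\<Sum>i\<in>{0..<int L}. g (a i) (b i)) \<le> 0"
proof -
  have L: "L > 0" and per: "a (i + int L) = a i" "b (i + int L) = b i"
    and G1: "G1 (a i) (b (i + 1))" and G2: "G2 (a i) (b i)" for i
    using walk by (auto simp: closed_walk_def)
  define F where "F i = g (a i) (b i)" for i
  define P where "P i = (\<Sum>j\<in>{0..<i}. F j)" for i
  define tot where "tot = P (int L)"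
  have P_add: "P (i + n) = P i + (\<Sum>j\<in>{i..<i + n}. F j)" if "i \<ge> 0" "n \<ge> 0" for i n
  proof -
    have "{0..<i + n} = {0..<i} \<union> {i..<i + n}" using that by auto
    then show ?thesis unfolding P_def by (simp add: sum.union_disjoint)
  qed
  have P_wrap: "P (i + int L) = P i + tot" if "i \<ge> 0" for i
  proof -
    have "(\<Sum>j\<in>{i..<i + int L}. F j) = tot"
      using sum_int_shift[where F = F and y = i and n = "int L"]
        sum_periodic_shift[where F = F and L = L and s = i] L per
      by (simp add: tot_def P_def F_def add.commute)
    then show ?thesis using P_add[of i "int L"] that by simp
  qed
  \<comment> \<open>At a fixed point of \<open>\<rho>\<close> the chord is an edge of the walk
    itself and the stretch is the entire walk of length \<open>L\<close>, which induction does not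
    cover; its contribution \<open>tot\<close> is subtracted below.\<close>
  define len where "len x = (if \<rho> x < x then x - \<rho> x else x - \<rho> x + int L)" for x
  have \<rho>_in: "\<rho> x \<in> {0..<int L}" if "x \<in> {0..<int L}" for x
    using permutes_in_image[OF \<rho>(1)] that by blast
  have arc: "P (\<rho> x + 1 + len x) - P (\<rho> x + 1) = P (x + 1) - P (\<rho> x + 1) + (if \<rho> x \<ge> x then tot else 0)"
    if x: "x \<in> {0..<int L}" for x
    using P_wrap[of "x + 1"] x by (auto simp: len_def algebra_simps)
  have small: "P (\<rho> x + 1 + len x) - P (\<rho> x + 1) \<le> 0" if x: "x \<in> {0..<int L}" "\<rho> x \<noteq> x" for x
  proof -
    define l where "l = nat (len x)"
    define a' where "a' i = a (\<rho> x + 1 + i mod int l)" for i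
    define b' where "b' i = b (\<rho> x + 1 + i mod int l)" for i
    have l: "l > 0" "l < L" "int l = len x"
      using x \<rho>_in[of x] by (auto simp: l_def len_def)
    have "closed_walk G1 G2 l a' b'"
      unfolding closed_walk_def
    proof (intro conjI allI)
      fix i
      show "a' (i + int l) = a' i" "b' (i + int l) = b' i" by (simp_all add: a'_def b'_def)
      show "G2 (a' i) (b' i)" using G2 by (simp add: a'_def b'_def)
      have succ_mod: "(i + 1) mod int l = (i mod int l + 1) mod int l" by (simp add: mod_add_left_eq)
      show "G1 (a' i) (b' (i + 1))"
      proof (cases "i mod int l = int l - 1")
        case True
        then have "(i + 1) mod int l = 0" using succ_mod by simp
        moreover have "a (\<rho> x + len x) = a x" using per(1)[of x] by (auto simp: len_def algebra_simps)
        ultimately show ?thesis using chord[OF x(1)] True l by (simp add: a'_def b'_def)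
      next
        case False
        moreover have "0 \<le> i mod int l" "i mod int l < int l" using l by simp_all
        ultimately have "(i + 1) mod int l = i mod int l + 1"
          unfolding succ_mod by (intro mod_pos_pos_trivial) auto
        then show ?thesis using G1[of "\<rho> x + 1 + i mod int l"] by (simp add: a'_def b'_def add.assoc)
      qed
    qed (use l in auto)
    then have "(\<Sum>i\<in>{0..<int l}. g (a' i) (b' i)) \<le> 0" using IH l by blast
    also have "(\<Sum>i\<in>{0..<int l}. g (a' i) (b' i)) = (\<Sum>i\<in>{0..<int l}. F (\<rho> x + 1 + i))"
      by (intro sum.cong) (auto simp: a'_def b'_def F_def)
    also have "\<dots> = P (\<rho> x + 1 + len x) - P (\<rho> x + 1)"
      using P_add[of "\<rho> x + 1" "len x"] \<rho>_in[OF x(1)] l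
      by (simp add: sum_int_shift)
    finally show ?thesis .
  qed
  have perm: "(\<Sum>x\<in>{0..<int L}. P (\<rho> x + 1)) = (\<Sum>x\<in>{0..<int L}. P (x + 1))"
    using sum.permute[OF \<rho>(1), of "\<lambda>x. P (x + 1)"] by (simp add: o_def)
  \<comment> \<open>The prefix sums cancel because \<open>\<rho>\<close> is a permutation. What
    remains is one full turn for each stretch that wraps around, apart from the fixed
    points.\<close>
  have "real (card {x\<in>{0..<int L}. \<rho> x > x}) * tot =
      (\<Sum>x\<in>{0..<int L}. P (\<rho> x + 1 + len x) - P (\<rho> x + 1) - (if \<rho> x = x then tot else 0))"
  proof -
    have "(\<Sum>x\<in>{0..<int L}. P (\<rho> x + 1 + len x) - P (\<rho> x + 1) - (if \<rho> x = x then tot else 0))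
        = (\<Sum>x\<in>{0..<int L}. P (x + 1) - P (\<rho> x + 1) + (if \<rho> x > x then tot else 0))"
      by (intro sum.cong refl) (auto simp: arc)
    also have "\<dots> = (\<Sum>x\<in>{0..<int L}. (if \<rho> x > x then tot else 0))"
      by (simp add: sum.distrib sum_subtractf perm)
    also have "\<dots> = (\<Sum>x\<in>{x\<in>{0..<int L}. \<rho> x > x}. tot)"
      by (intro sum.mono_neutral_cong_right) auto
    finally show ?thesis by simp
  qed
  also have "\<dots> \<le> 0"
  proof (rule sum_nonpos)
    fix x assume x: "x \<in> {0..<int L}"
    show "P (\<rho> x + 1 + len x) - P (\<rho> x + 1) - (if \<rho> x = x then tot else 0) \<le> 0"
      using small[OF x] arc[OF x] by auto
  qed
  finally have "real (card {x\<in>{0..<int L}. \<rho> x > x}) * tot \<le> 0" .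
  moreover have "card {x\<in>{0..<int L}. \<rho> x > x} > 0"
    using permutes_not_id_greater[OF _ \<rho>] finite_subset[of "{x\<in>{0..<int L}. \<rho> x > x}" "{0..<int L}"]
    unfolding card_gt_0_iff by blast
  ultimately have "tot \<le> 0" by (simp add: mult_le_0_iff)
  then show ?thesis by (simp add: tot_def P_def F_def)
qed

lemma sum_periodic_reflect:
  fixes F :: "int \<Rightarrow> real"
  assumes per: "\<And>i. F (i + int L) = F i" and L: "L > 0"
  shows "(\<Sum>i\<in>{0..<int L}. F (s - i)) = (\<Sum>i\<in>{0..<int L}. F i)"
proof -
  have "(\<Sum>i\<in>{0..<int L}. F (s - i)) = (\<Sum>i\<in>{0..<int L}. F (s - (int L - 1 - i)))"
    by (rule sum.reindex_bij_witness[of _ "\<lambda>i. int L - 1 - i" "\<lambda>i. int L - 1 - i"]) auto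
  also have "\<dots> = (\<Sum>i\<in>{0..<int L}. F (i + (s - int L + 1)))"
    by (simp add: algebra_simps)
  also have "\<dots> = (\<Sum>i\<in>{0..<int L}. F i)"
    using sum_periodic_shift[of F L] per L by blast
  finally show ?thesis .
qed

definition swap_edge :: "'b set \<Rightarrow> 'b set \<Rightarrow> 'b set set \<Rightarrow> 'b \<Rightarrow> 'b \<Rightarrow> bool" where
  "swap_edge S J Ind x y \<longleftrightarrow> x \<in> J \<and> y \<in> S \<and> insert x (S - {y}) \<in> Ind"

text \<open>Induction on the length. If the sum were positive, neither graph could have a second
  matching along the walk, since \<open>closed_walk_shortcut\<close> would reduce the claim to
  shorter walks. Uniqueness makes the vertices distinct and every segment a feasible exchange.
  Averaging \<open>opt\<close> over all shifts counts each \<open>a i\<close> p times and each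
  \<open>b i\<close> p + 1 times; a walk with at most p elements of J is a single exchange.\<close>

lemma closed_walk_bound:
  fixes u w :: "'b \<Rightarrow> real"
  assumes M1: "matroid E1 Ind1" and M2: "matroid E2 Ind2" and S1: "S \<in> Ind1" and S2: "S \<in> Ind2"
    and base1: "\<And>Y. Y \<in> Ind1 \<Longrightarrow> card Y \<le> card S"
    and base2: "\<And>Y. Y \<in> Ind2 \<Longrightarrow> card Y \<le> card S"
    and disj: "J \<inter> S = {}" and p: "p > 0" and w: "\<And>y. y \<in> S \<Longrightarrow> w y \<ge> 0"
    and opt: "\<And>A R. A \<subseteq> J \<Longrightarrow> R \<subseteq> S \<Longrightarrow> card A \<le> p \<Longrightarrow> card R \<le> p + 1 \<Longrightarrow>
      (S - R) \<union> A \<in> Ind1 \<Longrightarrow> (S - R) \<union> A \<in> Ind2 \<Longrightarrow> sum u A \<le> sum w R"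
    and walk: "closed_walk (swap_edge S J Ind1) (swap_edge S J Ind2) L a b"
  shows "(\<Sum>i\<in>{0..<int L}. real p * u (a i) - real (p + 1) * w (b i)) \<le> 0"
  using walk
proof (induction L arbitrary: a b rule: less_induct)
  case (less L)
  let ?G1 = "swap_edge S J Ind1" and ?G2 = "swap_edge S J Ind2"
  define tot where "tot a b = (\<Sum>i\<in>{0..<int L}. real p * u (a i) - real (p + 1) * w (b i))"
    for a b :: "int \<Rightarrow> 'b"
  have short: "tot a b \<le> 0" if walk: "closed_walk ?G1 ?G2 L a b"
    and "\<rho> permutes {0..<int L}" "\<rho> \<noteq> id" "\<And>x. x \<in> {0..<int L} \<Longrightarrow> ?G1 (a x) (b (\<rho> x + 1))"
    for a b \<rho>
    unfolding tot_def
    using closed_walk_shortcut[OF that, where g = "\<lambda>x y. real p * u x - real (p + 1) * w y"] less.IH by blast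
  \<comment> \<open>Chords in the second graph: position x becomes L - 1 - x, and
    \<open>\<rho>\<close> is conjugated by this reflection.\<close>
  have short': "tot a b \<le> 0" if walk: "closed_walk ?G1 ?G2 L a b"
    and \<rho>: "\<rho> permutes {0..<int L}" "\<rho> \<noteq> id" and chord: "\<And>x. x \<in> {0..<int L} \<Longrightarrow> ?G2 (a x) (b (\<rho> x))"
    for a b \<rho>
  proof -
    have L: "L > 0" and per: "a (i + int L) = a i" "b (i + int L) = b i" for i
      using walk by (auto simp: closed_walk_def)
    define a' where "a' i = a (int L - 1 - i)" for i
    define b' where "b' i = b (int L - i)" for i
    have walk': "closed_walk ?G2 ?G1 L a' b'"
      using closed_walk_shift[OF closed_walk_reverse[OF walk], of "1 - int L"]
      unfolding a'_def b'_def by (simp add: algebra_simps)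
    define rev where "rev i = (if i \<in> {0..<int L} then int L - 1 - i else i)" for i
    have rev: "rev permutes {0..<int L}"
      by (rule bij_imp_permutes, rule bij_betwI[of _ _ _ rev]) (auto simp: rev_def)
    have rr: "rev (rev i) = i" for i by (auto simp: rev_def)
    define \<rho>' where "\<rho>' = rev \<circ> \<rho> \<circ> rev"
    have \<rho>': "\<rho>' permutes {0..<int L}"
      unfolding \<rho>'_def using permutes_compose[OF rev permutes_compose[OF \<rho>(1) rev]]
      by (simp add: o_assoc)
    have "\<rho>' \<noteq> id"
    proof
      assume "\<rho>' = id"
      then have "rev (\<rho>' (rev i)) = i" for i by (simp add: rr)
      then have "\<rho> i = i" for i by (simp add: \<rho>'_def rr)
      then show False using \<rho>(2) by auto
    qed
    have chord': "?G2 (a' x) (b' (\<rho>' x + 1))" if x: "x \<in> {0..<int L}" for x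
    proof -
      have y: "rev x = int L - 1 - x" "rev x \<in> {0..<int L}" using x by (auto simp: rev_def)
      then have "\<rho> (rev x) \<in> {0..<int L}" using permutes_in_image[OF \<rho>(1)] by blast
      then have "b' (\<rho>' x + 1) = b (\<rho> (rev x))" by (auto simp: b'_def \<rho>'_def rev_def[of "\<rho> _"])
      then show ?thesis using chord[OF y(2)] y(1) by (simp add: a'_def)
    qed
    have "(\<Sum>i\<in>{0..<int L}. real p * u (a' i) - real (p + 1) * w (b' i)) \<le> 0"
    proof (rule closed_walk_shortcut[OF walk' \<rho>' \<open>\<rho>' \<noteq> id\<close> chord',
          where g = "\<lambda>x y. real p * u x - real (p + 1) * w y"])
      fix L' a'' b'' assume walk'': "closed_walk ?G2 ?G1 L' a'' b''" and "L' < L"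
      have L': "L' > 0" and per': "a'' (i + int L') = a'' i" "b'' (i + int L') = b'' i" for i
        using walk'' by (auto simp: closed_walk_def)
      \<comment> \<open>The shorter walks have the graphs interchanged; reversing them once more
        brings them under the induction hypothesis.\<close>
      have "(\<Sum>i\<in>{0..<int L'}. real p * u (a'' (- i)) - real (p + 1) * w (b'' (1 - i))) \<le> 0"
        using less.IH[OF \<open>L' < L\<close> closed_walk_reverse[OF walk'']] .
      then show "(\<Sum>i\<in>{0..<int L'}. real p * u (a'' i) - real (p + 1) * w (b'' i)) \<le> 0"
        using sum_periodic_reflect[of "\<lambda>i. u (a'' i)" L' 0] sum_periodic_reflect[of "\<lambda>i. w (b'' i)" L' 1] L' per'
        by (simp add: sum_subtractf sum_distrib_left [symmetric])
    qed
    then show ?thesis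
      using sum_periodic_reflect[of "\<lambda>i. u (a i)" L "int L - 1"] sum_periodic_reflect[of "\<lambda>i. w (b i)" L "int L"] L per
      by (simp add: tot_def a'_def b'_def sum_subtractf sum_distrib_left [symmetric])
  qed
  \<comment> \<open>The first matroid uses b 1, ..., b q and the second b 0, ..., b (q - 1). An open
    segment therefore needs q' = q + 1, while q' = q suffices once the segment is the whole
    walk.\<close>
  have seg: "(\<Sum>i\<in>{0..<int q}. u (a i)) \<le> (\<Sum>i\<in>{0..<int q'}. w (b i))"
    if walk: "closed_walk ?G1 ?G2 L a b" and pos: "tot a b > 0" and q: "q \<le> p" "q \<le> q'" "q' \<le> L" "q' \<le> q + 1"
      "(\<lambda>i. b (i + 1)) ` {0..<int q} \<subseteq> b ` {0..<int q'}" for a b q q'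
  proof -
    have G1: "?G1 (a i) (b (i + 1))" and G2: "?G2 (a i) (b i)" for i
      using walk by (auto simp: closed_walk_def)
    have u1: "\<rho> = id" if "\<rho> permutes {0..<int L}" "\<And>x. x \<in> {0..<int L} \<Longrightarrow> ?G1 (a x) (b (\<rho> x + 1))" for \<rho>
      using short[OF walk that(1) _ that(2)] pos by force
    have u2: "\<rho> = id" if "\<rho> permutes {0..<int L}" "\<And>x. x \<in> {0..<int L} \<Longrightarrow> ?G2 (a x) (b (\<rho> x))" for \<rho>
      using short'[OF walk that(1) _ that(2)] pos by force
    \<comment> \<open>A repeated vertex would let two positions swap partners, which is a second
      matching.\<close>
    have inja: "i = j" if "i \<in> {0..<int L}" "j \<in> {0..<int L}" "a i = a j" for i j
    proof -
      have "?G2 (a x) (b (Transposition.transpose i j x))" for x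
        using G2[of i] G2[of j] G2[of x] that(3) by (auto simp: Transposition.transpose_def)
      then show ?thesis using u2[OF permutes_swap_id[OF that(1,2)]] transpose_eq_id_iff by metis
    qed
    have injb: "i = j" if "i \<in> {0..<int L}" "j \<in> {0..<int L}" "b i = b j" for i j
    proof -
      have "?G2 (a x) (b (Transposition.transpose i j x))" for x
        using G2[of i] G2[of j] G2[of x] that(3) by (auto simp: Transposition.transpose_def)
      then show ?thesis using u2[OF permutes_swap_id[OF that(1,2)]] transpose_eq_id_iff by metis
    qed
    have injb1: "i = j" if "i \<in> {0..<int L}" "j \<in> {0..<int L}" "b (i + 1) = b (j + 1)" for i j
    proof -
      have "?G1 (a x) (b (Transposition.transpose i j x + 1))" for x
        using G1[of i] G1[of j] G1[of x] that(3) by (auto simp: Transposition.transpose_def)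
      then show ?thesis using u1[OF permutes_swap_id[OF that(1,2)]] transpose_eq_id_iff by metis
    qed
    let ?I = "{0..<int q}"
    define A where "A = a ` ?I"
    define R where "R = b ` {0..<int q'}"
    have AJ: "A \<subseteq> J" and RS: "R \<subseteq> S" using G2 by (auto simp: A_def R_def swap_edge_def)
    have sub: "{0..<int q} \<subseteq> {0..<int L}" using q by auto
    have e1: "(S - (\<lambda>i. b (i + 1)) ` ?I) \<union> a ` ?I \<in> Ind1"
    proof (rule unique_matching_exchange[OF M1 S1 base1])
      show "inj_on a ?I" using inja sub by (meson inj_onI subsetD)
      show "inj_on (\<lambda>i. b (i + 1)) ?I" using injb1 sub by (meson inj_onI subsetD)
      show "a ` ?I \<inter> S = {}" using G1 disj by (auto simp: swap_edge_def)
      show "(\<lambda>i. b (i + 1)) ` ?I \<subseteq> S" using G1 by (auto simp: swap_edge_def)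
      show "insert (a i) (S - {b (i + 1)}) \<in> Ind1" for i using G1 by (simp add: swap_edge_def)
      fix \<rho> assume \<rho>: "\<rho> permutes ?I" "\<And>i. i \<in> ?I \<Longrightarrow> insert (a i) (S - {b (\<rho> i + 1)}) \<in> Ind1"
      show "\<rho> = id"
      proof (rule u1[OF permutes_subset[OF \<rho>(1) sub]])
        fix x
        show "?G1 (a x) (b (\<rho> x + 1))"
        proof (cases "x \<in> ?I")
          case True
          then show ?thesis using \<rho>(2) G1 by (auto simp: swap_edge_def)
        next
          case False
          then show ?thesis using permutes_not_in[OF \<rho>(1)] G1 by simp
        qed
      qed
    qed simp_all
    have e2: "(S - b ` ?I) \<union> a ` ?I \<in> Ind2"
    proof (rule unique_matching_exchange[OF M2 S2 base2])
      show "inj_on a ?I" using inja sub by (meson inj_onI subsetD)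
      show "inj_on b ?I" using injb sub by (meson inj_onI subsetD)
      show "a ` ?I \<inter> S = {}" using G2 disj by (auto simp: swap_edge_def)
      show "b ` ?I \<subseteq> S" using G2 by (auto simp: swap_edge_def)
      show "insert (a i) (S - {b i}) \<in> Ind2" for i using G2 by (simp add: swap_edge_def)
      fix \<rho> assume \<rho>: "\<rho> permutes ?I" "\<And>i. i \<in> ?I \<Longrightarrow> insert (a i) (S - {b (\<rho> i)}) \<in> Ind2"
      show "\<rho> = id"
      proof (rule u2[OF permutes_subset[OF \<rho>(1) sub]])
        fix x
        show "?G2 (a x) (b (\<rho> x))"
        proof (cases "x \<in> ?I")
          case True
          then show ?thesis using \<rho>(2) G2 by (auto simp: swap_edge_def)
        next
          case False
          then show ?thesis using permutes_not_in[OF \<rho>(1)] G2 by simp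
        qed
      qed
    qed simp_all
    have "(S - R) \<union> A \<in> Ind1"
      using q(5) by (intro matroid_mono[OF M1 e1]) (auto simp: A_def R_def)
    moreover have "b ` ?I \<subseteq> R" using q(2) by (auto simp: R_def)
    then have "(S - R) \<union> A \<in> Ind2"
      by (intro matroid_mono[OF M2 e2]) (auto simp: A_def)
    moreover have "card A \<le> p" using card_image_le[of ?I a] q by (simp add: A_def)
    moreover have "card R \<le> p + 1" using card_image_le[of "{0..<int q'}" b] q by (simp add: R_def)
    ultimately have "sum u A \<le> sum w R" using opt[OF AJ RS] by blast
    moreover have "sum u A = (\<Sum>i\<in>?I. u (a i))"
      unfolding A_def using inja sub by (subst sum.reindex) (auto simp: inj_on_def)
    moreover have "sum w R = (\<Sum>i\<in>{0..<int q'}. w (b i))"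
      unfolding R_def using injb q by (subst sum.reindex) (auto simp: inj_on_def)
    ultimately show ?thesis by simp
  qed
  have walk: "closed_walk ?G1 ?G2 L a b" by fact
  have L: "L > 0" and per: "a (i + int L) = a i" "b (i + int L) = b i" and G2: "?G2 (a i) (b i)" for i
    using walk by (auto simp: closed_walk_def)
  have "tot a b \<le> 0"
  proof (rule ccontr)
    assume "\<not> ?thesis"
    then have pos: "tot a b > 0" by simp
    let ?U = "\<Sum>i\<in>{0..<int L}. u (a i)" and ?W = "\<Sum>i\<in>{0..<int L}. w (b i)"
    have tot: "tot a b = real p * ?U - real (p + 1) * ?W"
      by (simp add: tot_def sum_subtractf sum_distrib_left)
    have W: "?W \<ge> 0" using G2 w by (intro sum_nonneg) (auto simp: swap_edge_def)
    show False
    proof (cases "L \<le> p")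
      case True
      have "(\<lambda>i. b (i + 1)) ` {0..<int L} \<subseteq> b ` {0..<int L}"
      proof (clarify)
        fix i assume i: "i \<in> {0..<int L}"
        have "b (i + 1) = b ((i + 1) mod int L)" using periodic_mod[of b, OF per(2)] by simp
        then show "b (i + 1) \<in> b ` {0..<int L}" using L by auto
      qed
      then have "?U \<le> ?W" using seg[OF walk pos, of L L] True by simp
      then have "real p * ?U \<le> real p * ?W" by (rule mult_left_mono) simp
      also have "\<dots> \<le> real (p + 1) * ?W" using W by (intro mult_right_mono) auto
      finally show ?thesis using pos tot by simp
    next
      case False
      have s: "(\<Sum>i\<in>{0..<int p}. u (a (i + s))) \<le> (\<Sum>i\<in>{0..<int (p + 1)}. w (b (i + s)))" for s
      proof (rule seg[OF closed_walk_shift[OF walk]])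
        have "tot (\<lambda>i. a (i + s)) (\<lambda>i. b (i + s)) = tot a b"
          unfolding tot_def
          using sum_periodic_shift[of "\<lambda>i. real p * u (a i) - real (p + 1) * w (b i)" L s] per L by simp
        then show "tot (\<lambda>i. a (i + s)) (\<lambda>i. b (i + s)) > 0" using pos by simp
        show "(\<lambda>i. b (i + 1 + s)) ` {0..<int p} \<subseteq> (\<lambda>i. b (i + s)) ` {0..<int (p + 1)}"
        proof clarify
          fix i assume "i \<in> {0..<int p}"
          then have "i + 1 \<in> {0..<int (p + 1)}" by auto
          then show "b (i + 1 + s) \<in> (\<lambda>i. b (i + s)) ` {0..<int (p + 1)}" by blast
        qed
      qed (use False in auto)
      have "(\<Sum>s\<in>{0..<int L}. \<Sum>i\<in>{0..<int p}. u (a (i + s))) = (\<Sum>i\<in>{0..<int p}. \<Sum>s\<in>{0..<int L}. u (a (s + i)))"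
        by (subst sum.swap) (simp add: add.commute)
      also have "\<dots> = (\<Sum>i\<in>{0..<int p}. ?U)"
        using sum_periodic_shift[of "\<lambda>i. u (a i)" L] per L by simp
      finally have U: "(\<Sum>s\<in>{0..<int L}. \<Sum>i\<in>{0..<int p}. u (a (i + s))) = real p * ?U" by simp
      have "(\<Sum>s\<in>{0..<int L}. \<Sum>i\<in>{0..<int (p + 1)}. w (b (i + s))) = (\<Sum>i\<in>{0..<int (p + 1)}. \<Sum>s\<in>{0..<int L}. w (b (s + i)))"
        by (subst sum.swap) (simp add: add.commute)
      also have "\<dots> = (\<Sum>i\<in>{0..<int (p + 1)}. ?W)"
        using sum_periodic_shift[of "\<lambda>i. w (b i)" L] per L by simp
      also have "\<dots> = real (p + 1) * ?W" by simp
      finally have W: "(\<Sum>s\<in>{0..<int L}. \<Sum>i\<in>{0..<int (p + 1)}. w (b (i + s))) = real (p + 1) * ?W" .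
      have "real p * ?U \<le> real (p + 1) * ?W"
        unfolding U [symmetric] W [symmetric] by (rule sum_mono) (rule s)
      then show ?thesis using pos tot by simp
    qed
  qed
  then show ?case by (simp add: tot_def)
qed

section \<open>From closed walks to pairs of independent sets\<close>

lemma permutes_power:
  assumes "\<pi> permutes J"
  shows "(\<pi> ^^ k) permutes J"
proof (induction k)
  case 0
  show ?case by (simp only: funpow.simps permutes_id)
next
  case (Suc k)
  show ?case by (simp only: funpow.simps) (rule permutes_compose[OF Suc assms])
qed

lemma permutes_finite_order:
  assumes "finite J" "\<pi> permutes J"
  shows "\<exists>k>0. \<pi> ^^ k = id"
proof -
  have "range (\<lambda>k. \<pi> ^^ k) \<subseteq> {\<rho>. \<rho> permutes J}" using permutes_power[OF assms(2)] by auto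
  then have "finite (range (\<lambda>k. \<pi> ^^ k))" by (rule finite_subset) (rule finite_permutations[OF assms(1)])
  then have "\<not> inj (\<lambda>k. \<pi> ^^ k)" using finite_imageD[of "\<lambda>k. \<pi> ^^ k" UNIV] by auto
  then obtain i' j' where "i' \<noteq> j'" "\<pi> ^^ i' = \<pi> ^^ j'" by (auto simp: inj_def)
  then have "\<exists>i j. i < j \<and> \<pi> ^^ i = \<pi> ^^ j" by (metis linorder_neqE_nat)
  then obtain i j where ij: "i < j" "\<pi> ^^ i = \<pi> ^^ j" by auto
  have "(\<pi> ^^ (j - i)) x = x" for x
  proof -
    have "(\<pi> ^^ i) ((\<pi> ^^ (j - i)) x) = (\<pi> ^^ (i + (j - i))) x" by (simp only: funpow_add o_apply)
    also have "\<dots> = (\<pi> ^^ i) x" using ij by simp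
    finally show ?thesis by (rule injD[OF permutes_inj[OF permutes_power[OF assms(2)]]])
  qed
  then show ?thesis using ij(1) by (intro exI[of _ "j - i"]) auto
qed

text \<open>The two exchange bijections combine to a permutation of J whose orbits trace closed
  walks. All walks run for the same period \<open>T\<close>, a multiple of every orbit length, so
  that the walks from all starting points together visit each element of J exactly \<open>T\<close>
  times.\<close>

lemma two_bases_exchange_bound:
  fixes u w :: "'b \<Rightarrow> real"
  assumes M1: "matroid E1 Ind1" and M2: "matroid E2 Ind2" and S1: "S \<in> Ind1" and S2: "S \<in> Ind2"
    and J1: "J \<in> Ind1" and J2: "J \<in> Ind2" and card: "card S = card J"
    and base1: "\<And>Y. Y \<in> Ind1 \<Longrightarrow> card Y \<le> card S"
    and base2: "\<And>Y. Y \<in> Ind2 \<Longrightarrow> card Y \<le> card S"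
    and disj: "J \<inter> S = {}" and p: "p > 0" and w: "\<And>y. y \<in> S \<Longrightarrow> w y \<ge> 0"
    and opt: "\<And>A R. A \<subseteq> J \<Longrightarrow> R \<subseteq> S \<Longrightarrow> card A \<le> p \<Longrightarrow> card R \<le> p + 1 \<Longrightarrow>
      (S - R) \<union> A \<in> Ind1 \<Longrightarrow> (S - R) \<union> A \<in> Ind2 \<Longrightarrow> sum u A \<le> sum w R"
  shows "real p * sum u J \<le> real (p + 1) * sum w S"
proof -
  have dS: "S - J = S" "J - S = J" using disj by auto
  obtain \<sigma>1 where \<sigma>1: "bij_betw \<sigma>1 J S" "\<And>j. j \<in> J \<Longrightarrow> insert j (S - {\<sigma>1 j}) \<in> Ind1"
    using matroid_exchange_bijection[OF M1 S1 J1 card] dS by auto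
  obtain \<sigma>2 where \<sigma>2: "bij_betw \<sigma>2 J S" "\<And>j. j \<in> J \<Longrightarrow> insert j (S - {\<sigma>2 j}) \<in> Ind2"
    using matroid_exchange_bijection[OF M2 S2 J2 card] dS by auto
  have finJ: "finite J" using matroid_finite[OF M1 J1] .
  define \<pi> where "\<pi> x = (if x \<in> J then inv_into J \<sigma>2 (\<sigma>1 x) else x)" for x
  have "bij_betw (inv_into J \<sigma>2 \<circ> \<sigma>1) J J"
    using bij_betw_trans[OF \<sigma>1(1) bij_betw_inv_into[OF \<sigma>2(1)]] .
  then have "bij_betw \<pi> J J"
    by (subst bij_betw_cong[of _ _ "inv_into J \<sigma>2 \<circ> \<sigma>1"]) (auto simp: \<pi>_def)
  then have \<pi>: "\<pi> permutes J" by (rule bij_imp_permutes) (auto simp: \<pi>_def)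
  have \<pi>\<sigma>: "\<sigma>2 (\<pi> x) = \<sigma>1 x" if "x \<in> J" for x
    using that \<sigma>1(1) \<sigma>2(1) by (auto simp: \<pi>_def bij_betw_def f_inv_into_f)
  note powJ = permutes_power[OF \<pi>]
  obtain T where T: "\<pi> ^^ T = id" "T > 0" using permutes_finite_order[OF finJ \<pi>] by blast
  define a where "a j i = (\<pi> ^^ nat (i mod int T)) j" for j i
  have aJ: "a j i \<in> J" if "j \<in> J" for j i
    using powJ that by (auto simp: a_def permutes_in_image)
  have a_Suc: "a j (i + 1) = \<pi> (a j i)" for j i
  proof (cases "i mod int T = int T - 1")
    case True
    then have "(i + 1) mod int T = 0"
      using mod_add_left_eq[of i "int T" 1] by simp
    then have "a j (i + 1) = j" by (simp add: a_def)
    moreover have "\<pi> (a j i) = (\<pi> ^^ Suc (nat (int T - 1))) j" using True by (simp add: a_def)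
    moreover have "Suc (nat (int T - 1)) = T" using T by simp
    ultimately show ?thesis using T by simp
  next
    case False
    moreover have "0 \<le> i mod int T" "i mod int T < int T" using T by simp_all
    ultimately have "(i mod int T + 1) mod int T = i mod int T + 1"
      by (intro mod_pos_pos_trivial) auto
    then have "(i + 1) mod int T = i mod int T + 1"
      using mod_add_left_eq[of i "int T" 1] by simp
    then have "nat ((i + 1) mod int T) = Suc (nat (i mod int T))"
      using \<open>0 \<le> i mod int T\<close> by simp
    then show ?thesis by (simp add: a_def)
  qed
  have "(\<Sum>i\<in>{0..<int T}. real p * u (a j i) - real (p + 1) * w (\<sigma>2 (a j i))) \<le> 0" if j: "j \<in> J" for j
  proof (rule closed_walk_bound[OF M1 M2 S1 S2 base1 base2 disj p w opt])
    show "closed_walk (swap_edge S J Ind1) (swap_edge S J Ind2) T (a j) (\<lambda>i. \<sigma>2 (a j i))"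
      unfolding closed_walk_def
    proof (intro conjI allI)
      fix i
      show "a j (i + int T) = a j i" by (simp add: a_def)
      then show "\<sigma>2 (a j (i + int T)) = \<sigma>2 (a j i)" by simp
      show "swap_edge S J Ind1 (a j i) (\<sigma>2 (a j (i + 1)))"
        using aJ[OF j] \<sigma>1 by (auto simp: a_Suc \<pi>\<sigma> swap_edge_def bij_betw_def)
      show "swap_edge S J Ind2 (a j i) (\<sigma>2 (a j i))"
        using aJ[OF j] \<sigma>2 by (auto simp: swap_edge_def bij_betw_def)
    qed (use T in auto)
  qed
  then have "(\<Sum>j\<in>J. \<Sum>i\<in>{0..<int T}. real p * u (a j i) - real (p + 1) * w (\<sigma>2 (a j i))) \<le> 0"
    by (rule sum_nonpos)
  also have "(\<Sum>j\<in>J. \<Sum>i\<in>{0..<int T}. real p * u (a j i) - real (p + 1) * w (\<sigma>2 (a j i)))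
      = (\<Sum>i\<in>{0..<int T}. \<Sum>j\<in>J. real p * u (a j i) - real (p + 1) * w (\<sigma>2 (a j i)))"
    by (rule sum.swap)
  also have "\<dots> = (\<Sum>i\<in>{0..<int T}. \<Sum>j\<in>J. real p * u j - real (p + 1) * w (\<sigma>2 j))"
  proof (rule sum.cong)
    fix i
    show "(\<Sum>j\<in>J. real p * u (a j i) - real (p + 1) * w (\<sigma>2 (a j i))) = (\<Sum>j\<in>J. real p * u j - real (p + 1) * w (\<sigma>2 j))"
      using sum.permute[OF powJ[of "nat (i mod int T)"], of "\<lambda>j. real p * u j - real (p + 1) * w (\<sigma>2 j)"]
      by (simp add: a_def o_def)
  qed simp
  also have "\<dots> = real T * (real p * sum u J - real (p + 1) * sum w S)"
    using sum.reindex_bij_betw[OF \<sigma>2(1), of w] by (simp add: sum_subtractf sum_distrib_left [symmetric])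
  finally have "real T * (real p * sum u J - real (p + 1) * sum w S) \<le> 0" .
  then show ?thesis using T(2) by (simp add: mult_le_0_iff)
qed

section \<open>Exchanges for intersections of matroids\<close>

text \<open>
  Free dummy elements \<open>Inr d\<close> and truncation at rank \<open>r\<close> turn two independent sets of different
  sizes into disjoint bases; additions without removal become exchanges with a dummy.
\<close>

definition pad_indep :: "'b set \<Rightarrow> nat \<Rightarrow> 'a set set \<Rightarrow> ('a + 'b) set set" where
  "pad_indep D r Ind = {Z. Inl -` Z \<in> Ind \<and> Inr -` Z \<subseteq> D \<and> card Z \<le> r}"

lemma Plus_vimage: "(Inl -` Z) <+> (Inr -` Z) = Z"
proof (rule set_eqI)
  fix z show "z \<in> (Inl -` Z) <+> (Inr -` Z) \<longleftrightarrow> z \<in> Z" by (cases z) auto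
qed

lemma card_vimage_Plus:
  assumes "finite (Inl -` Z)" "finite (Inr -` Z)"
  shows "card Z = card (Inl -` Z) + card (Inr -` Z)"
  using card_Plus[OF assms] by (simp add: Plus_vimage)

text \<open>A dummy of Y that X lacks can always be added; if there is none, Y exceeds X in original
  elements and the given matroid provides the augmentation.\<close>

lemma matroid_pad:
  assumes M: "matroid E Ind" and D: "finite D"
  shows "matroid (E <+> D) (pad_indep D r Ind)"
proof -
  have fin: "finite (Inl -` Z)" "finite (Inr -` Z)" "finite Z" if "Z \<in> pad_indep D r Ind" for Z
  proof -
    show 1: "finite (Inl -` Z)" using that matroid_finite[OF M] by (auto simp: pad_indep_def)
    show 2: "finite (Inr -` Z)" using that finite_subset[OF _ D] by (auto simp: pad_indep_def)
    show "finite Z" using finite_Plus[OF 1 2] by (simp add: Plus_vimage)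
  qed
  show ?thesis
    unfolding matroid_def
  proof (intro conjI ballI allI impI)
    show "finite (E <+> D)" using M D by (auto simp: matroid_def)
    show "{} \<in> pad_indep D r Ind" using M by (auto simp: pad_indep_def matroid_def)
    fix X assume X: "X \<in> pad_indep D r Ind"
    have "Inl -` X \<subseteq> E" "Inr -` X \<subseteq> D" using X M by (auto simp: pad_indep_def matroid_def)
    then have "(Inl -` X) <+> (Inr -` X) \<subseteq> E <+> D" by auto
    then show "X \<subseteq> E <+> D" by (simp add: Plus_vimage)
    fix Y assume Y: "Y \<in> pad_indep D r Ind" and less: "card X < card Y"
    show "\<exists>e\<in>Y - X. insert e X \<in> pad_indep D r Ind"
    proof (cases "Inr -` Y \<subseteq> Inr -` X")
      case False
      then obtain d where d: "Inr d \<in> Y" "Inr d \<notin> X" by auto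
      have "Inl -` insert (Inr d) X = Inl -` X" by auto
      moreover have "Inr -` insert (Inr d) X = insert d (Inr -` X)" by auto
      moreover have "d \<in> D" using d Y by (auto simp: pad_indep_def)
      moreover have "card (insert (Inr d) X) \<le> r"
        using d fin(3)[OF X] less Y by (simp add: pad_indep_def)
      ultimately have "insert (Inr d) X \<in> pad_indep D r Ind" using X by (simp add: pad_indep_def)
      then show ?thesis using d by blast
    next
      case True
      then have "card (Inr -` Y) \<le> card (Inr -` X)" using fin X by (intro card_mono) auto
      then have "card (Inl -` X) < card (Inl -` Y)"
        using less card_vimage_Plus[OF fin(1,2)[OF X]] card_vimage_Plus[OF fin(1,2)[OF Y]] by linarith
      then obtain e where e: "e \<in> Inl -` Y - Inl -` X" "insert e (Inl -` X) \<in> Ind"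
        using matroid_augment[OF M, of "Inl -` X" "Inl -` Y"] X Y by (auto simp: pad_indep_def)
      have "Inl -` insert (Inl e) X = insert e (Inl -` X)" by auto
      moreover have "Inr -` insert (Inl e) X = Inr -` X" by auto
      moreover have "card (insert (Inl e) X) \<le> r"
        using e fin(3)[OF X] less Y by (simp add: pad_indep_def)
      ultimately have "insert (Inl e) X \<in> pad_indep D r Ind" using X e by (simp add: pad_indep_def)
      then show ?thesis using e by blast
    qed
  next
    fix X Y assume "X \<subseteq> Y \<and> Y \<in> pad_indep D r Ind"
    then have XY: "X \<subseteq> Y" and Y: "Y \<in> pad_indep D r Ind" by auto
    have "Inl -` Y \<in> Ind" "Inl -` X \<subseteq> Inl -` Y" using Y XY by (auto simp: pad_indep_def)
    then have "Inl -` X \<in> Ind" using matroid_mono[OF M] by blast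
    moreover have "Inr -` Y \<subseteq> D" using Y by (simp add: pad_indep_def)
    then have "Inr -` X \<subseteq> D" using vimage_mono[OF XY] by (rule order_trans[rotated])
    moreover have "card Y \<le> r" using Y by (simp add: pad_indep_def)
    then have "card X \<le> r" using card_mono[OF fin(3)[OF Y] XY] by simp
    ultimately show "X \<in> pad_indep D r Ind" by (simp add: pad_indep_def)
  qed
qed

text \<open>Each set is padded with copies of the other, which gives disjoint bases of size card S +
  card J. Dummies have weight zero, so an exchange of padded sets projects to one of the original
  sets with no more elements and the same weights.\<close>

lemma two_matroid_exchange_bound:
  fixes u w :: "'a \<Rightarrow> real"
  assumes M1: "matroid E1 Ind1" and M2: "matroid E2 Ind2" and S1: "S \<in> Ind1" and S2: "S \<in> Ind2"
    and J1: "J \<in> Ind1" and J2: "J \<in> Ind2"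
    and disj: "J \<inter> S = {}" and p: "p > 0" and w: "\<And>y. y \<in> S \<Longrightarrow> w y \<ge> 0"
    and opt: "\<And>A R. A \<subseteq> J \<Longrightarrow> R \<subseteq> S \<Longrightarrow> card A \<le> p \<Longrightarrow> card R \<le> p + 1 \<Longrightarrow>
      (S - R) \<union> A \<in> Ind1 \<Longrightarrow> (S - R) \<union> A \<in> Ind2 \<Longrightarrow> sum u A \<le> sum w R"
  shows "real p * sum u J \<le> real (p + 1) * sum w S"
proof -
  have fin: "finite S" "finite J" using matroid_finite[OF M1] S1 J1 by auto
  define D where "D = S \<union> J"
  define r where "r = card S + card J"
  define S' where "S' = S <+> J"
  define J' where "J' = J <+> S"
  define u' :: "'a + 'a \<Rightarrow> real" where "u' = case_sum u (\<lambda>_. 0)"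
  define w' :: "'a + 'a \<Rightarrow> real" where "w' = case_sum w (\<lambda>_. 0)"
  have finD: "finite D" using fin by (simp add: D_def)
  have fin': "finite S'" "finite J'" using fin by (auto simp: S'_def J'_def)
  have card: "card S' = r" "card J' = r" using fin by (auto simp: S'_def J'_def r_def card_Plus)
  have v: "Inl -` S' = S" "Inr -` S' = J" "Inl -` J' = J" "Inr -` J' = S"
    by (auto simp: S'_def J'_def)
  have sums: "sum (case_sum g (\<lambda>_. 0)) Z = sum g (Inl -` Z)" if "finite Z" for Z :: "('a + 'a) set" and g :: "'a \<Rightarrow> real"
  proof -
    have f: "finite (Inl -` Z)" "finite (Inr -` Z)"
      using that by (auto intro!: finite_vimageI)
    have "sum (case_sum g (\<lambda>_. 0)) ((Inl -` Z) <+> (Inr -` Z)) = sum g (Inl -` Z)"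
      using f by (simp add: sum.Plus)
    then show ?thesis by (simp add: Plus_vimage)
  qed
  have "real p * sum u' J' \<le> real (p + 1) * sum w' S'"
  proof (rule two_bases_exchange_bound[OF matroid_pad[OF M1 finD, of r] matroid_pad[OF M2 finD, of r]])
    show "S' \<in> pad_indep D r Ind1" "S' \<in> pad_indep D r Ind2" "J' \<in> pad_indep D r Ind1" "J' \<in> pad_indep D r Ind2"
      using S1 S2 J1 J2 card v by (auto simp: pad_indep_def D_def)
    show "card S' = card J'" using card by simp
    show "card Y \<le> card S'" if "Y \<in> pad_indep D r Ind1" for Y using that card by (auto simp: pad_indep_def)
    show "card Y \<le> card S'" if "Y \<in> pad_indep D r Ind2" for Y using that card by (auto simp: pad_indep_def)
    show "J' \<inter> S' = {}" using disj by (auto simp: S'_def J'_def)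
    show "w' y \<ge> 0" if "y \<in> S'" for y using that w by (auto simp: w'_def S'_def)
    fix A R assume AR: "A \<subseteq> J'" "R \<subseteq> S'" "card A \<le> p" "card R \<le> p + 1"
      "S' - R \<union> A \<in> pad_indep D r Ind1" "S' - R \<union> A \<in> pad_indep D r Ind2"
    have fAR: "finite A" "finite R" using AR fin' finite_subset by auto
    have cv: "card (Inl -` Z) \<le> card Z" if "finite Z" for Z :: "('a + 'a) set"
      using card_vimage_Plus[of Z] finite_vimageI[OF that inj_Inl] finite_vimageI[OF that inj_Inr] by simp
    have eq: "Inl -` (S' - R \<union> A) = (S - Inl -` R) \<union> Inl -` A" using v by auto
    have "sum u (Inl -` A) \<le> sum w (Inl -` R)"
    proof (rule opt)
      show "Inl -` A \<subseteq> J" using AR(1) by (auto simp: J'_def)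
      show "Inl -` R \<subseteq> S" using AR(2) by (auto simp: S'_def)
      show "card (Inl -` A) \<le> p" using cv[OF fAR(1)] AR(3) by simp
      show "card (Inl -` R) \<le> p + 1" using cv[OF fAR(2)] AR(4) by simp
      show "S - Inl -` R \<union> Inl -` A \<in> Ind1" "S - Inl -` R \<union> Inl -` A \<in> Ind2"
        using AR(5,6) unfolding pad_indep_def mem_Collect_eq eq by blast+
    qed
    then show "sum u' A \<le> sum w' R" using sums fAR by (simp add: u'_def w'_def)
  qed (rule p)
  then show ?thesis using sums fin' v by (simp add: u'_def w'_def)
qed

text \<open>Edmonds' greedy vertex of the base polytope: \<open>l x\<close> is the marginal value of
  x over the elements inserted before it, and submodularity makes the marginal value over a subset
  of these at least as large.\<close>

lemma submodular_linear_minorant: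
  fixes F :: "'a set \<Rightarrow> real"
  assumes "finite J" "F {} = 0"
    and "\<And>X Y. X \<subseteq> J \<Longrightarrow> Y \<subseteq> J \<Longrightarrow> F (X \<union> Y) + F (X \<inter> Y) \<le> F X + F Y"
  shows "\<exists>l. sum l J = F J \<and> (\<forall>A\<subseteq>J. sum l A \<le> F A)"
  using assms(1,3)
proof (induction J rule: finite_induct)
  case empty
  then show ?case using assms(2) by auto
next
  case (insert x J)
  have "\<exists>l. sum l J = F J \<and> (\<forall>A\<subseteq>J. sum l A \<le> F A)"
    by (rule insert.IH) (auto intro!: insert.prems)
  then obtain l where l: "sum l J = F J" "\<And>A. A \<subseteq> J \<Longrightarrow> sum l A \<le> F A" by blast
  define l' where "l' = l(x := F (insert x J) - F J)"
  have same: "sum l' A = sum l A" if "x \<notin> A" for A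
    using that by (intro sum.cong) (auto simp: l'_def)
  have "sum l' (insert x J) = F (insert x J)"
    using insert.hyps same[of J] l(1) by (simp add: l'_def)
  moreover have "sum l' A \<le> F A" if A: "A \<subseteq> insert x J" for A
  proof (cases "x \<in> A")
    case False
    then show ?thesis using same l(2)[of A] A by auto
  next
    case True
    have finA: "finite A" using A insert.hyps finite_subset by auto
    have sub: "A - {x} \<subseteq> J" using A by auto
    have "sum l' A = l' x + sum l' (A - {x})" using True finA by (simp add: sum.remove)
    also have "\<dots> = F (insert x J) - F J + sum l (A - {x})" using same[of "A - {x}"] by (simp add: l'_def)
    also have "\<dots> \<le> F (insert x J) - F J + F (A - {x})" using l(2)[OF sub] by simp
    also have "J \<union> A = insert x J" "J \<inter> A = A - {x}" using A True insert.hyps by auto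
    then have "F (insert x J) + F (A - {x}) \<le> F J + F A"
      using insert.prems[of J A] A by auto
    then have "F (insert x J) - F J + F (A - {x}) \<le> F A" by linarith
    finally show ?thesis .
  qed
  ultimately show ?case by blast
qed

section \<open>Rank, greedy removal and approximate local optima\<close>

definition matroid_rank :: "'a set set \<Rightarrow> 'a set \<Rightarrow> nat" where
  "matroid_rank Ind X = Max (card ` {Y \<in> Ind. Y \<subseteq> X})"

lemma matroid_rank_attained:
  assumes M: "matroid E Ind"
  shows "\<exists>Y\<in>Ind. Y \<subseteq> X \<and> card Y = matroid_rank Ind X"
    and "\<And>Y. Y \<in> Ind \<Longrightarrow> Y \<subseteq> X \<Longrightarrow> card Y \<le> matroid_rank Ind X"
proof -
  have "finite Ind" using M unfolding matroid_def by (meson finite_Pow_iff finite_subset PowI subsetI)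
  then have fin: "finite (card ` {Y \<in> Ind. Y \<subseteq> X})" by simp
  have "{} \<in> Ind" using M by (simp add: matroid_def)
  then have "card ` {Y \<in> Ind. Y \<subseteq> X} \<noteq> {}" by blast
  then have "matroid_rank Ind X \<in> card ` {Y \<in> Ind. Y \<subseteq> X}"
    unfolding matroid_rank_def using fin by (rule Max_in[rotated])
  then show "\<exists>Y\<in>Ind. Y \<subseteq> X \<and> card Y = matroid_rank Ind X" by auto
  show "card Y \<le> matroid_rank Ind X" if "Y \<in> Ind" "Y \<subseteq> X" for Y
    unfolding matroid_rank_def using fin that by (intro Max_ge) auto
qed

lemma matroid_rank_indep:
  assumes M: "matroid E Ind" and X: "X \<in> Ind"
  shows "matroid_rank Ind X = card X"
proof -
  obtain Y where "Y \<in> Ind" "Y \<subseteq> X" "card Y = matroid_rank Ind X" using matroid_rank_attained(1)[OF M] by blast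
  then have "matroid_rank Ind X \<le> card X" using matroid_finite[OF M X] card_mono by metis
  then show ?thesis using matroid_rank_attained(2)[OF M X, of X] by simp
qed

text \<open>A basis of the intersection extends to a basis \<open>C\<close> of the union. The parts
  of \<open>C\<close> in X and in Y are independent and overlap in at least the first basis.\<close>

lemma matroid_rank_submodular:
  assumes M: "matroid E Ind"
  shows "matroid_rank Ind (X \<union> Y) + matroid_rank Ind (X \<inter> Y) \<le> matroid_rank Ind X + matroid_rank Ind Y"
proof -
  obtain A where A: "A \<in> Ind" "A \<subseteq> X \<inter> Y" "card A = matroid_rank Ind (X \<inter> Y)"
    using matroid_rank_attained(1)[OF M] by blast
  obtain B where B: "B \<in> Ind" "B \<subseteq> X \<union> Y" "card B = matroid_rank Ind (X \<union> Y)"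
    using matroid_rank_attained(1)[OF M] by blast
  have "card A \<le> card B" using matroid_rank_attained(2)[OF M A(1), of "X \<union> Y"] A(2) B by auto
  then obtain C where C: "C \<in> Ind" "A \<subseteq> C" "C \<subseteq> A \<union> B" "card C = card B"
    using matroid_extend[OF M A(1) B(1)] by blast
  have finC: "finite C" using matroid_finite[OF M C(1)] .
  have sub: "C \<subseteq> X \<union> Y" using C A B by auto
  have "card B + card A \<le> card C + card (C \<inter> X \<inter> Y)"
    using C(2,4) A(2) finC card_mono[of "C \<inter> X \<inter> Y" A] by auto
  also have "\<dots> = card ((C \<inter> X) \<union> (C \<inter> Y)) + card ((C \<inter> X) \<inter> (C \<inter> Y))"
  proof -
    have "(C \<inter> X) \<union> (C \<inter> Y) = C" "(C \<inter> X) \<inter> (C \<inter> Y) = C \<inter> X \<inter> Y" using sub by auto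
    then show ?thesis by simp
  qed
  also have "\<dots> = card (C \<inter> X) + card (C \<inter> Y)" using finC by (simp add: card_Un_Int [symmetric])
  also have "card (C \<inter> X) \<le> matroid_rank Ind X"
    using matroid_mono[OF M C(1)] by (intro matroid_rank_attained(2)[OF M]) auto
  also have "card (C \<inter> Y) \<le> matroid_rank Ind Y"
    using matroid_mono[OF M C(1)] by (intro matroid_rank_attained(2)[OF M]) auto
  finally show ?thesis using A B by simp
qed

lemma summation_by_parts:
  fixes v g :: "nat \<Rightarrow> real"
  shows "(\<Sum>k<m. v k * (g (Suc k) - g k)) = (\<Sum>k<m. (v k - v (Suc k)) * g (Suc k)) + v m * g m - v 0 * g 0"
  by (induction m) (auto simp: algebra_simps)

text \<open>
  The cheapest set that has to be removed from \<open>S\<close> to make room for \<open>A\<close> is found greedily; by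
  summation by parts its weight is a nonnegative combination of nullities, hence supermodular
  in \<open>A\<close>, and so has a linear majorant.
\<close>

lemma exchange_linear_majorant:
  fixes w :: "'a \<Rightarrow> real"
  assumes M: "matroid E Ind" and S: "S \<in> Ind" and J: "J \<in> Ind" and disj: "J \<inter> S = {}"
    and w: "\<And>y. y \<in> S \<Longrightarrow> w y \<ge> 0"
  shows "\<exists>l. sum l J \<le> sum w S \<and>
    (\<forall>A\<subseteq>J. \<exists>R\<subseteq>S. card R \<le> card A \<and> (S - R) \<union> A \<in> Ind \<and> sum w R \<le> sum l A)"
proof -
  have fin: "finite S" "finite J" using matroid_finite[OF M] S J by auto
  obtain ys where ys: "set ys = S" "distinct ys" using finite_distinct_list[OF fin(1)] by blast
  define xs where "xs = rev (sort_key w ys)"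
  define m where "m = length xs"
  have xs: "set xs = S" "distinct xs" using ys by (auto simp: xs_def)
  have dec: "w (xs ! Suc k) \<le> w (xs ! k)" if "Suc k < m" for k
  proof -
    let ?zs = "sort_key w ys"
    have "sorted (map w ?zs)" by simp
    moreover have len: "length ?zs = m" by (simp add: m_def xs_def)
    ultimately have "w (?zs ! (m - Suc (Suc k))) \<le> w (?zs ! (m - Suc k))"
      using that sorted_nth_mono[of "map w ?zs" "m - Suc (Suc k)" "m - Suc k"] by auto
    then show ?thesis using that len by (simp add: xs_def rev_nth)
  qed
  \<comment> \<open>The value 0 at m removes the boundary term of the summation by parts. As the
    weights decrease along \<open>xs\<close> and are nonnegative, all differences v k - v (k + 1)
    are nonnegative.\<close>
  define v where "v k = (if k < m then w (xs ! k) else 0)" for k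
  have v_dec: "v (Suc k) \<le> v k" if "k < m" for k
    using dec[of k] that w[of "xs ! k"] xs by (auto simp: v_def m_def)
  define P where "P k = set (take k xs)" for k
  have P_Suc: "P (Suc k) = insert (xs ! k) (P k)" "xs ! k \<notin> P k" "xs ! k \<in> S" if "k < m" for k
  proof -
    show "P (Suc k) = insert (xs ! k) (P k)" using that by (simp add: P_def m_def take_Suc_conv_app_nth)
    show "xs ! k \<notin> P k" using that xs(2) by (auto simp: P_def m_def in_set_conv_nth nth_eq_iff_index_eq)
    show "xs ! k \<in> S" using that xs by (auto simp: m_def)
  qed
  have PS: "P k \<subseteq> S" for k unfolding P_def xs(1) [symmetric] by (rule set_take_subset)
  have P0: "P 0 = {}" and Pm: "P m = S" using xs by (auto simp: P_def m_def)
  have cardP: "card (P k) = k" if "k \<le> m" for k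
    using that xs(2) by (simp add: P_def m_def distinct_card)
  define rk where "rk = matroid_rank Ind"
  \<comment> \<open>\<open>g A k\<close> is the nullity of A together with the k heaviest elements
    of S, that is, how many of these have to make room for A. An element is removed exactly where
    \<open>g A\<close> increases, so \<open>G A\<close> is the removed weight.\<close>
  define g where "g A k = real (card A) + real k - real (rk (A \<union> P k))" for A k
  define G where "G A = (\<Sum>k<m. v k * (g A (Suc k) - g A k))" for A
  have indA: "A \<in> Ind" if "A \<subseteq> J" for A using matroid_mono[OF M J that] .
  have G_parts: "G A = (\<Sum>k<m. (v k - v (Suc k)) * g A (Suc k))" if "A \<subseteq> J" for A
  proof -
    have "g A 0 = 0" using indA[OF that] by (simp add: g_def P0 rk_def matroid_rank_indep[OF M])
    moreover have "v m = 0" by (simp add: v_def)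
    ultimately show ?thesis unfolding G_def by (subst summation_by_parts) simp
  qed
  have g_super: "g X k + g Y k \<le> g (X \<union> Y) k + g (X \<inter> Y) k" if "X \<subseteq> J" "Y \<subseteq> J" for X Y k
  proof -
    have "finite X" "finite Y" using that fin finite_subset by auto
    then have "real (card X) + real (card Y) = real (card (X \<union> Y)) + real (card (X \<inter> Y))"
      using card_Un_Int by (metis of_nat_add)
    moreover have "(X \<union> P k) \<union> (Y \<union> P k) = (X \<union> Y) \<union> P k" "(X \<union> P k) \<inter> (Y \<union> P k) = (X \<inter> Y) \<union> P k" by auto
    then have "real (rk ((X \<union> Y) \<union> P k)) + real (rk ((X \<inter> Y) \<union> P k)) \<le> real (rk (X \<union> P k)) + real (rk (Y \<union> P k))"
      using matroid_rank_submodular[OF M, of "X \<union> P k" "Y \<union> P k"] by (simp add: rk_def)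
    ultimately show ?thesis by (simp add: g_def)
  qed
  have "\<exists>l. sum l J = - G J \<and> (\<forall>A\<subseteq>J. sum l A \<le> - G A)"
  proof (rule submodular_linear_minorant[OF fin(2)])
    have "g {} k = 0" if "k \<le> m" for k
      using that matroid_rank_indep[OF M matroid_mono[OF M S PS[of k]]] by (simp add: g_def rk_def cardP)
    then show "- G {} = 0" by (simp add: G_def)
    fix X Y assume XY: "X \<subseteq> J" "Y \<subseteq> J"
    then have sub: "X \<union> Y \<subseteq> J" "X \<inter> Y \<subseteq> J" by auto
    have "G X + G Y = (\<Sum>k<m. (v k - v (Suc k)) * (g X (Suc k) + g Y (Suc k)))"
      using XY by (simp add: G_parts sum.distrib distrib_left)
    also have "\<dots> \<le> (\<Sum>k<m. (v k - v (Suc k)) * (g (X \<union> Y) (Suc k) + g (X \<inter> Y) (Suc k)))"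
      using g_super[OF XY] v_dec by (intro sum_mono mult_left_mono) auto
    also have "\<dots> = G (X \<union> Y) + G (X \<inter> Y)"
      using sub by (simp add: G_parts sum.distrib distrib_left)
    finally show "- G (X \<union> Y) + - G (X \<inter> Y) \<le> - G X + - G Y" by simp
  qed
  then obtain l where l: "sum l J = - G J" "\<And>A. A \<subseteq> J \<Longrightarrow> sum l A \<le> - G A" by blast
  have "G J \<le> (\<Sum>k<m. (v k - v (Suc k)) * real (Suc k))"
    unfolding G_parts[OF order_refl]
  proof (intro sum_mono mult_left_mono)
    fix k
    have "card J \<le> rk (J \<union> P (Suc k))" unfolding rk_def by (rule matroid_rank_attained(2)[OF M J]) auto
    then show "g J (Suc k) \<le> real (Suc k)" by (simp add: g_def)
  qed (use v_dec in auto)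
  also have "\<dots> = (\<Sum>k<m. v k * (real (Suc k) - real k))"
    using summation_by_parts[of v real m] by (simp add: v_def)
  also have "\<dots> = (\<Sum>k<m. w (xs ! k))" by (intro sum.cong) (auto simp: v_def)
  also have "\<dots> = sum w S"
    using sum.reindex_bij_betw[OF bij_betw_nth[OF xs(2), of "{..<m}" S], of w] xs by (simp add: m_def)
  finally have total: "G J \<le> sum w S" .
  \<comment> \<open>An element is kept whenever it is independent of A and the elements kept before,
    so A and the kept elements always form a basis of \<open>A \<union> P k\<close>.\<close>
  have greedy: "\<exists>R\<subseteq>P k. (P k - R) \<union> A \<in> Ind \<and> real (card R) = g A k \<and>
      sum w R = (\<Sum>i<k. v i * (g A (Suc i) - g A i))"
    if A: "A \<subseteq> J" and "k \<le> m" for A k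
    using that(2)
  proof (induction k)
    case 0
    then show ?case using indA[OF A] by (simp add: P0 g_def rk_def matroid_rank_indep[OF M])
  next
    case (Suc k)
    then obtain R where R: "R \<subseteq> P k" "(P k - R) \<union> A \<in> Ind" "real (card R) = g A k"
      "sum w R = (\<Sum>i<k. v i * (g A (Suc i) - g A i))" by auto
    have k: "k < m" using Suc.prems by simp
    note Ps = P_Suc[OF k]
    let ?x = "xs ! k" and ?T = "(P k - R) \<union> A"
    have finA: "finite A" using A fin finite_subset by auto
    have finP: "finite (P k)" by (simp add: P_def)
    have finR: "finite R" using R finP finite_subset by auto
    have xA: "?x \<notin> A" using A disj Ps by auto
    have vk: "v k = w ?x" using k by (simp add: v_def)
    have "card ?T = card (P k - R) + card A"
      using finA finP A disj PS by (intro card_Un_disjoint) auto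
    also have "card (P k - R) = k - card R" using R(1) finR cardP[of k] k by (simp add: card_Diff_subset)
    finally have "card ?T = (k - card R) + card A" .
    moreover have "card R \<le> k" using R(1) finP cardP[of k] k card_mono by (metis less_imp_le)
    ultimately have "real (card ?T) = real (rk (A \<union> P k))" using R(3) by (simp add: g_def)
    then have cT: "card ?T = rk (A \<union> P k)" by simp
    show ?case
    proof (cases "insert ?x ?T \<in> Ind")
      case True
      have "card (insert ?x ?T) \<le> rk (A \<union> P (Suc k))"
        unfolding rk_def using Ps by (intro matroid_rank_attained(2)[OF M True]) auto
      moreover have "card (insert ?x ?T) = Suc (card ?T)" using Ps xA finP finA by simp
      moreover have "rk (A \<union> P (Suc k)) \<le> Suc (rk (A \<union> P k))"
      proof -
        obtain Y where Y: "Y \<in> Ind" "Y \<subseteq> A \<union> P (Suc k)" "card Y = rk (A \<union> P (Suc k))"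
          using matroid_rank_attained(1)[OF M] unfolding rk_def by blast
        have "card (Y - {?x}) \<le> rk (A \<union> P k)"
          unfolding rk_def using Y Ps matroid_mono[OF M Y(1)] by (intro matroid_rank_attained(2)[OF M]) auto
        moreover have "card Y \<le> Suc (card (Y - {?x}))" by (cases "card Y") (auto simp: card_Diff_singleton_if)
        ultimately show ?thesis using Y(3) by simp
      qed
      ultimately have "g A (Suc k) = g A k" using cT by (simp add: g_def)
      moreover have "(P (Suc k) - R) \<union> A = insert ?x ?T" using Ps R by auto
      ultimately show ?thesis using R True Ps by (intro exI[of _ R]) auto
    next
      case False
      have "rk (A \<union> P (Suc k)) = rk (A \<union> P k)"
      proof (rule ccontr)
        assume ne: "rk (A \<union> P (Suc k)) \<noteq> rk (A \<union> P k)"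
        obtain Y where Y: "Y \<in> Ind" "Y \<subseteq> A \<union> P (Suc k)" "card Y = rk (A \<union> P (Suc k))"
          using matroid_rank_attained(1)[OF M] unfolding rk_def by blast
        have "card ?T \<le> rk (A \<union> P (Suc k))"
          unfolding rk_def using Ps by (intro matroid_rank_attained(2)[OF M R(2)]) auto
        then have "card ?T < card Y" using ne cT Y by simp
        then obtain e where e: "e \<in> Y - ?T" "insert e ?T \<in> Ind"
          using matroid_augment[OF M R(2) Y(1)] by blast
        have "e \<noteq> ?x" using False e by auto
        then have "insert e ?T \<subseteq> A \<union> P k" using e Y Ps by auto
        then have "card (insert e ?T) \<le> card ?T"
          using matroid_rank_attained(2)[OF M e(2)] cT by (simp add: rk_def)
        then show False using e finA finP by simp
      qed
      then have g: "g A (Suc k) = g A k + 1" by (simp add: g_def)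
      have xR: "?x \<notin> R" using R Ps by auto
      have "(P (Suc k) - insert ?x R) \<union> A = ?T" using Ps R xA by auto
      moreover have "insert ?x R \<subseteq> P (Suc k)" using R Ps by auto
      ultimately show ?thesis
        using R g xR finR vk by (intro exI[of _ "insert ?x R"]) simp
    qed
  qed
  show ?thesis
  proof (intro exI[of _ "\<lambda>x. - l x"] conjI allI impI)
    show "(\<Sum>x\<in>J. - l x) \<le> sum w S" using l(1) total by (simp add: sum_negf)
    fix A assume A: "A \<subseteq> J"
    obtain R where R: "R \<subseteq> S" "(S - R) \<union> A \<in> Ind" "real (card R) = g A m" "sum w R = G A"
      using greedy[OF A order_refl] by (auto simp: Pm G_def)
    have "m = card S" using cardP[of m] Pm by simp
    \<comment> \<open>At the end the basis has at least \<open>card S\<close> elements, which limits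
      the removals to \<open>card A\<close>.\<close>
    have "card S \<le> rk (A \<union> P m)"
      unfolding rk_def by (rule matroid_rank_attained(2)[OF M S]) (auto simp: Pm)
    then have "real (card R) \<le> real (card A)" using R(3) \<open>m = card S\<close> by (simp add: g_def)
    moreover have "sum w R \<le> (\<Sum>x\<in>A. - l x)" using R(4) l(2)[OF A] by (simp add: sum_negf)
    ultimately show "\<exists>R\<subseteq>S. card R \<le> card A \<and> (S - R) \<union> A \<in> Ind \<and> sum w R \<le> (\<Sum>x\<in>A. - l x)"
      using R by auto
  qed
qed

text \<open>Submodularity for S and S' = (S - U) \<union> A, combined with local optimality, gives u
  A \<le> w U + \<kappa>, where \<open>w\<close> and \<open>u\<close> linearize f on S and its
  marginal values over S from below. Here U is the union of what the matroids demand: matroid i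
  \<ge> 2 is paid for by \<open>l i\<close>, which is deducted from u in advance, and matroids 0 and
  1 by \<open>two_matroid_exchange_bound\<close>.\<close>

theorem approx_local_optimum_bound:
  fixes f :: "'a set \<Rightarrow> real"
  assumes M: "\<And>i. i < \<mu> \<Longrightarrow> matroid E (Ind i)" and \<mu>: "\<mu> \<ge> 2" and p: "p > 0"
    and sub: "submodular E f" and mono: "monotone_setfun E f" and f0: "f {} = 0"
    and S: "S \<in> matroid_intersection \<mu> Ind" and J: "J \<in> matroid_intersection \<mu> Ind" and \<kappa>: "\<kappa> \<ge> 0"
    and opt: "\<And>S'. S' \<in> matroid_intersection \<mu> Ind \<Longrightarrow> card ((S - S') \<union> (S' - S)) \<le> \<mu> * p + 1 \<Longrightarrow>
      f S' \<le> f S + \<kappa>"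
  shows "f J \<le> (real \<mu> + 1 / real p) * f S + real (card E) * \<kappa>"
proof -
  have S_i: "S \<in> Ind i" and J_i: "J \<in> Ind i" if "i < \<mu>" for i
    using S J that by (auto simp: matroid_intersection_def)
  have finE: "finite E" and SE: "S \<subseteq> E" and JE: "J \<subseteq> E"
    using M[of 0] S_i[of 0] J_i[of 0] \<mu> by (auto simp: matroid_def)
  have fin: "finite S" "finite J" using SE JE finE finite_subset by auto
  have submod: "f (X \<union> Y) + f (X \<inter> Y) \<le> f X + f Y" if "X \<subseteq> E" "Y \<subseteq> E" for X Y
    using sub that by (auto simp: submodular_def)
  have monoD: "f X \<le> f Y" if "X \<subseteq> Y" "Y \<subseteq> E" for X Y
    using mono that by (auto simp: monotone_setfun_def)
  define J0 where "J0 = J - S"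
  have J0: "J0 \<subseteq> J" "J0 \<inter> S = {}" "finite J0" "J0 \<subseteq> E" using fin JE by (auto simp: J0_def)
  have J0_i: "J0 \<in> Ind i" if "i < \<mu>" for i using matroid_mono[OF M[OF that] J_i[OF that]] J0 by blast
  have "\<exists>w. sum w S = f S \<and> (\<forall>A\<subseteq>S. sum w A \<le> f A)"
  proof (rule submodular_linear_minorant[of S f, OF fin(1) f0])
    fix X Y assume "X \<subseteq> S" "Y \<subseteq> S"
    then show "f (X \<union> Y) + f (X \<inter> Y) \<le> f X + f Y" using SE by (intro submod) auto
  qed
  then obtain w where "sum w S = f S \<and> (\<forall>A\<subseteq>S. sum w A \<le> f A)" ..
  note w_conj = this
  have w: "sum w S = f S" using w_conj by (rule conjunct1)
  have w_le: "sum w A \<le> f A" if "A \<subseteq> S" for A using conjunct2[OF w_conj] that by (simp only: HOL.simp_thms)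
  have w_nonneg: "w y \<ge> 0" if y: "y \<in> S" for y
  proof -
    have "sum w (S - {y}) \<le> f (S - {y})" by (rule w_le) auto
    also have "\<dots> \<le> f S" by (rule monoD) (use SE in auto)
    also have "\<dots> = w y + sum w (S - {y})" using w y fin by (simp add: sum.remove)
    finally show ?thesis by simp
  qed
  define F where "F A = f (S \<union> A) - f S" for A
  have "\<exists>u. sum u J0 = F J0 \<and> (\<forall>A\<subseteq>J0. sum u A \<le> F A)"
  proof (rule submodular_linear_minorant)
    fix X Y assume "X \<subseteq> J0" "Y \<subseteq> J0"
    then have "S \<union> X \<subseteq> E" "S \<union> Y \<subseteq> E" using SE J0 by auto
    moreover have "(S \<union> X) \<union> (S \<union> Y) = S \<union> (X \<union> Y)" "(S \<union> X) \<inter> (S \<union> Y) = S \<union> (X \<inter> Y)" by auto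
    ultimately show "F (X \<union> Y) + F (X \<inter> Y) \<le> F X + F Y"
      using submod[of "S \<union> X" "S \<union> Y"] by (simp add: F_def)
  qed (use J0 in \<open>auto simp: F_def\<close>)
  then obtain u where "sum u J0 = F J0 \<and> (\<forall>A\<subseteq>J0. sum u A \<le> F A)" ..
  note u_conj = this
  have u: "sum u J0 = F J0" using u_conj by (rule conjunct1)
  have u_le: "sum u A \<le> F A" if "A \<subseteq> J0" for A using conjunct2[OF u_conj] that by (simp only: HOL.simp_thms)
  have "\<exists>l. sum l J0 \<le> sum w S \<and>
    (\<forall>A\<subseteq>J0. \<exists>R\<subseteq>S. card R \<le> card A \<and> (S - R) \<union> A \<in> Ind i \<and> sum w R \<le> sum l A)" if "i < \<mu>" for i
    using exchange_linear_majorant[OF M[OF that] S_i[OF that] J0_i[OF that] J0(2) w_nonneg] .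
  then obtain l where l: "\<And>i. i < \<mu> \<Longrightarrow> sum (l i) J0 \<le> sum w S"
    "\<And>i A. i < \<mu> \<Longrightarrow> A \<subseteq> J0 \<Longrightarrow> \<exists>R\<subseteq>S. card R \<le> card A \<and> (S - R) \<union> A \<in> Ind i \<and> sum w R \<le> sum (l i) A"
    by metis
  \<comment> \<open>Every nonempty exchange must absorb \<open>\<kappa>\<close> once. Charging it to
    each element of A covers this and costs at most \<open>card E\<close> times
    \<open>\<kappa>\<close> altogether.\<close>
  define u' where "u' x = u x - (\<Sum>i\<in>{2..<\<mu>}. l i x) - \<kappa>" for x
  have sum_u': "sum u' A = sum u A - (\<Sum>i\<in>{2..<\<mu>}. sum (l i) A) - real (card A) * \<kappa>" for A
    unfolding u'_def sum_subtractf by (subst sum.swap) simp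
  define J1 where "J1 = {x \<in> J0. u' x \<ge> 0}"
  have J1: "J1 \<subseteq> J0" by (auto simp: J1_def)
  have "real p * sum u' J1 \<le> real (p + 1) * sum w S"
  proof (rule two_matroid_exchange_bound[of E "Ind 0" E "Ind 1"])
    show "J1 \<in> Ind 0" "J1 \<in> Ind 1" using matroid_mono[OF M J0_i J1] \<mu> by auto
    show "J1 \<inter> S = {}" using J0 J1 by auto
    fix A R assume A: "A \<subseteq> J1" and R: "R \<subseteq> S" and cA: "card A \<le> p" and cR: "card R \<le> p + 1"
      and i0: "S - R \<union> A \<in> Ind 0" and i1: "S - R \<union> A \<in> Ind 1"
    have AJ0: "A \<subseteq> J0" using A J1 by simp
    have finA: "finite A" using finite_subset[OF AJ0 J0(3)] .
    show "sum u' A \<le> sum w R"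
    proof (cases "A = {}")
      case True
      then show ?thesis using R w_nonneg by (auto intro!: sum_nonneg)
    next
      case False
      have "\<forall>i\<in>{2..<\<mu>}. \<exists>R\<subseteq>S. card R \<le> card A \<and> (S - R) \<union> A \<in> Ind i \<and> sum w R \<le> sum (l i) A"
        using l(2)[OF _ AJ0] by simp
      then obtain Q where Q: "\<And>i. i \<in> {2..<\<mu>} \<Longrightarrow> Q i \<subseteq> S \<and> card (Q i) \<le> card A \<and>
          (S - Q i) \<union> A \<in> Ind i \<and> sum w (Q i) \<le> sum (l i) A" by metis
      define U where "U = R \<union> (\<Union>i\<in>{2..<\<mu>}. Q i)"
      have QS: "Q i \<subseteq> S" if "i \<in> {2..<\<mu>}" for i using Q[OF that] by simp
      have US: "U \<subseteq> S" unfolding U_def using R QS by blast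
      define S' where "S' = (S - U) \<union> A"
      have S'_i: "S' \<in> Ind i" if i: "i < \<mu>" for i
      proof -
        consider "i = 0" | "i = 1" | "i \<in> {2..<\<mu>}" using i by fastforce
        then show ?thesis
        proof cases
          case 1
          have "S' \<subseteq> S - R \<union> A" by (auto simp: S'_def U_def)
          then show ?thesis using matroid_mono[OF M[OF i]] i0 1 by blast
        next
          case 2
          have "S' \<subseteq> S - R \<union> A" by (auto simp: S'_def U_def)
          then show ?thesis using matroid_mono[OF M[OF i]] i1 2 by blast
        next
          case 3
          then have "S' \<subseteq> S - Q i \<union> A" by (auto simp: S'_def U_def)
          then show ?thesis using matroid_mono[OF M[OF i]] Q[OF 3] by blast
        qed
      qed
      have diff: "(S - S') \<union> (S' - S) = U \<union> A" using US AJ0 J0 by (auto simp: S'_def)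
      have "card U \<le> card R + card (\<Union>i\<in>{2..<\<mu>}. Q i)" unfolding U_def by (rule card_Un_le)
      also have "card (\<Union>i\<in>{2..<\<mu>}. Q i) \<le> (\<Sum>i\<in>{2..<\<mu>}. card (Q i))" by (rule card_UN_le) simp
      also have "\<dots> \<le> (\<Sum>i\<in>{2..<\<mu>}. p)" using Q cA by (intro sum_mono) (meson order_trans)
      finally have "card U \<le> card R + (\<mu> - 2) * p" by simp
      \<comment> \<open>At most p + 1 removals for the first two matroids, p for each of the others,
        and p insertions: this is the origin of the exchange size
        \<open>\<mu> * p + 1\<close>.\<close>
      then have "card (U \<union> A) \<le> p + 1 + (\<mu> - 2) * p + p"
        using cA cR card_Un_le[of U A] by linarith
      also have "\<dots> = \<mu> * p + 1" using \<mu> by (auto simp: le_iff_add algebra_simps)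
      finally have "f S' \<le> f S + \<kappa>"
        using S'_i diff by (intro opt) (auto simp: matroid_intersection_def)
      moreover have "f (S \<union> A) + f (S - U) \<le> f S + f S'"
      proof -
        have "S \<union> S' = S \<union> A" "S \<inter> S' = S - U" using AJ0 J0 by (auto simp: S'_def)
        moreover have "S' \<subseteq> E" using SE AJ0 J0 by (auto simp: S'_def)
        ultimately show ?thesis using submod[OF SE, of S'] by simp
      qed
      moreover have "f S - sum w U \<le> f (S - U)"
      proof -
        have "sum w S = sum w U + sum w (S - U)"
          using US fin by (metis add.commute sum.subset_diff)
        then show ?thesis using w w_le[of "S - U"] by auto
      qed
      moreover have "sum u A \<le> f (S \<union> A) - f S" using u_le[OF AJ0] by (simp add: F_def)
      moreover have "sum w U \<le> sum w R + (\<Sum>i\<in>{2..<\<mu>}. sum (l i) A)"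
      proof -
        have union: "sum w (A \<union> B) \<le> sum w A + sum w B" if "A \<subseteq> S" "B \<subseteq> S" for A B
        proof -
          have "finite A" "finite B" using that finite_subset[OF _ fin(1)] by blast+
          moreover have "0 \<le> sum w (A \<inter> B)" using that w_nonneg by (intro sum_nonneg) auto
          ultimately show ?thesis using sum.union_inter[of A B w] by linarith
        qed
        have UN: "sum w (\<Union>i\<in>I. Q i) \<le> (\<Sum>i\<in>I. sum w (Q i))" if "finite I" "I \<subseteq> {2..<\<mu>}" for I
          using that
        proof (induction I rule: finite_induct)
          case (insert i I)
          have "sum w (Q i \<union> (\<Union>i\<in>I. Q i)) \<le> sum w (Q i) + sum w (\<Union>i\<in>I. Q i)"
            using insert.prems QS by (intro union) blast+
          then show ?case using insert by simp
        qed simp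
        have "sum w U \<le> sum w R + sum w (\<Union>i\<in>{2..<\<mu>}. Q i)"
          unfolding U_def using R QS by (intro union) blast+
        also have "sum w (\<Union>i\<in>{2..<\<mu>}. Q i) \<le> (\<Sum>i\<in>{2..<\<mu>}. sum w (Q i))" by (rule UN) auto
        also have "\<dots> \<le> (\<Sum>i\<in>{2..<\<mu>}. sum (l i) A)" using Q by (intro sum_mono) blast
        finally show ?thesis by simp
      qed
      moreover have "\<kappa> \<le> real (card A) * \<kappa>"
      proof -
        have "1 \<le> card A" using False finA by (simp add: card_gt_0_iff Suc_le_eq)
        then show ?thesis using mult_right_mono[of 1 "real (card A)" \<kappa>] \<kappa> by simp
      qed
      ultimately show ?thesis unfolding sum_u' by linarith
    qed
  qed (use M S_i \<mu> p w_nonneg in auto)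
  moreover have "sum u' J0 \<le> sum u' J1"
  proof -
    have "sum u' J0 = sum u' (J0 - J1) + sum u' J1" using J1 J0(3) by (rule sum.subset_diff)
    moreover have "sum u' (J0 - J1) \<le> 0" by (rule sum_nonpos) (auto simp: J1_def)
    ultimately show ?thesis by simp
  qed
  ultimately have "real p * sum u' J0 \<le> real (p + 1) * sum w S"
    using p by (meson mult_left_mono of_nat_0_le_iff order_trans)
  then have 1: "sum u' J0 \<le> (1 + 1 / real p) * f S" using p w by (simp add: field_simps)
  have "(\<Sum>i\<in>{2..<\<mu>}. sum (l i) J0) \<le> (\<Sum>i\<in>{2..<\<mu>}. f S)"
    using l(1) w by (intro sum_mono) auto
  then have 2: "(\<Sum>i\<in>{2..<\<mu>}. sum (l i) J0) \<le> (real \<mu> - 2) * f S" using \<mu> by (simp add: of_nat_diff)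
  have 3: "real (card J0) * \<kappa> \<le> real (card E) * \<kappa>"
    using card_mono[OF finE J0(4)] \<kappa> by (intro mult_right_mono) auto
  have "f J \<le> f (S \<union> J0)" using SE JE by (intro monoD) (auto simp: J0_def)
  also have "\<dots> = sum u J0 + f S" using u by (simp add: F_def)
  finally have 4: "f J \<le> sum u J0 + f S" .
  have "f J \<le> (1 + 1 / real p) * f S + (real \<mu> - 2) * f S + real (card E) * \<kappa> + f S"
    using 1 2 3 4 unfolding sum_u' by linarith
  then show ?thesis by (simp add: algebra_simps)
qed

section \<open>Best responses and multiplicative weights\<close>

text \<open>Monotonicity makes the union the largest and the intersection the smallest of the four
  values, and truncation is increasing and concave.\<close>

lemma submodular_truncate:
  assumes "submodular E f" "monotone_setfun E f"
  shows "submodular E (\<lambda>X. min (f X) \<theta>)"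
  unfolding submodular_def
proof (intro allI impI)
  fix X Y assume XY: "X \<subseteq> E \<and> Y \<subseteq> E"
  have "f (X \<union> Y) + f (X \<inter> Y) \<le> f X + f Y" using assms(1) XY by (auto simp: submodular_def)
  moreover have "f X \<le> f (X \<union> Y)" "f Y \<le> f (X \<union> Y)" "f (X \<inter> Y) \<le> f X" "f (X \<inter> Y) \<le> f Y"
    using assms(2) XY by (auto simp: monotone_setfun_def)
  ultimately show "min (f (X \<union> Y)) \<theta> + min (f (X \<inter> Y)) \<theta> \<le> min (f X) \<theta> + min (f Y) \<theta>"
    by (auto simp: min_def)
qed

lemma submodular_weighted_sum:
  assumes "\<And>k. k \<in> K \<Longrightarrow> submodular E (g k)" "\<And>k. k \<in> K \<Longrightarrow> w k \<ge> 0"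
  shows "submodular E (\<lambda>X. \<Sum>k\<in>K. w k * g k X)"
  unfolding submodular_def
proof (intro allI impI)
  fix X Y assume XY: "X \<subseteq> E \<and> Y \<subseteq> E"
  have "(\<Sum>k\<in>K. w k * (g k (X \<union> Y) + g k (X \<inter> Y))) \<le> (\<Sum>k\<in>K. w k * (g k X + g k Y))"
    using assms XY by (intro sum_mono mult_left_mono) (auto simp: submodular_def)
  then show "(\<Sum>k\<in>K. w k * g k (X \<union> Y)) + (\<Sum>k\<in>K. w k * g k (X \<inter> Y)) \<le> (\<Sum>k\<in>K. w k * g k X) + (\<Sum>k\<in>K. w k * g k Y)"
    by (simp add: distrib_left sum.distrib)
qed

lemma monotone_weighted_sum:
  assumes "\<And>k. k \<in> K \<Longrightarrow> monotone_setfun E (g k)" "\<And>k. k \<in> K \<Longrightarrow> w k \<ge> 0"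
  shows "monotone_setfun E (\<lambda>X. \<Sum>k\<in>K. w k * g k X)"
  unfolding monotone_setfun_def
proof (intro allI impI)
  fix X Y assume XY: "X \<subseteq> Y \<and> Y \<subseteq> E"
  show "(\<Sum>k\<in>K. w k * g k X) \<le> (\<Sum>k\<in>K. w k * g k Y)"
    using assms XY by (intro sum_mono mult_left_mono) (auto simp: monotone_setfun_def)
qed

text \<open>The weight of index k is bounded below through its own gains, the total weight above
  through the gains of the responses, and the exponents are compared. The estimate n \<le> exp n
  stands in for ln n: the regret stays polynomial, and the number of rounds can be computed without
  logarithms.\<close>

lemma mwu_regret:
  fixes w g :: "nat \<Rightarrow> nat \<Rightarrow> real"
  assumes \<theta>: "\<theta> > 0" and \<eta>: "0 < \<eta>" "\<eta> \<le> 1 / 2" and n: "n \<ge> 1"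
    and w0: "\<And>k. k < n \<Longrightarrow> w 0 k = 1"
    and step: "\<And>t k. k < n \<Longrightarrow> t < T \<Longrightarrow> w (Suc t) k = w t k * (1 - \<eta> * g t k / \<theta>)"
    and g: "\<And>t k. k < n \<Longrightarrow> t < T \<Longrightarrow> 0 \<le> g t k \<and> g t k \<le> \<theta>"
    and gain: "\<And>t. t < T \<Longrightarrow> (\<Sum>k<n. w t k * g t k) \<ge> a * (\<Sum>k<n. w t k)"
    and k: "k < n"
  shows "a * real T - \<theta> * real n / \<eta> \<le> (1 + 2 * \<eta>) * (\<Sum>t<T. g t k)"
proof -
  have x: "0 \<le> \<eta> * g t j / \<theta>" "\<eta> * g t j / \<theta> \<le> \<eta>" "\<eta> * g t j / \<theta> \<le> 1 / 2" if "j < n" "t < T" for t j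
  proof -
    have "g t j / \<theta> \<le> 1" "0 \<le> g t j / \<theta>" using g[OF that] \<theta> by auto
    then have "\<eta> * (g t j / \<theta>) \<le> \<eta> * 1" using \<eta> by (intro mult_left_mono) auto
    then show "\<eta> * g t j / \<theta> \<le> \<eta>" by simp
    then show "\<eta> * g t j / \<theta> \<le> 1 / 2" using \<eta> by linarith
    show "0 \<le> \<eta> * g t j / \<theta>" using g[OF that] \<theta> \<eta> by simp
  qed
  have lower: "exp (- (1 + 2 * \<eta>) * \<eta> / \<theta> * (\<Sum>i<t. g i k)) \<le> w t k" if "t \<le> T" for t
    using that
  proof (induction t)
    case 0
    then show ?case using w0[OF k] by simp
  next
    case (Suc t)
    let ?x = "\<eta> * g t k / \<theta>"
    have t: "t < T" using Suc.prems by simp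
    \<comment> \<open>For 0 \<le> x \<le> \<eta> \<le> 1 / 2: ln (1 - x) is at least - x - 2 x^2,
      and the quadratic term is at most 2 \<eta> x.\<close>
    have "?x * ?x \<le> \<eta> * ?x" using x[OF k t] by (intro mult_right_mono) auto
    moreover have "- (1 + 2 * \<eta>) * y \<le> - y - 2 * y\<^sup>2" if "y * y \<le> \<eta> * y" for y
      using that by (simp add: power2_eq_square algebra_simps)
    ultimately have "- (1 + 2 * \<eta>) * ?x \<le> - ?x - 2 * ?x\<^sup>2" by blast
    also have "\<dots> \<le> ln (1 - ?x)" using x[OF k t] by (intro ln_one_minus_pos_lower_bound) auto
    finally have "- (1 + 2 * \<eta>) * ?x \<le> ln (1 - ?x)" .
    moreover have pos: "0 < 1 - ?x" using x(3)[OF k t] by linarith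
    ultimately have "exp (- (1 + 2 * \<eta>) * ?x) \<le> 1 - ?x" using ln_ge_iff[OF pos] by blast
    then have "exp (- (1 + 2 * \<eta>) * \<eta> / \<theta> * (\<Sum>i<t. g i k)) * exp (- (1 + 2 * \<eta>) * ?x) \<le> w t k * (1 - ?x)"
      using Suc.IH t x[OF k t] by (intro mult_mono) (auto intro: order_trans[OF exp_ge_zero])
    also have "exp (- (1 + 2 * \<eta>) * \<eta> / \<theta> * (\<Sum>i<t. g i k)) * exp (- (1 + 2 * \<eta>) * ?x)
        = exp (- (1 + 2 * \<eta>) * \<eta> / \<theta> * (\<Sum>i<Suc t. g i k))"
      unfolding exp_add [symmetric] by (simp add: algebra_simps add_divide_distrib diff_divide_distrib)
    finally show ?case using step[OF k t] by simp
  qed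
  have nonneg: "w t j \<ge> 0" if "j < n" "t \<le> T" for t j
    using that(2)
  proof (induction t)
    case (Suc t)
    have "0 \<le> 1 - \<eta> * g t j / \<theta>" using x(3)[OF that(1), of t] Suc.prems by linarith
    then show ?case using step[OF that(1), of t] Suc by simp
  qed (use w0 that in auto)
  have upper: "(\<Sum>j<n. w t j) \<le> real n * exp (- \<eta> * a / \<theta> * real t)" if "t \<le> T" for t
    using that
  proof (induction t)
    case 0
    then show ?case using w0 by simp
  next
    case (Suc t)
    have t: "t < T" using Suc.prems by simp
    have "(\<Sum>j<n. w (Suc t) j) = (\<Sum>j<n. w t j) - \<eta> / \<theta> * (\<Sum>j<n. w t j * g t j)"
    proof -
      have "(\<Sum>j<n. w (Suc t) j) = (\<Sum>j<n. w t j - \<eta> / \<theta> * (w t j * g t j))"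
        using step t by (intro sum.cong) (auto simp: algebra_simps)
      then show ?thesis by (simp add: sum_subtractf sum_distrib_left)
    qed
    also have "\<dots> \<le> (\<Sum>j<n. w t j) - \<eta> / \<theta> * (a * (\<Sum>j<n. w t j))"
      using gain[OF t] \<eta> \<theta> by (intro diff_left_mono mult_left_mono) auto
    also have "\<dots> = (\<Sum>j<n. w t j) * (1 - \<eta> * a / \<theta>)" by (simp add: algebra_simps)
    also have "\<dots> \<le> (\<Sum>j<n. w t j) * exp (- \<eta> * a / \<theta>)"
      using exp_ge_add_one_self[of "- \<eta> * a / \<theta>"] nonneg t by (intro mult_left_mono sum_nonneg) auto
    also have "\<dots> \<le> real n * exp (- \<eta> * a / \<theta> * real t) * exp (- \<eta> * a / \<theta>)"
      using Suc.IH t by (intro mult_right_mono) auto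
    also have "\<dots> = real n * exp (- \<eta> * a / \<theta> * real (Suc t))"
      by (simp add: exp_add [symmetric] algebra_simps add_divide_distrib)
    finally show ?case .
  qed
  have "w T k \<le> (\<Sum>j<n. w T j)"
    using k nonneg by (intro member_le_sum) auto
  then have "exp (- (1 + 2 * \<eta>) * \<eta> / \<theta> * (\<Sum>i<T. g i k)) \<le> real n * exp (- \<eta> * a / \<theta> * real T)"
    using lower[of T] upper[of T] by linarith
  also have "\<dots> \<le> exp (real n) * exp (- \<eta> * a / \<theta> * real T)"
    using exp_ge_add_one_self[of "real n"] by (intro mult_right_mono) (linarith, simp)
  finally have "exp (- (1 + 2 * \<eta>) * \<eta> / \<theta> * (\<Sum>i<T. g i k)) \<le> exp (real n + - \<eta> * a / \<theta> * real T)"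
    by (simp only: exp_add)
  then have "- (1 + 2 * \<eta>) * \<eta> / \<theta> * (\<Sum>i<T. g i k) \<le> real n + - \<eta> * a / \<theta> * real T" by (simp only: exp_le_cancel_iff)
  then have le: "(\<theta> / \<eta>) * (- (1 + 2 * \<eta>) * \<eta> / \<theta> * (\<Sum>i<T. g i k)) \<le> (\<theta> / \<eta>) * (real n + - \<eta> * a / \<theta> * real T)"
    using \<theta> \<eta> by (intro mult_left_mono) auto
  have eqG: "(\<theta> / \<eta>) * (- (1 + 2 * \<eta>) * \<eta> / \<theta> * G) = - ((1 + 2 * \<eta>) * G)" for G
    using \<theta> \<eta> by (simp, simp add: algebra_simps)
  have eqN: "(\<theta> / \<eta>) * (real n + - \<eta> * a / \<theta> * real T) = \<theta> * real n / \<eta> - a * real T"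
    using \<theta> \<eta> by (simp add: field_simps)
  from le show ?thesis unfolding eqG eqN by linarith
qed

lemma submodularD: "submodular E f \<Longrightarrow> X \<subseteq> E \<Longrightarrow> Y \<subseteq> E \<Longrightarrow> f (X \<union> Y) + f (X \<inter> Y) \<le> f X + f Y"
  by (simp add: submodular_def)

section \<open>Truncated payoffs and approximate best responses\<close>

locale robust_problem =
  fixes E :: "'a set" and n :: nat and f :: "nat \<Rightarrow> 'a set \<Rightarrow> real" and Ind :: "nat \<Rightarrow> 'a set set" and \<mu> :: nat
  assumes finE: "finite E" and n: "n \<ge> 1" and \<mu>: "\<mu> \<ge> 2"
    and f_nonneg: "\<And>k X. k < n \<Longrightarrow> X \<subseteq> E \<Longrightarrow> f k X \<ge> 0"
    and f_empty: "\<And>k. k < n \<Longrightarrow> f k {} = 0"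
    and f_mono: "\<And>k. k < n \<Longrightarrow> monotone_setfun E (f k)"
    and f_submod: "\<And>k. k < n \<Longrightarrow> submodular E (f k)"
    and matroids: "\<And>i. i < \<mu> \<Longrightarrow> matroid E (Ind i)"
begin

abbreviation "\<I> \<equiv> matroid_intersection \<mu> Ind"

abbreviation "\<nu> \<equiv> nu_star \<I> n f"

lemma indep_subset: "X \<in> \<I> \<Longrightarrow> X \<subseteq> E"
  using matroids[of 0] \<mu> by (auto simp: matroid_intersection_def matroid_def)

lemma indep_mono: "Y \<in> \<I> \<Longrightarrow> X \<subseteq> Y \<Longrightarrow> X \<in> \<I>"
  using matroid_mono[OF matroids] unfolding matroid_intersection_def by blast

lemma empty_indep: "{} \<in> \<I>"
  using matroids by (auto simp: matroid_intersection_def matroid_def)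

lemma finite_indep: "finite \<I>"
  using indep_subset finE by (meson finite_Pow_iff finite_subset PowI subsetI)

lemma robust_optimum:
  obtains p where "p \<in> \<Delta> \<I>" "\<And>k. k < n \<Longrightarrow> \<nu> \<le> (\<Sum>X\<in>\<I>. pmf p X * f k X)"
proof -
  obtain p where p: "p \<in> \<Delta> \<I>" "robust_value \<I> n f p = \<nu>"
    using nu_star_is_max[OF finite_indep _ n, of f] empty_indep by auto
  have "\<nu> \<le> (\<Sum>X\<in>\<I>. pmf p X * f k X)" if "k < n" for k
    unfolding p(2) [symmetric] robust_value_def using that by (intro Min_le) auto
  then show ?thesis using that p by blast
qed

lemma pmf_sum_1: "p \<in> \<Delta> \<I> \<Longrightarrow> (\<Sum>X\<in>\<I>. pmf p X) = 1"
  using finite_indep by (intro sum_pmf_eq_1) (auto simp: \<Delta>_def)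

text \<open>Submodularity bounds f k on a set by the sum over its singletons, and the optimal
  strategy earns at least \<open>\<nu>\<close> on every single index.\<close>

lemma nu_star_le:
  assumes "k < n" "\<beta> \<ge> 0" and \<beta>: "\<And>e. {e} \<in> \<I> \<Longrightarrow> f k {e} \<le> \<beta>"
  shows "\<nu> \<le> real (card E) * \<beta>"
proof -
  have le: "f k X \<le> real (card E) * \<beta>" if X: "X \<in> \<I>" for X
  proof -
    have fin: "finite X" using indep_subset[OF X] finE finite_subset by auto
    have "f k X \<le> real (card X) * \<beta>"
      using fin X
    proof (induction X rule: finite_induct)
      case empty
      then show ?case using f_empty assms by simp
    next
      case (insert x X)
      have "insert x X \<subseteq> E" using indep_subset insert.prems by blast
      then have "f k ({x} \<union> X) + f k ({x} \<inter> X) \<le> f k {x} + f k X"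
        by (intro submodularD[OF f_submod[OF assms(1)]]) auto
      moreover have "f k {x} \<le> \<beta>" using indep_mono[OF insert.prems, of "{x}"] by (intro \<beta>) auto
      moreover have "f k X \<le> real (card X) * \<beta>"
        using indep_mono[OF insert.prems, of X] by (intro insert.IH) auto
      ultimately show ?case
        using insert.hyps f_empty[OF assms(1)] by (simp add: algebra_simps)
    qed
    also have "\<dots> \<le> real (card E) * \<beta>"
      using card_mono[OF finE indep_subset[OF X]] assms(2) by (intro mult_right_mono) auto
    finally show ?thesis .
  qed
  obtain p where p: "p \<in> \<Delta> \<I>" "\<And>k. k < n \<Longrightarrow> \<nu> \<le> (\<Sum>X\<in>\<I>. pmf p X * f k X)"
    using robust_optimum by blast
  have "\<nu> \<le> (\<Sum>X\<in>\<I>. pmf p X * f k X)" using p(2) assms(1) by blast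
  also have "\<dots> \<le> (\<Sum>X\<in>\<I>. pmf p X * (real (card E) * \<beta>))"
    using le by (intro sum_mono mult_left_mono) auto
  also have "\<dots> = real (card E) * \<beta>" using pmf_sum_1[OF p(1)] by (simp add: sum_distrib_right [symmetric])
  finally show ?thesis .
qed

definition trunc :: "real \<Rightarrow> (nat \<Rightarrow> real) \<Rightarrow> 'a set \<Rightarrow> real" where
  "trunc \<theta> w X = (\<Sum>k<n. w k * min (f k X) \<theta>)"

text \<open>The min-max over singletons in the form in which it is used: one index bounds
  \<open>\<nu>\<close> from above, and every index offers a singleton worth \<open>\<beta>\<close>.
  The alternative \<open>\<beta> = 0\<close> covers indices without any feasible singleton.\<close>

definition bottleneck :: "real \<Rightarrow> bool" where
  "bottleneck \<beta> \<longleftrightarrow> \<beta> \<ge> 0 \<and> (\<exists>k<n. \<forall>e. {e} \<in> \<I> \<longrightarrow> f k {e} \<le> \<beta>) \<and>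
     (\<forall>k<n. \<beta> = 0 \<or> (\<exists>e. {e} \<in> \<I> \<and> \<beta> \<le> f k {e}))"

lemma heavy_coordinate:
  assumes "finite K" "(\<Sum>k\<in>K. w k) \<ge> c" "card K \<le> n" "c > 0"
  shows "\<exists>k\<in>K. w k \<ge> (c :: real) / real n"
proof (rule ccontr)
  assume "\<not> ?thesis"
  then have less: "w k < c / real n" if "k \<in> K" for k using that by force
  have "K \<noteq> {}" using assms by auto
  then have "(\<Sum>k\<in>K. w k) < (\<Sum>k\<in>K. c / real n)" using less assms by (intro sum_strict_mono) auto
  also have "\<dots> = real (card K) * c / real n" by simp
  also have "\<dots> \<le> real n * c / real n" using assms by (intro divide_right_mono mult_right_mono) auto
  finally show False using assms n by simp
qed

text \<open>Let \<open>K\<close> be the indices whose function exceeds \<theta> on some feasible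
  set. If \<open>K\<close> carries a fraction 1 / D of the total weight W, a single index of weight
  at least W / (D n) earns W |E| \<beta> by the choice of \<theta>, which is at least \<nu> W.
  Otherwise truncation is inactive on all but a fraction 1 / D of the weight, and averaging over an
  optimal strategy provides a set.\<close>

lemma trunc_ge_nu_star:
  assumes \<beta>: "bottleneck \<beta>" and \<theta>: "\<theta> = real n * real (card E) * D * \<beta>" and D: "D \<ge> 1"
    and w: "\<And>k. k < n \<Longrightarrow> w k \<ge> 0"
  shows "\<exists>X\<in>\<I>. (1 - 1 / D) * \<nu> * (\<Sum>k<n. w k) \<le> trunc \<theta> w X"
proof -
  define W where "W = (\<Sum>k<n. w k)"
  have W: "W \<ge> 0" unfolding W_def using w by (intro sum_nonneg) auto
  have \<beta>0: "\<beta> \<ge> 0" and \<theta>0: "\<theta> \<ge> 0" using \<beta> D by (auto simp: bottleneck_def \<theta>)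
  have \<nu>\<beta>: "\<nu> \<le> real (card E) * \<beta>" using \<beta> nu_star_le unfolding bottleneck_def by blast
  have term0: "w k * min (f k X) \<theta> \<ge> 0" if "k < n" "X \<in> \<I>" for k X
    using w f_nonneg[OF that(1) indep_subset[OF that(2)]] that \<theta>0 by auto
  have trunc0: "trunc \<theta> w X \<ge> 0" if "X \<in> \<I>" for X
    unfolding trunc_def using term0 that by (intro sum_nonneg) auto
  define K where "K = {k. k < n \<and> (\<exists>X\<in>\<I>. f k X > \<theta>)}"
  have finK: "finite K" and KN: "K \<subseteq> {..<n}" by (auto simp: K_def)
  show ?thesis
  proof (cases "\<nu> \<le> 0 \<or> W = 0")
    case True
    then have "(1 - 1 / D) * \<nu> * W \<le> 0"
      using W D by (auto simp: mult_le_0_iff zero_le_mult_iff)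
    then show ?thesis using trunc0 empty_indep W_def by force
  next
    case False
    then have \<nu>: "\<nu> > 0" and Wpos: "W > 0" using W by auto
    show ?thesis
    proof (cases "(\<Sum>k\<in>K. w k) \<ge> W / D")
      case True
      obtain k where k: "k \<in> K" "w k \<ge> W / D / real n"
        using heavy_coordinate[OF finK True] card_mono[OF _ KN] D Wpos by auto
      then obtain X where X: "X \<in> \<I>" "f k X > \<theta>" by (auto simp: K_def)
      have "(1 - 1 / D) * \<nu> * W \<le> 1 * \<nu> * W" using D \<nu> Wpos by (intro mult_right_mono) auto
      also have "\<dots> \<le> real (card E) * \<beta> * W" using \<nu>\<beta> W by (simp add: mult_right_mono)
      also have "\<dots> = W / D / real n * \<theta>" using D n by (simp add: \<theta>)
      also have "\<dots> \<le> w k * \<theta>" using k \<theta>0 by (intro mult_right_mono) auto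
      also have "\<dots> = w k * min (f k X) \<theta>" using X by simp
      also have "\<dots> \<le> trunc \<theta> w X"
        unfolding trunc_def using k KN term0 X by (intro member_le_sum) auto
      finally show ?thesis using X W_def by blast
    next
      case False
      obtain p where p: "p \<in> \<Delta> \<I>" "\<And>k. k < n \<Longrightarrow> \<nu> \<le> (\<Sum>X\<in>\<I>. pmf p X * f k X)"
        using robust_optimum by blast
      have split: "W = (\<Sum>k\<in>{..<n} - K. w k) + (\<Sum>k\<in>K. w k)"
        unfolding W_def using KN by (intro sum.subset_diff) auto
      define c where "c = (1 - 1 / D) * \<nu> * W"
      have "c = (W - W / D) * \<nu>" by (simp add: c_def algebra_simps)
      also have "\<dots> \<le> (\<Sum>k\<in>{..<n} - K. w k) * \<nu>" using split False \<nu> by (intro mult_right_mono) auto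
      also have "\<dots> = (\<Sum>k\<in>{..<n} - K. w k * \<nu>)" by (simp add: sum_distrib_right)
      also have "\<dots> \<le> (\<Sum>k\<in>{..<n} - K. w k * (\<Sum>X\<in>\<I>. pmf p X * f k X))"
        using p w by (intro sum_mono mult_left_mono) auto
      also have "\<dots> = (\<Sum>k\<in>{..<n} - K. \<Sum>X\<in>\<I>. pmf p X * (w k * f k X))"
        by (simp add: sum_distrib_left mult.left_commute)
      also have "\<dots> = (\<Sum>X\<in>\<I>. \<Sum>k\<in>{..<n} - K. pmf p X * (w k * f k X))" by (rule sum.swap)
      also have "\<dots> = (\<Sum>X\<in>\<I>. pmf p X * (\<Sum>k\<in>{..<n} - K. w k * f k X))"
        by (simp add: sum_distrib_left)
      also have "\<dots> \<le> (\<Sum>X\<in>\<I>. pmf p X * trunc \<theta> w X)"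
      proof (intro sum_mono mult_left_mono)
        fix X assume X: "X \<in> \<I>"
        have "(\<Sum>k\<in>{..<n} - K. w k * f k X) = (\<Sum>k\<in>{..<n} - K. w k * min (f k X) \<theta>)"
          using X by (intro sum.cong) (auto simp: K_def not_less min_absorb1)
        also have "\<dots> \<le> trunc \<theta> w X"
          unfolding trunc_def using term0 X by (intro sum_mono2) auto
        finally show "(\<Sum>k\<in>{..<n} - K. w k * f k X) \<le> trunc \<theta> w X" .
      qed auto
      finally have c: "c \<le> (\<Sum>X\<in>\<I>. pmf p X * trunc \<theta> w X)" .
      have "\<exists>X\<in>\<I>. c \<le> trunc \<theta> w X"
      proof (rule ccontr)
        assume "\<not> ?thesis"
        then have less: "trunc \<theta> w X < c" if "X \<in> \<I>" for X using that by force
        have "\<exists>X0\<in>\<I>. pmf p X0 \<noteq> 0"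
          using pmf_sum_1[OF p(1)] sum.neutral[of \<I> "pmf p"] by fastforce
        then obtain X0 where X0: "X0 \<in> \<I>" "pmf p X0 > 0"
          using pmf_nonneg[of p] by (auto simp: less_le)
        have "(\<Sum>X\<in>\<I>. pmf p X * trunc \<theta> w X) < (\<Sum>X\<in>\<I>. pmf p X * c)"
          using X0 less finite_indep
          by (intro sum_strict_mono_ex1 ballI bexI[of _ X0] mult_left_mono mult_strict_left_mono)
             (auto simp: less_imp_le)
        then show False using c pmf_sum_1[OF p(1)] by (simp add: sum_distrib_right [symmetric])
      qed
      then show ?thesis by (simp add: c_def W_def)
    qed
  qed
qed

text \<open>A heavy index and its best singleton suffice; the value \<beta> survives truncation
  because \<beta> \<le> \<theta> as soon as E is nonempty. Errors proportional to \<beta> are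
  measured against this bound.\<close>

lemma trunc_ge_bottleneck:
  assumes \<beta>: "bottleneck \<beta>" and \<theta>: "\<theta> = real n * real (card E) * D * \<beta>" and D: "D \<ge> 1"
    and w: "\<And>k. k < n \<Longrightarrow> w k \<ge> 0"
  shows "\<exists>X\<in>\<I>. \<beta> / real n * (\<Sum>k<n. w k) \<le> trunc \<theta> w X"
proof -
  define W where "W = (\<Sum>k<n. w k)"
  have W: "W \<ge> 0" unfolding W_def using w by (intro sum_nonneg) auto
  have \<beta>0: "\<beta> \<ge> 0" and \<theta>0: "\<theta> \<ge> 0" using \<beta> D by (auto simp: bottleneck_def \<theta>)
  have term0: "w k * min (f k X) \<theta> \<ge> 0" if "k < n" "X \<in> \<I>" for k X
    using w f_nonneg[OF that(1) indep_subset[OF that(2)]] that \<theta>0 by auto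
  show ?thesis
  proof (cases "W = 0 \<or> \<beta> = 0")
    case True
    have "trunc \<theta> w {} \<ge> 0" unfolding trunc_def using term0 empty_indep by (intro sum_nonneg) auto
    then show ?thesis using True empty_indep W_def by force
  next
    case False
    then have "W > 0" using W by simp
    then obtain k where k: "k < n" "w k \<ge> W / real n"
      using heavy_coordinate[of "{..<n}" W w] by (auto simp: W_def)
    obtain e where e: "{e} \<in> \<I>" "\<beta> \<le> f k {e}" using \<beta> False k unfolding bottleneck_def by blast
    have "e \<in> E" using indep_subset[OF e(1)] by simp
    then have "real (card E) \<ge> 1" using finE by (simp add: card_gt_0_iff Suc_le_eq) blast
    then have "1 * 1 * 1 \<le> real n * real (card E) * D" using n D by (intro mult_mono) auto
    then have "\<beta> \<le> \<theta>" unfolding \<theta> using mult_right_mono[of 1 _ \<beta>] \<beta>0 by simp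
    have "\<beta> / real n * W = W / real n * \<beta>" by simp
    also have "\<dots> \<le> w k * min (f k {e}) \<theta>"
      using k e \<open>\<beta> \<le> \<theta>\<close> \<beta>0 w[OF k(1)] by (intro mult_mono) auto
    also have "\<dots> \<le> trunc \<theta> w {e}"
      unfolding trunc_def using k term0 e by (intro member_le_sum) auto
    finally show ?thesis using e W_def by blast
  qed
qed

text \<open>\<open>\<kappa>\<close> is chosen so that \<open>card E\<close> times it is at most a
  fraction 1 / D of the value of the comparison set, which is at least \<beta> / n per unit of
  weight. The slack thus costs one more factor 1 - 1 / D.\<close>

lemma local_optimum_response:
  assumes \<beta>: "bottleneck \<beta>" and \<theta>: "\<theta> = real n * real (card E) * D * \<beta>" and D: "D \<ge> 1"
    and w: "\<And>k. k < n \<Longrightarrow> w k \<ge> 0" and p: "p > 0" and S: "S \<in> \<I>"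
    and \<kappa>: "\<kappa> = (\<Sum>k<n. w k) * \<beta> / (D * real n * real (card E))"
    and opt: "\<And>S'. S' \<in> \<I> \<Longrightarrow> card ((S - S') \<union> (S' - S)) \<le> \<mu> * p + 1 \<Longrightarrow> trunc \<theta> w S' \<le> trunc \<theta> w S + \<kappa>"
  shows "(1 - 1 / D) / (real \<mu> + 1 / real p) * max ((1 - 1 / D) * \<nu>) (\<beta> / real n) * (\<Sum>k<n. w k) \<le> trunc \<theta> w S"
proof -
  define W where "W = (\<Sum>k<n. w k)"
  have W: "W \<ge> 0" unfolding W_def using w by (intro sum_nonneg) auto
  have \<beta>0: "\<beta> \<ge> 0" and \<theta>0: "\<theta> \<ge> 0" using \<beta> D by (auto simp: bottleneck_def \<theta>)
  define a where "a = max ((1 - 1 / D) * \<nu>) (\<beta> / real n)"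
  have "\<exists>X\<in>\<I>. (1 - 1 / D) * \<nu> * W \<le> trunc \<theta> w X" "\<exists>X\<in>\<I>. \<beta> / real n * W \<le> trunc \<theta> w X"
    unfolding W_def by (rule trunc_ge_nu_star[OF \<beta> \<theta> D w] trunc_ge_bottleneck[OF \<beta> \<theta> D w]; assumption)+
  then obtain J where J: "J \<in> \<I>" "a * W \<le> trunc \<theta> w J"
    by (metis a_def max_def)
  have "trunc \<theta> w J \<le> (real \<mu> + 1 / real p) * trunc \<theta> w S + real (card E) * \<kappa>"
  proof (rule approx_local_optimum_bound[where f = "trunc \<theta> w" and S = S and J = J and E = E and \<kappa> = \<kappa>, OF matroids \<mu> p _ _ _ S J(1) _ opt])
    show "submodular E (trunc \<theta> w)"
      unfolding trunc_def[abs_def] using f_submod f_mono w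
      by (intro submodular_weighted_sum submodular_truncate) auto
    have "monotone_setfun E (\<lambda>X. min (f k X) \<theta>)" if "k < n" for k
      using f_mono[OF that] by (auto simp: monotone_setfun_def min.coboundedI1)
    then show "monotone_setfun E (trunc \<theta> w)"
      unfolding trunc_def[abs_def] using w by (intro monotone_weighted_sum) auto
    show "trunc \<theta> w {} = 0" using f_empty \<theta>0 by (simp add: trunc_def)
    show "\<kappa> \<ge> 0" using \<beta>0 W D by (simp add: \<kappa> W_def)
  qed
  moreover have "real (card E) * \<kappa> \<le> trunc \<theta> w J / D"
  proof -
    have "real (card E) * \<kappa> \<le> W * \<beta> / (D * real n)"
      using W \<beta>0 D by (cases "card E = 0") (auto simp: \<kappa> W_def field_simps)
    also have "\<dots> = \<beta> / real n * W / D" by (simp add: mult.commute)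
    also have "\<dots> \<le> a * W / D"
      using W D by (intro divide_right_mono mult_right_mono) (auto simp: a_def)
    also have "\<dots> \<le> trunc \<theta> w J / D" using J D by (intro divide_right_mono) auto
    finally show ?thesis .
  qed
  ultimately have "(1 - 1 / D) * trunc \<theta> w J \<le> (real \<mu> + 1 / real p) * trunc \<theta> w S"
    by (simp add: algebra_simps)
  moreover have "(1 - 1 / D) * (a * W) \<le> (1 - 1 / D) * trunc \<theta> w J"
    using J D by (intro mult_left_mono) auto
  ultimately have "(1 - 1 / D) * (a * W) \<le> (real \<mu> + 1 / real p) * trunc \<theta> w S" by linarith
  moreover have "real \<mu> + 1 / real p > 0" using \<mu> by (simp add: add_pos_nonneg)
  ultimately have "(1 - 1 / D) * (a * W) / (real \<mu> + 1 / real p) \<le> trunc \<theta> w S"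
    by (simp add: pos_divide_le_eq mult.commute)
  then show ?thesis unfolding a_def [symmetric] W_def [symmetric] by simp
qed

end

section \<open>Total correctness with running time\<close>

text \<open>Because execution is deterministic, the existence of one execution already expresses
  total correctness.\<close>

definition run :: "'a oracles \<Rightarrow> com \<Rightarrow> state \<Rightarrow> nat \<Rightarrow> (state \<Rightarrow> bool) \<Rightarrow> bool" where
  "run \<Omega> c s T Q \<longleftrightarrow> (\<exists>t s'. exec \<Omega> c s t s' \<and> t \<le> T \<and> Q s')"

lemma run_weaken:
  assumes "run \<Omega> c s T Q" "\<And>s'. Q s' \<Longrightarrow> Q' s'" "T \<le> T'"
  shows "run \<Omega> c s T' Q'"
  using assms unfolding run_def by (meson order_trans)

lemma run_NAssign: "Q (nupd s x (nval i s) (nval a s)) \<Longrightarrow> run \<Omega> (NAssign x i a) s 1 Q"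
  unfolding run_def using exec.NAssign by blast

lemma exec_atomic:
  "exec \<Omega> Skip s t s' \<longleftrightarrow> t = 1 \<and> s' = s"
  "exec \<Omega> (NAssign x i a) s t s' \<longleftrightarrow> t = 1 \<and> s' = nupd s x (nval i s) (nval a s)"
  "exec \<Omega> (RAssign x i r) s t s' \<longleftrightarrow> t = 1 \<and> s' = rupd s x (nval i s) (rval r s)"
  "exec \<Omega> (ValueQuery x i k y a) s t s' \<longleftrightarrow> t = 1 \<and> s' = rupd s x (nval i s)
     (value_oracle \<Omega> (nval k s) (decode (elements \<Omega>) s y (nval a s)))"
  "exec \<Omega> (IndepQuery x i k y a) s t s' \<longleftrightarrow> t = 1 \<and> s' = nupd s x (nval i s)
     (if decode (elements \<Omega>) s y (nval a s) \<in> indep_oracle \<Omega> (nval k s) then 1 else 0)"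
  by (subst exec.simps; auto)+

lemma exec_Seq: "exec \<Omega> (Seq c1 c2) s t s' \<longleftrightarrow> (\<exists>t1 s1 t2. exec \<Omega> c1 s t1 s1 \<and> exec \<Omega> c2 s1 t2 s' \<and> t = t1 + t2)"
  by (subst exec.simps) auto

lemma exec_Cond: "exec \<Omega> (Cond b c1 c2) s t s' \<longleftrightarrow> (\<exists>t1. t = t1 + 1 \<and> exec \<Omega> (if bval b s then c1 else c2) s t1 s')"
  by (subst exec.simps) auto

lemma run_atomic:
  "run \<Omega> Skip s T Q \<longleftrightarrow> 1 \<le> T \<and> Q s"
  "run \<Omega> (NAssign x i a) s T Q \<longleftrightarrow> 1 \<le> T \<and> Q (nupd s x (nval i s) (nval a s))"
  "run \<Omega> (RAssign x i r) s T Q \<longleftrightarrow> 1 \<le> T \<and> Q (rupd s x (nval i s) (rval r s))"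
  "run \<Omega> (ValueQuery x i k y a) s T Q \<longleftrightarrow> 1 \<le> T \<and> Q (rupd s x (nval i s)
     (value_oracle \<Omega> (nval k s) (decode (elements \<Omega>) s y (nval a s))))"
  "run \<Omega> (IndepQuery x i k y a) s T Q \<longleftrightarrow> 1 \<le> T \<and> Q (nupd s x (nval i s)
     (if decode (elements \<Omega>) s y (nval a s) \<in> indep_oracle \<Omega> (nval k s) then 1 else 0))"
  by (auto simp: run_def exec_atomic)

lemma run_iff_step:
  assumes "\<And>t s'. exec \<Omega> c s t s' \<longleftrightarrow> (\<exists>t1. t = t1 + 1 \<and> exec \<Omega> c' s1 t1 s')"
  shows "run \<Omega> c s T Q \<longleftrightarrow> 1 \<le> T \<and> run \<Omega> c' s1 (T - 1) Q"
proof
  assume "run \<Omega> c s T Q"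
  then obtain t1 s' where "exec \<Omega> c' s1 t1 s'" "t1 + 1 \<le> T" "Q s'" unfolding run_def assms by blast
  then show "1 \<le> T \<and> run \<Omega> c' s1 (T - 1) Q" unfolding run_def
    by (intro conjI exI[of _ t1] exI[of _ s']) auto
next
  assume "1 \<le> T \<and> run \<Omega> c' s1 (T - 1) Q"
  then obtain t1 s' where "1 \<le> T" "exec \<Omega> c' s1 t1 s'" "t1 \<le> T - 1" "Q s'" unfolding run_def by blast
  then show "run \<Omega> c s T Q" unfolding run_def assms
    by (intro exI[of _ "t1 + 1"] exI[of _ s']) auto
qed

lemma run_Seq_iff_atomic:
  assumes "\<And>t s'. exec \<Omega> c1 s t s' \<longleftrightarrow> t = 1 \<and> s' = s1"
  shows "run \<Omega> (Seq c1 c2) s T Q \<longleftrightarrow> 1 \<le> T \<and> run \<Omega> c2 s1 (T - 1) Q"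
  by (rule run_iff_step) (auto simp: exec_Seq assms)

lemma run_Seq_atomic:
  "run \<Omega> (Seq Skip c) s T Q \<longleftrightarrow> 1 \<le> T \<and> run \<Omega> c s (T - 1) Q"
  "run \<Omega> (Seq (NAssign x i a) c) s T Q \<longleftrightarrow> 1 \<le> T \<and> run \<Omega> c (nupd s x (nval i s) (nval a s)) (T - 1) Q"
  "run \<Omega> (Seq (RAssign x i r) c) s T Q \<longleftrightarrow> 1 \<le> T \<and> run \<Omega> c (rupd s x (nval i s) (rval r s)) (T - 1) Q"
  "run \<Omega> (Seq (ValueQuery x i k y a) c) s T Q \<longleftrightarrow> 1 \<le> T \<and> run \<Omega> c (rupd s x (nval i s)
     (value_oracle \<Omega> (nval k s) (decode (elements \<Omega>) s y (nval a s)))) (T - 1) Q"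
  "run \<Omega> (Seq (IndepQuery x i k y a) c) s T Q \<longleftrightarrow> 1 \<le> T \<and> run \<Omega> c (nupd s x (nval i s)
     (if decode (elements \<Omega>) s y (nval a s) \<in> indep_oracle \<Omega> (nval k s) then 1 else 0)) (T - 1) Q"
  by (rule run_Seq_iff_atomic, rule exec_atomic)+

lemma run_Cond_iff:
  "run \<Omega> (Cond b c1 c2) s T Q \<longleftrightarrow> 1 \<le> T \<and> run \<Omega> (if bval b s then c1 else c2) s (T - 1) Q"
  by (rule run_iff_step) (auto simp: exec_Cond)

lemma run_Seq_Cond_iff:
  "run \<Omega> (Seq (Cond b c1 c2) c) s T Q \<longleftrightarrow> 1 \<le> T \<and> run \<Omega> (Seq (if bval b s then c1 else c2) c) s (T - 1) Q"
  by (rule run_iff_step) (fastforce simp: exec_Cond exec_Seq)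

text \<open>As equivalences, these rules let the simplifier execute straight-line code and count its
  time.\<close>

lemmas run_simps = run_atomic run_Seq_atomic run_Cond_iff run_Seq_Cond_iff

lemma run_Seq:
  assumes "run \<Omega> c1 s T1 P" "\<And>s1. P s1 \<Longrightarrow> run \<Omega> c2 s1 T2 Q"
  shows "run \<Omega> (Seq c1 c2) s (T1 + T2) Q"
proof -
  obtain t1 s1 where 1: "exec \<Omega> c1 s t1 s1" "t1 \<le> T1" "P s1" using assms(1) unfolding run_def by blast
  obtain t2 s2 where 2: "exec \<Omega> c2 s1 t2 s2" "t2 \<le> T2" "Q s2" using assms(2)[OF 1(3)] unfolding run_def by blast
  show ?thesis unfolding run_def using exec.Seq[OF 1(1) 2(1)] 1 2 by (meson add_mono)
qed

section \<open>Frame conditions and loop rules\<close>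

fun nmods :: "com \<Rightarrow> string set" where
  "nmods (NAssign x i a) = {x}"
| "nmods (IndepQuery x i k y a) = {x}"
| "nmods (Seq c1 c2) = nmods c1 \<union> nmods c2"
| "nmods (Cond b c1 c2) = nmods c1 \<union> nmods c2"
| "nmods (While b c) = nmods c"
| "nmods _ = {}"

fun rmods :: "com \<Rightarrow> string set" where
  "rmods (RAssign x i a) = {x}"
| "rmods (ValueQuery x i k y a) = {x}"
| "rmods (Seq c1 c2) = rmods c1 \<union> rmods c2"
| "rmods (Cond b c1 c2) = rmods c1 \<union> rmods c2"
| "rmods (While b c) = rmods c"
| "rmods _ = {}"

text \<open>Which arrays are untouched can be read off from the syntax, so specifications need to
  mention only what a program computes.\<close>

definition agree :: "com \<Rightarrow> state \<Rightarrow> state \<Rightarrow> bool" where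
  "agree c s s' \<longleftrightarrow> (\<forall>x. x \<notin> nmods c \<longrightarrow> nmem s' x = nmem s x) \<and> (\<forall>x. x \<notin> rmods c \<longrightarrow> rmem s' x = rmem s x)"

lemma agree_nmem: "agree c s s' \<Longrightarrow> x \<notin> nmods c \<Longrightarrow> nmem s' x = nmem s x"
  and agree_rmem: "agree c s s' \<Longrightarrow> x \<notin> rmods c \<Longrightarrow> rmem s' x = rmem s x"
  by (auto simp: agree_def)

lemma agree_refl: "agree c s s"
  by (simp add: agree_def)

lemma agree_trans: "agree c s s' \<Longrightarrow> agree c s' s'' \<Longrightarrow> agree c s s''"
  by (simp add: agree_def)

lemma agree_mono: "agree c s s' \<Longrightarrow> nmods c \<subseteq> nmods c' \<Longrightarrow> rmods c \<subseteq> rmods c' \<Longrightarrow> agree c' s s'"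
  by (auto simp: agree_def)

lemma mem_upd [simp]:
  "nmem (nupd s x i a) y j = (if x = y \<and> i = j then a else nmem s y j)"
  "rmem (nupd s x i a) = rmem s"
  "rmem (rupd s x i r) y j = (if x = y \<and> i = j then r else rmem s y j)"
  "nmem (rupd s x i r) = nmem s"
  by (auto simp: nupd_def rupd_def)

lemma nmem_nupd_other: "x \<noteq> y \<Longrightarrow> nmem (nupd s x i a) y = nmem s y"
  by (rule ext) simp

lemma rmem_rupd_other: "x \<noteq> y \<Longrightarrow> rmem (rupd s x i r) y = rmem s y"
  by (rule ext) simp

lemma exec_agree: "exec \<Omega> c s t s' \<Longrightarrow> agree c s s'"
proof (induction rule: exec.induct)
  case (Seq c1 s t1 s1 c2 t2 s2)
  then show ?case by (intro agree_trans[of "Seq c1 c2" s s1 s2]) (auto intro: agree_mono)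
next
  case (WhileTrue b s c t1 s1 t2 s2)
  then show ?case by (intro agree_trans[of "While b c" s s1 s2]) (auto intro: agree_mono)
qed (auto simp: agree_def nmem_nupd_other rmem_rupd_other)

lemma run_frame:
  assumes "run \<Omega> c s T Q"
  shows "run \<Omega> c s T (\<lambda>s'. Q s' \<and> agree c s s')"
  using assms unfolding run_def using exec_agree by blast

text \<open>The index k of the invariant is a decreasing variant and so bounds the number of
  iterations. The body may rely on all arrays that the loop never assigns.\<close>

lemma run_While:
  assumes body: "\<And>k s. Inv k s \<Longrightarrow> bval b s \<Longrightarrow> agree (While b c) s0 s \<Longrightarrow> run \<Omega> c s T (\<lambda>s'. \<exists>k'<k. Inv k' s')"
    and init: "Inv k s0"
  shows "run \<Omega> (While b c) s0 (k * (T + 1) + 1) (\<lambda>s'. \<not> bval b s' \<and> (\<exists>k. Inv k s'))"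
proof -
  have "run \<Omega> (While b c) s (k * (T + 1) + 1) (\<lambda>s'. \<not> bval b s' \<and> (\<exists>k. Inv k s'))"
    if "Inv k s" "agree (While b c) s0 s" for k s
    using that
  proof (induction k arbitrary: s rule: less_induct)
    case (less k)
    show ?case
    proof (cases "bval b s")
      case False
      then show ?thesis unfolding run_def using exec.WhileFalse[OF False] less.prems
        by (intro exI[of _ 1] exI[of _ s]) auto
    next
      case True
      obtain t1 s1 k' where 1: "exec \<Omega> c s t1 s1" "t1 \<le> T" "k' < k" "Inv k' s1"
        using body[OF less.prems(1) True less.prems(2)] unfolding run_def by blast
      have "agree (While b c) s s1" using exec_agree[OF 1(1)] by (rule agree_mono) auto
      then have "agree (While b c) s0 s1" using less.prems(2) agree_trans by blast
      then obtain t2 s2 where 2: "exec \<Omega> (While b c) s1 t2 s2" "t2 \<le> k' * (T + 1) + 1"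
        "\<not> bval b s2" "\<exists>k. Inv k s2"
        using less.IH[OF 1(3,4)] unfolding run_def by blast
      have "t1 + t2 + 1 \<le> Suc k' * (T + 1) + 1" using 1(2) 2(2) by simp
      also have "\<dots> \<le> k * (T + 1) + 1" using 1(3) by (intro add_right_mono mult_right_mono) auto
      finally show ?thesis unfolding run_def using exec.WhileTrue[OF True 1(1) 2(1)] 2 by blast
    qed
  qed
  then show ?thesis using init agree_refl by blast
qed

abbreviation nv :: "string \<Rightarrow> nexp" where "nv x \<equiv> NCell x (NConst 0)"

abbreviation rv :: "string \<Rightarrow> rexp" where "rv x \<equiv> RCell x (NConst 0)"

definition For :: "string \<Rightarrow> nexp \<Rightarrow> com \<Rightarrow> com" where
  "For x b c = Seq (NAssign x (NConst 0) (NConst 0))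
     (While (NLess (nv x) b) (Seq c (NAssign x (NConst 0) (NAdd (nv x) (NConst 1)))))"

lemma For_mods [simp]: "nmods (For x b c) = insert x (nmods c)" "rmods (For x b c) = rmods c"
  by (auto simp: For_def)

text \<open>The invariant is asserted after the counter has been advanced, and the body must leave
  the counter alone. Each iteration pays for the body, the increment and the test.\<close>

lemma run_For:
  assumes body: "\<And>i s. i < N \<Longrightarrow> Inv i s \<Longrightarrow> nmem s x 0 = i \<Longrightarrow> agree (For x b c) s0 s \<Longrightarrow>
        run \<Omega> c s T (\<lambda>s'. nmem s' x 0 = i \<and> Inv (Suc i) (nupd s' x 0 (Suc i)))"
    and bound: "\<And>s. agree (For x b c) s0 s \<Longrightarrow> nval b s = N"
    and init: "Inv 0 (nupd s0 x 0 0)"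
  shows "run \<Omega> (For x b c) s0 (N * (T + 2) + 2) (Inv N)"
proof -
  let ?W = "While (NLess (nv x) b) (Seq c (NAssign x (NConst 0) (NAdd (nv x) (NConst 1))))"
  define Inv' where "Inv' k s \<longleftrightarrow> (\<exists>i\<le>N. k = N - i \<and> Inv i s \<and> nmem s x 0 = i \<and> agree (For x b c) s0 s)" for k s
  have ag0: "agree (For x b c) s0 (nupd s0 x 0 0)" by (auto simp: agree_def nmem_nupd_other)
  have "run \<Omega> ?W (nupd s0 x 0 0) (N * ((T + 1) + 1) + 1)
      (\<lambda>s'. \<not> bval (NLess (nv x) b) s' \<and> (\<exists>k. Inv' k s'))"
  proof (rule run_While)
    show "Inv' N (nupd s0 x 0 0)" unfolding Inv'_def using init ag0 by (intro exI[of _ 0]) auto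
    fix k s assume "Inv' k s" and b: "bval (NLess (nv x) b) s"
    then obtain i where i: "i \<le> N" "k = N - i" "Inv i s" "nmem s x 0 = i" "agree (For x b c) s0 s"
      by (auto simp: Inv'_def)
    then have less: "i < N" using b bound by simp
    have "run \<Omega> c s T (\<lambda>s'. (nmem s' x 0 = i \<and> Inv (Suc i) (nupd s' x 0 (Suc i))) \<and> agree c s s')"
      using run_frame[OF body[OF less i(3,4,5)]] .
    then show "run \<Omega> (Seq c (NAssign x (NConst 0) (NAdd (nv x) (NConst 1)))) s (T + 1) (\<lambda>s'. \<exists>k'<k. Inv' k' s')"
    proof (rule run_Seq)
      fix s1 assume s1: "(nmem s1 x 0 = i \<and> Inv (Suc i) (nupd s1 x 0 (Suc i))) \<and> agree c s s1"
      have "agree (For x b c) s (nupd s1 x 0 (Suc i))"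
        using s1 by (auto simp: agree_def nmem_nupd_other)
      then have "agree (For x b c) s0 (nupd s1 x 0 (Suc i))" using i(5) agree_trans by blast
      then show "run \<Omega> (NAssign x (NConst 0) (NAdd (nv x) (NConst 1))) s1 1 (\<lambda>s'. \<exists>k'<k. Inv' k' s')"
        using s1 less i(2) by (intro run_NAssign exI[of _ "N - Suc i"]) (auto simp: Inv'_def intro!: exI[of _ "Suc i"])
    qed
  qed
  then have W: "run \<Omega> ?W (nupd s0 x 0 0) (N * (T + 2) + 1) (Inv N)"
  proof (rule run_weaken)
    fix s' assume "\<not> bval (NLess (nv x) b) s' \<and> (\<exists>k. Inv' k s')"
    then show "Inv N s'" using bound by (auto simp: Inv'_def)
  qed simp
  have "run \<Omega> (For x b c) s0 (1 + (N * (T + 2) + 1)) (Inv N)"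
    unfolding For_def
  proof (rule run_Seq)
    show "run \<Omega> (NAssign x (NConst 0) (NConst 0)) s0 1 (\<lambda>s. s = nupd s0 x 0 0)"
      by (rule run_NAssign) simp
  qed (use W in simp)
  then show ?thesis by simp
qed

section \<open>Building blocks of the program\<close>

abbreviation "c0 \<equiv> NConst 0"
abbreviation "c1 \<equiv> NConst 1"

definition IndepX :: com where
  "IndepX = Seq (NAssign ''ok'' c0 c1)
     (For ''i'' (nv ''mu'')
       (Seq (IndepQuery ''r'' c0 (nv ''i'') ''X'' c0)
         (Cond (NLess (nv ''r'') c1) (NAssign ''ok'' c0 c0) Skip)))"

definition ValueX :: com where
  "ValueX = Seq (RAssign ''v'' c0 (RConst 0))
     (For ''k'' (nv ''n'')
       (Seq (ValueQuery ''q'' c0 (nv ''k'') ''X'' c0)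
         (Seq (Cond (RLess (rv ''theta'') (rv ''q'')) (RAssign ''q'' c0 (rv ''theta'')) Skip)
           (RAssign ''v'' c0 (RAdd (rv ''v'') (RMul (RCell ''w'' (nv ''k'')) (rv ''q'')))))))"

definition CopySet :: "string \<Rightarrow> nexp \<Rightarrow> string \<Rightarrow> com" where
  "CopySet x a y = For ''e'' (nv ''m'') (NAssign x (NAdd a (nv ''e'')) (NCell y (nv ''e'')))"

definition ClearSet :: "string \<Rightarrow> com" where
  "ClearSet x = For ''e'' (nv ''m'') (NAssign x (nv ''e'') c0)"

text \<open>The language cannot multiply natural numbers, but p is a constant of the program, so the
  product unfolds into p additions.\<close>

fun nmul :: "nat \<Rightarrow> nexp \<Rightarrow> nexp" where
  "nmul 0 a = c0"
| "nmul (Suc p) a = NAdd a (nmul p a)"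

definition swaps :: "nat \<Rightarrow> nexp" where
  "swaps p = NAdd (nmul p (nv ''mu'')) c1"

text \<open>Truncated subtraction from 1 turns 0 into 1 and every nonzero entry into 0, so
  characteristic vectors need not be normalized.\<close>

definition ToggleX :: "nat \<Rightarrow> com" where
  "ToggleX p = For ''i'' (swaps p)
     (Cond (NLess (NCell ''d'' (nv ''i'')) (nv ''m''))
       (NAssign ''X'' (NCell ''d'' (nv ''i'')) (NSub c1 (NCell ''X'' (NCell ''d'' (nv ''i''))))) Skip)"

text \<open>
  The array \<open>d\<close> is an odometer in base \<open>m + 1\<close>, where the digit \<open>m\<close> means that no element is toggled;
  the cell after the last digit becomes nonzero when all combinations have been tried.
\<close>

definition ClearDigits :: "nat \<Rightarrow> com" where
  "ClearDigits p = For ''i'' (NAdd (swaps p) c1) (NAssign ''d'' (nv ''i'') c0)"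

text \<open>The carry passes over all digits that are not below m; if there is no other digit, it
  ends in the overflow cell.\<close>

definition Increment :: "nat \<Rightarrow> com" where
  "Increment p = Seq (NAssign ''i'' c0 c0)
     (Seq (While (Conj (NLess (nv ''i'') (swaps p)) (Neg (NLess (NCell ''d'' (nv ''i'')) (nv ''m''))))
            (Seq (NAssign ''d'' (nv ''i'') c0) (NAssign ''i'' c0 (NAdd (nv ''i'') c1))))
       (NAssign ''d'' (nv ''i'') (NAdd (NCell ''d'' (nv ''i'')) c1)))"

lemma mods [simp]:
  "nmods IndepX = {''ok'', ''i'', ''r''}" "rmods IndepX = {}"
  "nmods ValueX = {''k''}" "rmods ValueX = {''v'', ''q''}"
  "nmods (CopySet x a y) = {''e'', x}" "rmods (CopySet x a y) = {}"
  "nmods (ClearSet x) = {''e'', x}" "rmods (ClearSet x) = {}"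
  "nmods (ToggleX p) = {''i'', ''X''}" "rmods (ToggleX p) = {}"
  "nmods (ClearDigits p) = {''i'', ''d''}" "rmods (ClearDigits p) = {}"
  "nmods (Increment p) = {''i'', ''d''}" "rmods (Increment p) = {}"
  by (auto simp: IndepX_def ValueX_def CopySet_def ClearSet_def ToggleX_def ClearDigits_def Increment_def)

lemma nval_nmul [simp]: "nval (nmul p a) s = p * nval a s"
  by (induction p) auto

lemma decode_upd [simp]:
  "x \<noteq> y \<Longrightarrow> decode es (nupd s y i c) x a = decode es s x a"
  "decode es (rupd s z i r) x a = decode es s x a"
  by (simp_all add: decode_def)

lemma decode_subset: "decode es s x a \<subseteq> set es"
  by (auto simp: decode_def)

section \<open>Enumeration of small symmetric differences\<close>

fun toggle :: "'a list \<Rightarrow> (nat \<Rightarrow> nat) \<Rightarrow> nat \<Rightarrow> 'a set \<Rightarrow> 'a set" where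
  "toggle es d 0 S = S"
| "toggle es d (Suc i) S = (if d i < length es
     then (toggle es d i S - {es ! d i}) \<union> ({es ! d i} - toggle es d i S) else toggle es d i S)"

lemma toggle_cong: "(\<And>i. i < N \<Longrightarrow> d i = d' i) \<Longrightarrow> toggle es d N S = toggle es d' N S"
  by (induction N) auto

lemma toggle_surj:
  assumes "finite A" "A \<subseteq> set es" "card A \<le> N"
  shows "\<exists>d. (\<forall>i. d i \<le> length es) \<and> toggle es d N S = (S - A) \<union> (A - S)"
  using assms
proof (induction N arbitrary: A)
  case 0
  then have "A = {}" by simp
  then show ?case by (intro exI[of _ "\<lambda>_. 0"]) simp
next
  case (Suc N)
  show ?case
  proof (cases "card A \<le> N")
    case True
    then obtain d where d: "\<forall>i. d i \<le> length es" "toggle es d N S = (S - A) \<union> (A - S)"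
      using Suc by blast
    have "toggle es (d(N := length es)) N S = toggle es d N S" by (rule toggle_cong) auto
    moreover have "toggle es (d(N := length es)) (Suc N) S = toggle es (d(N := length es)) N S" by simp
    ultimately have "toggle es (d(N := length es)) (Suc N) S = (S - A) \<union> (A - S)" using d(2) by (simp only:)
    moreover have "\<forall>i. (d(N := length es)) i \<le> length es" using d(1) by simp
    ultimately show ?thesis by blast
  next
    case False
    then have "A \<noteq> {}" by auto
    then obtain x where x: "x \<in> A" by auto
    then obtain j where j: "j < length es" "es ! j = x" using Suc.prems(2) by (meson in_set_conv_nth subsetD)
    have "card (A - {x}) \<le> N" "finite (A - {x})" "A - {x} \<subseteq> set es" using Suc.prems x by auto
    then obtain d where d: "\<forall>i. d i \<le> length es" "toggle es d N S = (S - (A - {x})) \<union> ((A - {x}) - S)"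
      using Suc.IH by blast
    have "toggle es (d(N := j)) N S = toggle es d N S" by (rule toggle_cong) auto
    then have "toggle es (d(N := j)) (Suc N) S = (S - A) \<union> (A - S)" using d(2) j x by auto
    moreover have "\<forall>i. (d(N := j)) i \<le> length es" using d(1) j by simp
    ultimately show ?thesis by blast
  qed
qed

definition digit :: "nat \<Rightarrow> nat \<Rightarrow> nat \<Rightarrow> nat" where
  "digit b c i = (c div b ^ i) mod b"

lemma digits_surj:
  assumes "\<And>i. d i < b"
  shows "\<exists>c < b ^ N. \<forall>i<N. digit b c i = d i"
proof (induction N)
  case 0
  then show ?case by auto
next
  case (Suc N)
  have b: "b > 0" using assms[of 0] by simp
  obtain c where c: "c < b ^ N" "\<forall>i<N. digit b c i = d i" using Suc by auto
  define c' where "c' = c + b ^ N * d N"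
  have "digit b c' i = d i" if i: "i < Suc N" for i
  proof (cases "i = N")
    case True
    then show ?thesis using c(1) assms[of N] b by (simp add: c'_def digit_def)
  next
    case False
    then have "i < N" using i by simp
    then obtain j where j: "N = i + Suc j" using less_imp_add_positive
      by (metis add.commute add_Suc_right gr0_conv_Suc)
    have "c' = c + b ^ i * (b * (b ^ j * d N))" unfolding c'_def j by (simp only: power_add power_Suc mult_ac)
    then have "c' div b ^ i = c div b ^ i + b * (b ^ j * d N)"
      using b div_mult_self2[of "b ^ i" c "b * (b ^ j * d N)"] by simp
    then show ?thesis using c(2) \<open>i < N\<close> by (simp add: digit_def)
  qed
  moreover have "c' < b ^ Suc N"
  proof -
    have "c' < b ^ N + b ^ N * d N" using c by (simp add: c'_def)
    also have "\<dots> = b ^ N * Suc (d N)" by simp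
    also have "\<dots> \<le> b ^ N * b" using assms[of N] by (intro mult_left_mono) auto
    finally show ?thesis by (simp add: mult.commute)
  qed
  ultimately show ?case by blast
qed

lemma digit_carry:
  assumes b: "b > 0" and carry: "\<forall>i<j. digit b c i = b - 1"
  shows "c + 1 = b ^ j * (c div b ^ j + 1)"
  using carry
proof (induction j)
  case (Suc j)
  have IH: "c + 1 = b ^ j * (c div b ^ j + 1)" using Suc by simp
  let ?q = "c div b ^ j"
  have "?q = b * (?q div b) + (b - 1)" using Suc.prems mult_div_mod_eq[of b "c div b ^ j"] by (simp add: digit_def)
  then have "?q + 1 = b * (?q div b + 1)" using b by simp
  moreover have "?q div b = c div b ^ Suc j" by (metis div_mult2_eq mult.commute power_Suc)
  ultimately have "c + 1 = b ^ j * (b * (c div b ^ Suc j + 1))" using IH by simp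
  then show ?case by (simp only: power_Suc mult_ac)
qed simp

lemma digit_of_multiple:
  assumes "i < j" "b > 0"
  shows "digit b (b ^ j * q) i = 0"
proof -
  obtain l where l: "j = i + Suc l" using assms(1) by (metis add_Suc_right less_iff_Suc_add)
  have eq: "b ^ j * q = b ^ i * (b * (b ^ l * q))" unfolding l by (simp only: power_add power_Suc mult_ac)
  show ?thesis unfolding digit_def eq using assms(2) by simp
qed

text \<open>By \<open>digit_carry\<close>, c + 1 is b ^ j times one more than c div b ^ j, and since
  the digit at j is not full, the carry stops there.\<close>

lemma digit_Suc:
  assumes b: "b > 0" and carry: "\<forall>i<j. digit b c i = b - 1" and stop: "digit b c j \<noteq> b - 1"
  shows "i < j \<Longrightarrow> digit b (c + 1) i = 0" and "digit b (c + 1) j = digit b c j + 1"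
    and "i > j \<Longrightarrow> (c + 1) div b ^ i = c div b ^ i"
proof -
  let ?q = "c div b ^ j"
  have eq: "c + 1 = b ^ j * (?q + 1)" using digit_carry[OF b carry] .
  note b0 = b
  show "digit b (c + 1) i = 0" if "i < j" using digit_of_multiple[OF that b0] eq by metis
  have lt: "?q mod b + 1 < b" using stop mod_less_divisor[OF b0, of ?q] by (simp add: digit_def)
  have q1: "(c + 1) div b ^ j = ?q + 1"
    using eq b0 nonzero_mult_div_cancel_left[of "b ^ j" "?q + 1"] by simp
  have qm: "(?q + 1) mod b = ?q mod b + 1" using lt by (simp add: mod_Suc)
  show "digit b (c + 1) j = digit b c j + 1" unfolding digit_def q1 by (rule qm)
  have "(?q + 1) div b = ?q div b"
    using qm by (simp add: div_Suc)
  then have step: "(c + 1) div b ^ Suc j = c div b ^ Suc j"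
    unfolding q1 [symmetric]
    by (subst (1 2) power_Suc2) (subst (1 2) div_mult2_eq, assumption)
  show "(c + 1) div b ^ i = c div b ^ i" if ij: "i > j"
  proof -
    obtain l where "i = Suc j + l" using less_imp_Suc_add[OF ij] by auto
    then have "b ^ i = b ^ Suc j * b ^ l" by (simp add: power_add)
    then show ?thesis
      using step div_mult2_eq[of "c + 1" "b ^ Suc j" "b ^ l"] div_mult2_eq[of c "b ^ Suc j" "b ^ l"] by argo
  qed
qed

section \<open>Correctness of the building blocks\<close>

locale robust_program = robust_problem E n f Ind \<mu>
  for E :: "'a set" and n f Ind \<mu> +
  fixes es :: "'a list"
  assumes distinct_es: "distinct es" and set_es: "set es = E"
begin

abbreviation \<Omega> :: "'a oracles" where
  "\<Omega> \<equiv> \<lparr>elements = es, value_oracle = f, indep_oracle = Ind\<rparr>"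

abbreviation "m \<equiv> length es"

abbreviation "dec s x \<equiv> decode es s x 0"

lemma card_E: "card E = m"
  using distinct_card[OF distinct_es] set_es by simp

definition input :: "state \<Rightarrow> bool" where
  "input s \<longleftrightarrow> nmem s ''m'' 0 = m \<and> nmem s ''n'' 0 = n \<and> nmem s ''mu'' 0 = \<mu>"

lemma input_agree:
  "agree c s s' \<Longrightarrow> input s \<Longrightarrow> ''m'' \<notin> nmods c \<Longrightarrow> ''n'' \<notin> nmods c \<Longrightarrow> ''mu'' \<notin> nmods c \<Longrightarrow> input s'"
  by (simp add: input_def agree_def)

lemma decode_agree: "agree c s s' \<Longrightarrow> x \<notin> nmods c \<Longrightarrow> decode es s' x a = decode es s x a"
  by (simp add: agree_def decode_def)

lemma mem_decode: "j < m \<Longrightarrow> es ! j \<in> decode es s x a \<longleftrightarrow> nmem s x (a + j) \<noteq> 0"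
  using distinct_es by (auto simp: decode_def nth_eq_iff_index_eq)

lemma decode_eqI:
  assumes "A \<subseteq> E" "\<And>j. j < m \<Longrightarrow> nmem s x (a + j) \<noteq> 0 \<longleftrightarrow> es ! j \<in> A"
  shows "decode es s x a = A"
proof (rule set_eqI)
  fix y
  show "y \<in> decode es s x a \<longleftrightarrow> y \<in> A"
  proof (cases "y \<in> set es")
    case True
    then obtain j where "j < m" "es ! j = y" by (auto simp: in_set_conv_nth)
    then show ?thesis using mem_decode[of j s x a] assms(2)[of j] by auto
  next
    case False
    then show ?thesis using decode_subset[of es s x a] assms(1) set_es by auto
  qed
qed

lemma run_IndepX:
  assumes "input s"
  shows "run \<Omega> IndepX s (\<mu> * 5 + 3) (\<lambda>s'. nmem s' ''ok'' 0 = (if dec s ''X'' \<in> \<I> then 1 else 0))"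
proof -
  let ?s = "nupd s ''ok'' 0 1"
  define Inv where "Inv i s' \<longleftrightarrow> nmem s' ''ok'' 0 = (if \<forall>j<i. dec s ''X'' \<in> Ind j then 1 else 0)" for i and s' :: state
  let ?body = "Seq (IndepQuery ''r'' c0 (nv ''i'') ''X'' c0)
         (Cond (NLess (nv ''r'') c1) (NAssign ''ok'' c0 c0) Skip)"
  have "run \<Omega> (For ''i'' (nv ''mu'') ?body) ?s (\<mu> * (3 + 2) + 2) (Inv \<mu>)"
  proof (rule run_For)
    show "Inv 0 (nupd ?s ''i'' 0 0)" by (simp add: Inv_def)
    fix s' assume ag: "agree (For ''i'' (nv ''mu'') ?body) ?s s'"
    show "nval (nv ''mu'') s' = \<mu>" using agree_nmem[OF ag, of "''mu''"] assms by (simp add: input_def)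
    fix i assume "i < \<mu>" "Inv i s'" "nmem s' ''i'' 0 = i"
    moreover have "dec s' ''X'' = dec s ''X''" using decode_agree[OF ag, of "''X''"] by simp
    ultimately show "run \<Omega> ?body s' 3 (\<lambda>s''. nmem s'' ''i'' 0 = i \<and> Inv (Suc i) (nupd s'' ''i'' 0 (Suc i)))"
      by (auto simp: run_simps Inv_def less_Suc_eq)
  qed
  moreover have "(\<forall>j<\<mu>. dec s ''X'' \<in> Ind j) \<longleftrightarrow> dec s ''X'' \<in> \<I>" by (auto simp: matroid_intersection_def)
  ultimately show ?thesis
    unfolding IndepX_def by (auto simp: run_simps Inv_def elim!: run_weaken)
qed

lemma run_ValueX:
  assumes "input s"
  shows "run \<Omega> ValueX s (n * 6 + 3) (\<lambda>s'. rmem s' ''v'' 0 = trunc (rmem s ''theta'' 0) (rmem s ''w'') (dec s ''X''))"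
proof -
  let ?s = "rupd s ''v'' 0 0"
  define Inv where "Inv i s' \<longleftrightarrow> rmem s' ''v'' 0 = (\<Sum>k<i. rmem s ''w'' k * min (f k (dec s ''X'')) (rmem s ''theta'' 0))"
    for i and s' :: state
  let ?body = "Seq (ValueQuery ''q'' c0 (nv ''k'') ''X'' c0)
         (Seq (Cond (RLess (rv ''theta'') (rv ''q'')) (RAssign ''q'' c0 (rv ''theta'')) Skip)
           (RAssign ''v'' c0 (RAdd (rv ''v'') (RMul (RCell ''w'' (nv ''k'')) (rv ''q'')))))"
  have "run \<Omega> (For ''k'' (nv ''n'') ?body) ?s (n * (4 + 2) + 2) (Inv n)"
  proof (rule run_For)
    show "Inv 0 (nupd ?s ''k'' 0 0)" by (simp add: Inv_def)
    fix s' assume ag: "agree (For ''k'' (nv ''n'') ?body) ?s s'"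
    show "nval (nv ''n'') s' = n" using agree_nmem[OF ag, of "''n''"] assms by (simp add: input_def)
    fix i assume "i < n" "Inv i s'" "nmem s' ''k'' 0 = i"
    moreover have "dec s' ''X'' = dec s ''X''" using decode_agree[OF ag, of "''X''"] by simp
    moreover have "rmem s' ''theta'' = rmem s ''theta''" "rmem s' ''w'' = rmem s ''w''"
      using agree_rmem[OF ag] by (simp_all add: rmem_rupd_other)
    ultimately show "run \<Omega> ?body s' 4 (\<lambda>s''. nmem s'' ''k'' 0 = i \<and> Inv (Suc i) (nupd s'' ''k'' 0 (Suc i)))"
      by (auto simp: run_simps Inv_def)
  qed
  then show ?thesis
    unfolding ValueX_def by (auto simp: run_simps Inv_def trunc_def elim!: run_weaken)
qed

text \<open>The address expression is evaluated anew in every iteration, hence the condition that it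
  has the same value in all states the loop can reach.\<close>

lemma run_CopySet:
  assumes "input s" and x: "x \<noteq> y" "x \<noteq> ''e''" "x \<noteq> ''m''" "y \<noteq> ''e''"
    and a: "\<And>s'. agree (CopySet x a y) s s' \<Longrightarrow> nval a s' = b"
  shows "run \<Omega> (CopySet x a y) s (m * 3 + 2)
    (\<lambda>s'. \<forall>j. nmem s' x j = (if b \<le> j \<and> j < b + m then nmem s y (j - b) else nmem s x j))"
proof -
  define Inv where "Inv i s' \<longleftrightarrow> (\<forall>j. nmem s' x j = (if b \<le> j \<and> j < b + i then nmem s y (j - b) else nmem s x j))"
    for i and s' :: state
  let ?body = "NAssign x (NAdd a (nv ''e'')) (NCell y (nv ''e''))"
  have "run \<Omega> (For ''e'' (nv ''m'') ?body) s (m * (1 + 2) + 2) (Inv m)"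
  proof (rule run_For)
    show "Inv 0 (nupd s ''e'' 0 0)" using x by (simp add: Inv_def)
    fix s' assume ag: "agree (For ''e'' (nv ''m'') ?body) s s'"
    show "nval (nv ''m'') s' = m" using agree_nmem[OF ag, of "''m''"] assms by (simp add: input_def)
    fix i assume "i < m" "Inv i s'" "nmem s' ''e'' 0 = i"
    moreover have "nval a s' = b" using a ag by (simp add: CopySet_def)
    moreover have "nmem s' y = nmem s y" using agree_nmem[OF ag] x by simp
    ultimately show "run \<Omega> ?body s' 1 (\<lambda>s''. nmem s'' ''e'' 0 = i \<and> Inv (Suc i) (nupd s'' ''e'' 0 (Suc i)))"
      using x by (auto simp: run_simps Inv_def)
  qed
  then show ?thesis unfolding CopySet_def Inv_def by (rule run_weaken) auto
qed

lemma run_CopySet_dec: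
  assumes "input s" and x: "x \<noteq> y" "x \<noteq> ''e''" "x \<noteq> ''m''" "y \<noteq> ''e''"
  shows "run \<Omega> (CopySet x c0 y) s (m * 3 + 2) (\<lambda>s'. dec s' x = dec s y)"
proof (rule run_weaken[OF run_CopySet[where b = 0, OF assms]])
  fix s' :: state assume "\<forall>j. nmem s' x j = (if 0 \<le> j \<and> j < 0 + m then nmem s y (j - 0) else nmem s x j)"
  then show "dec s' x = dec s y" unfolding decode_def by auto
qed simp_all

lemma run_ClearSet:
  assumes "input s" and x: "x \<noteq> ''e''" "x \<noteq> ''m''"
  shows "run \<Omega> (ClearSet x) s (m * 3 + 2) (\<lambda>s'. dec s' x = {})"
proof -
  define Inv where "Inv i s' \<longleftrightarrow> (\<forall>j<i. nmem s' x j = 0)" for i and s' :: state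
  let ?body = "NAssign x (nv ''e'') c0"
  have "run \<Omega> (For ''e'' (nv ''m'') ?body) s (m * (1 + 2) + 2) (Inv m)"
  proof (rule run_For)
    show "Inv 0 (nupd s ''e'' 0 0)" using x by (simp add: Inv_def)
    fix s' assume ag: "agree (For ''e'' (nv ''m'') ?body) s s'"
    show "nval (nv ''m'') s' = m" using agree_nmem[OF ag, of "''m''"] assms by (simp add: input_def)
    fix i assume "i < m" "Inv i s'" "nmem s' ''e'' 0 = i"
    then show "run \<Omega> ?body s' 1 (\<lambda>s''. nmem s'' ''e'' 0 = i \<and> Inv (Suc i) (nupd s'' ''e'' 0 (Suc i)))"
      using x by (auto simp: run_simps Inv_def less_Suc_eq)
  qed
  then show ?thesis
    unfolding ClearSet_def by (rule run_weaken) (auto simp: Inv_def decode_def)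
qed

lemma run_ToggleX:
  assumes "input s"
  shows "run \<Omega> (ToggleX p) s ((p * \<mu> + 1) * 4 + 2) (\<lambda>s'. dec s' ''X'' = toggle es (nmem s ''d'') (p * \<mu> + 1) (dec s ''X''))"
proof -
  define Inv where "Inv i s' \<longleftrightarrow> dec s' ''X'' = toggle es (nmem s ''d'') i (dec s ''X'')" for i and s' :: state
  let ?body = "Cond (NLess (NCell ''d'' (nv ''i'')) (nv ''m''))
       (NAssign ''X'' (NCell ''d'' (nv ''i'')) (NSub c1 (NCell ''X'' (NCell ''d'' (nv ''i''))))) Skip"
  have "run \<Omega> (For ''i'' (swaps p) ?body) s ((p * \<mu> + 1) * (2 + 2) + 2) (Inv (p * \<mu> + 1))"
  proof (rule run_For)
    show "Inv 0 (nupd s ''i'' 0 0)" by (simp add: Inv_def)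
    fix s' assume ag: "agree (For ''i'' (swaps p) ?body) s s'"
    have inp: "input s'" using input_agree[OF ag assms] by simp
    then show "nval (swaps p) s' = p * \<mu> + 1" by (simp add: input_def swaps_def)
    fix i assume i: "Inv i s'" "nmem s' ''i'' 0 = i"
    have d: "nmem s' ''d'' = nmem s ''d''" using agree_nmem[OF ag] by simp
    show "run \<Omega> ?body s' 2 (\<lambda>s''. nmem s'' ''i'' 0 = i \<and> Inv (Suc i) (nupd s'' ''i'' 0 (Suc i)))"
    proof (cases "nmem s ''d'' i < m")
      case False
      then show ?thesis using i inp d by (simp add: run_simps Inv_def input_def)
    next
      case True
      let ?j = "nmem s ''d'' i" and ?T = "toggle es (nmem s ''d'') i (dec s ''X'')"
      let ?s' = "nupd s' ''X'' ?j (1 - nmem s' ''X'' ?j)"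
      have T: "?T = dec s' ''X''" using i(1) by (simp add: Inv_def)
      have "dec ?s' ''X'' = (?T - {es ! ?j}) \<union> ({es ! ?j} - ?T)"
      proof (rule decode_eqI)
        show "(?T - {es ! ?j}) \<union> ({es ! ?j} - ?T) \<subseteq> E"
          using decode_subset[of es s' "''X''" 0] True set_es unfolding T by auto
        fix j assume "j < m"
        then show "nmem ?s' ''X'' (0 + j) \<noteq> 0 \<longleftrightarrow> es ! j \<in> (?T - {es ! ?j}) \<union> ({es ! ?j} - ?T)"
          using mem_decode[of j s' "''X''" 0] True distinct_es unfolding T
          by (auto simp: nth_eq_iff_index_eq)
      qed
      then show ?thesis using True i inp d by (simp add: run_simps Inv_def input_def)
    qed
  qed
  then show ?thesis unfolding ToggleX_def Inv_def by (rule run_weaken) auto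
qed

text \<open>Cell N holds the overflow, which is zero exactly as long as c is below (m + 1) ^ N; this
  serves as the loop test of the search.\<close>

definition digits :: "nat \<Rightarrow> nat \<Rightarrow> state \<Rightarrow> bool" where
  "digits N c s \<longleftrightarrow> (\<forall>i<N. nmem s ''d'' i = digit (m + 1) c i) \<and> nmem s ''d'' N = c div (m + 1) ^ N"

lemma run_ClearDigits:
  assumes "input s"
  shows "run \<Omega> (ClearDigits p) s ((p * \<mu> + 2) * 3 + 2) (digits (p * \<mu> + 1) 0)"
proof -
  define Inv where "Inv i s' \<longleftrightarrow> (\<forall>j<i. nmem s' ''d'' j = 0)" for i and s' :: state
  let ?body = "NAssign ''d'' (nv ''i'') c0"
  have "run \<Omega> (For ''i'' (NAdd (swaps p) c1) ?body) s ((p * \<mu> + 2) * (1 + 2) + 2) (Inv (p * \<mu> + 2))"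
  proof (rule run_For)
    show "Inv 0 (nupd s ''i'' 0 0)" by (simp add: Inv_def)
    fix s' assume ag: "agree (For ''i'' (NAdd (swaps p) c1) ?body) s s'"
    have "input s'" using input_agree[OF ag assms] by simp
    then show "nval (NAdd (swaps p) c1) s' = p * \<mu> + 2" by (simp add: input_def swaps_def)
    fix i assume "Inv i s'" "nmem s' ''i'' 0 = i"
    then show "run \<Omega> ?body s' 1 (\<lambda>s''. nmem s'' ''i'' 0 = i \<and> Inv (Suc i) (nupd s'' ''i'' 0 (Suc i)))"
      by (auto simp: run_simps Inv_def less_Suc_eq)
  qed
  then show ?thesis
    unfolding ClearDigits_def by (rule run_weaken) (auto simp: Inv_def digits_def digit_def)
qed

lemma run_Increment:
  assumes inp: "input s" and dig: "digits (p * \<mu> + 1) c s"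
  shows "run \<Omega> (Increment p) s ((p * \<mu> + 1) * 3 + 3) (digits (p * \<mu> + 1) (c + 1))"
proof -
  define N where "N = p * \<mu> + 1"
  let ?s = "nupd s ''i'' 0 0"
  let ?b = "Conj (NLess (nv ''i'') (swaps p)) (Neg (NLess (NCell ''d'' (nv ''i'')) (nv ''m'')))"
  let ?c = "Seq (NAssign ''d'' (nv ''i'') c0) (NAssign ''i'' c0 (NAdd (nv ''i'') c1))"
  define Inv where "Inv k s' \<longleftrightarrow> (\<exists>j\<le>N. k = N - j \<and> input s' \<and> nmem s' ''i'' 0 = j \<and>
      (\<forall>i<j. digit (m + 1) c i = m) \<and>
      (\<forall>i\<le>N. nmem s' ''d'' i = (if i < j then 0 else nmem s ''d'' i)))" for k and s' :: state
  have W: "run \<Omega> (While ?b ?c) ?s (N * (2 + 1) + 1) (\<lambda>s'. \<not> bval ?b s' \<and> (\<exists>k. Inv k s'))"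
  proof (rule run_While)
    show "Inv N ?s" unfolding Inv_def using inp by (intro exI[of _ 0]) (auto simp: input_def)
    fix k s' assume "Inv k s'" and b: "bval ?b s'"
    then obtain j where j: "j \<le> N" "k = N - j" "input s'" "nmem s' ''i'' 0 = j"
      "\<forall>i<j. digit (m + 1) c i = m" "\<forall>i\<le>N. nmem s' ''d'' i = (if i < j then 0 else nmem s ''d'' i)"
      unfolding Inv_def by blast
    have jN: "j < N" using b j by (simp add: input_def swaps_def N_def)
    have "nmem s' ''d'' j = digit (m + 1) c j" using j(6) jN dig by (simp add: digits_def N_def)
    moreover have "\<not> nmem s' ''d'' j < m" using b j by (simp add: input_def)
    moreover have "digit (m + 1) c j < m + 1" by (simp add: digit_def)
    ultimately have dj: "digit (m + 1) c j = m" by simp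
    have "Inv (N - Suc j) (nupd (nupd s' ''d'' j 0) ''i'' 0 (Suc j))"
      unfolding Inv_def using j jN dj
      by (intro exI[of _ "Suc j"]) (auto simp: input_def less_Suc_eq)
    moreover have "N - Suc j < k" using j jN by simp
    ultimately show "run \<Omega> ?c s' 2 (\<lambda>s''. \<exists>k'<k. Inv k' s'')" using j by (auto simp: run_simps)
  qed
  have post: "digits N (c + 1) (nupd s' ''d'' (nmem s' ''i'' 0) (nmem s' ''d'' (nmem s' ''i'' 0) + 1))"
    if nb: "\<not> bval ?b s'" and invk: "Inv k s'" for k s'
  proof -
    obtain j where j: "j \<le> N" "input s'" "nmem s' ''i'' 0 = j"
      "\<forall>i<j. digit (m + 1) c i = m" "\<forall>i\<le>N. nmem s' ''d'' i = (if i < j then 0 else nmem s ''d'' i)"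
      using invk unfolding Inv_def by blast
    have b: "m + 1 > 0" by simp
    have carry: "\<forall>i<j. digit (m + 1) c i = m + 1 - 1" using j(4) by simp
    show ?thesis
    proof (cases "j = N")
      case True
      have eq: "c + 1 = (m + 1) ^ N * (c div (m + 1) ^ N + 1)"
        using digit_carry[OF b carry] True by simp
      have "digit (m + 1) (c + 1) i = 0" if "i < N" for i
        using digit_of_multiple[OF that, of "m + 1"] eq by (metis add_gr_0 zero_less_one)
      moreover have "(c + 1) div (m + 1) ^ N = c div (m + 1) ^ N + 1"
        using eq nonzero_mult_div_cancel_left[of "(m + 1) ^ N" "c div (m + 1) ^ N + 1"] by simp
      ultimately show ?thesis
        using True j dig unfolding digits_def N_def [symmetric] by auto
    next
      case False
      then have jN: "j < N" using j by simp
      have dj: "nmem s' ''d'' j = digit (m + 1) c j" using j(5) jN dig by (simp add: digits_def N_def)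
      then have stop: "digit (m + 1) c j \<noteq> m + 1 - 1" using nb jN j by (simp add: input_def swaps_def N_def)
      note D = digit_Suc[OF b carry stop]
      show ?thesis
        unfolding digits_def
      proof (intro conjI allI impI)
        fix i assume i: "i < N"
        consider "i < j" | "i = j" | "i > j" by linarith
        then show "nmem (nupd s' ''d'' (nmem s' ''i'' 0) (nmem s' ''d'' (nmem s' ''i'' 0) + 1)) ''d'' i = digit (m + 1) (c + 1) i"
        proof cases
          case 1
          then show ?thesis using j i D(1) by simp
        next
          case 2
          then show ?thesis using j i D(2) dj by simp
        next
          case 3
          then show ?thesis using j i D(3)[OF 3] dig by (simp add: digits_def digit_def N_def)
        qed
      next
        show "nmem (nupd s' ''d'' (nmem s' ''i'' 0) (nmem s' ''d'' (nmem s' ''i'' 0) + 1)) ''d'' N = (c + 1) div (m + 1) ^ N"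
          using j jN D(3)[OF jN] dig by (simp add: digits_def N_def)
      qed
    qed
  qed
  have "run \<Omega> (Seq (While ?b ?c) (NAssign ''d'' (nv ''i'') (NAdd (NCell ''d'' (nv ''i'')) c1))) ?s ((N * (2 + 1) + 1) + 1) (digits N (c + 1))"
    by (rule run_Seq[OF W]) (use post in \<open>auto simp: run_simps\<close>)
  then show ?thesis
    unfolding Increment_def N_def by (auto simp: run_simps elim!: run_weaken)
qed

end

section \<open>Local search\<close>

definition scale :: "nat \<Rightarrow> rexp" where
  "scale r = RMul (RConst (of_nat (20 * r))) (RAdd (RNat (nv ''mu'')) (RConst 1))"

definition Candidate :: "nat \<Rightarrow> com" where
  "Candidate p = Seq (CopySet ''X'' c0 ''S'') (Seq (ToggleX p) (Seq IndepX ValueX))"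

definition Accept :: "nat \<Rightarrow> com" where
  "Accept p = Seq (CopySet ''S'' c0 ''X'') (Seq (RAssign ''cur'' c0 (rv ''v'')) (ClearDigits p))"

text \<open>An accepted exchange restarts the enumeration, so a complete pass without acceptance
  certifies that the current set is an approximate local optimum.\<close>

definition SearchStep :: "nat \<Rightarrow> com" where
  "SearchStep p = Seq (Candidate p)
     (Cond (Conj (NLess c0 (nv ''ok'')) (RLess (RAdd (rv ''cur'') (rv ''kap'')) (rv ''v'')))
       (Accept p) (Increment p))"

definition SumW :: com where
  "SumW = Seq (RAssign ''W'' c0 (RConst 0))
     (For ''k'' (nv ''n'') (RAssign ''W'' c0 (RAdd (rv ''W'') (RCell ''w'' (nv ''k'')))))"

definition InitSearch :: "nat \<Rightarrow> nat \<Rightarrow> com" where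
  "InitSearch p r = Seq (ClearSet ''S'') (Seq (ClearDigits p) (Seq SumW (Seq (RAssign ''cur'' c0 (RConst 0))
     (RAssign ''kap'' c0 (RDiv (RMul (rv ''W'') (rv ''beta''))
        (RMul (RMul (scale r) (RNat (nv ''n''))) (RNat (nv ''m''))))))))"

definition LocalSearch :: "nat \<Rightarrow> nat \<Rightarrow> com" where
  "LocalSearch p r = Seq (InitSearch p r) (While (NLess (NCell ''d'' (swaps p)) c1) (SearchStep p))"

definition Singletons :: com where
  "Singletons = For ''e'' (nv ''m'')
     (Seq (NAssign ''X'' (nv ''e'') c1) (Seq IndepX (Seq (ValueQuery ''q'' c0 (nv ''k'') ''X'' c0)
       (Seq (Cond (Conj (NLess c0 (nv ''ok'')) (RLess (rv ''mx'') (rv ''q''))) (RAssign ''mx'' c0 (rv ''q'')) Skip)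
         (NAssign ''X'' (nv ''e'') c0)))))"

text \<open>For lack of a disjunction the test is negated twice: k is 0 or \<open>mx\<close> is
  below \<open>beta\<close>. The first index always stores its value, since the initial 0 would
  otherwise pass for the minimum.\<close>

definition Bottleneck :: com where
  "Bottleneck = For ''k'' (nv ''n'')
     (Seq (RAssign ''mx'' c0 (RConst 0)) (Seq Singletons
       (Cond (Neg (Conj (Neg (NLess (nv ''k'') c1)) (Neg (RLess (rv ''mx'') (rv ''beta'')))))
         (RAssign ''beta'' c0 (rv ''mx'')) Skip)))"

lemma mods_search [simp]:
  "nmods (Candidate p) = {''e'', ''X'', ''i'', ''ok'', ''r'', ''k''}" "rmods (Candidate p) = {''v'', ''q''}"
  "nmods (Accept p) = {''e'', ''S'', ''i'', ''d''}" "rmods (Accept p) = {''cur''}"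
  "nmods (SearchStep p) = {''e'', ''X'', ''i'', ''ok'', ''r'', ''k'', ''S'', ''d''}"
  "rmods (SearchStep p) = {''v'', ''q'', ''cur''}"
  "nmods SumW = {''k''}" "rmods SumW = {''W''}"
  "nmods (InitSearch p r) = {''e'', ''S'', ''i'', ''d'', ''k''}" "rmods (InitSearch p r) = {''W'', ''cur'', ''kap''}"
  "nmods (LocalSearch p r) = {''e'', ''X'', ''i'', ''ok'', ''r'', ''k'', ''S'', ''d''}"
  "rmods (LocalSearch p r) = {''v'', ''q'', ''cur'', ''W'', ''kap''}"
  "nmods Singletons = {''e'', ''X'', ''ok'', ''i'', ''r''}" "rmods Singletons = {''q'', ''mx''}"
  "nmods Bottleneck = {''e'', ''X'', ''ok'', ''i'', ''r'', ''k''}" "rmods Bottleneck = {''q'', ''mx'', ''beta''}"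
  by (auto simp: Candidate_def Accept_def SearchStep_def SumW_def InitSearch_def LocalSearch_def
      Singletons_def Bottleneck_def)

text \<open>Of the two branches \<open>Accept\<close> is the more expensive one. All time bounds are
  defined outside the locale, so that they can later be estimated as functions of n and m.\<close>

definition step_cost :: "nat \<Rightarrow> nat \<Rightarrow> nat \<Rightarrow> nat \<Rightarrow> nat" where
  "step_cost \<mu> n m p = (m * 3 + 2 + ((p * \<mu> + 1) * 4 + 2 + (\<mu> * 5 + 3 + (n * 6 + 3)))) +
     (m * 3 + 2 + (1 + ((p * \<mu> + 2) * 3 + 2)) + 1)"

text \<open>
  The step size and all relative errors are \<open>1 / scale_val \<mu> r\<close>.  They shrink the guarantee by a factor
  of at least \<open>1 - 5 / scale_val \<mu> r\<close>, which is paid for by passing from \<open>\<mu> + 1 / (2 r)\<close> to \<open>\<mu> + 1 / r\<close>.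
\<close>

definition scale_val :: "nat \<Rightarrow> nat \<Rightarrow> nat" where
  "scale_val \<mu> r = 20 * r * (\<mu> + 1)"

section \<open>Correctness of the search and of the bottleneck value\<close>

context robust_program
begin

lemma input_upd [simp]:
  "x \<notin> {''m'', ''n'', ''mu''} \<Longrightarrow> input (nupd s x i a) = input s"
  "input (rupd s z i b) = input s"
  by (auto simp: input_def)

lemma run_Candidate:
  assumes inp: "input s"
  shows "run \<Omega> (Candidate p) s (m * 3 + 2 + ((p * \<mu> + 1) * 4 + 2 + (\<mu> * 5 + 3 + (n * 6 + 3))))
    (\<lambda>s'. dec s' ''X'' = toggle es (nmem s ''d'') (p * \<mu> + 1) (dec s ''S'') \<and>
      nmem s' ''ok'' 0 = (if dec s' ''X'' \<in> \<I> then 1 else 0) \<and>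
      rmem s' ''v'' 0 = trunc (rmem s ''theta'' 0) (rmem s ''w'') (dec s' ''X''))"
  unfolding Candidate_def
proof (rule run_Seq[OF run_frame[OF run_CopySet_dec]])
  fix s1 assume s1: "dec s1 ''X'' = dec s ''S'' \<and> agree (CopySet ''X'' c0 ''S'') s s1"
  then have inp1: "input s1" using input_agree inp by fastforce
  have d1: "nmem s1 ''d'' = nmem s ''d''" using s1 by (auto simp: agree_def)
  have r1: "rmem s1 = rmem s" using s1 by (auto simp: agree_def)
  show "run \<Omega> (Seq (ToggleX p) (Seq IndepX ValueX)) s1 ((p * \<mu> + 1) * 4 + 2 + (\<mu> * 5 + 3 + (n * 6 + 3)))
    (\<lambda>s'. dec s' ''X'' = toggle es (nmem s ''d'') (p * \<mu> + 1) (dec s ''S'') \<and>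
      nmem s' ''ok'' 0 = (if dec s' ''X'' \<in> \<I> then 1 else 0) \<and>
      rmem s' ''v'' 0 = trunc (rmem s ''theta'' 0) (rmem s ''w'') (dec s' ''X''))"
  proof (rule run_Seq[OF run_frame[OF run_ToggleX[OF inp1]]])
    fix s2 assume s2: "dec s2 ''X'' = toggle es (nmem s1 ''d'') (p * \<mu> + 1) (dec s1 ''X'') \<and> agree (ToggleX p) s1 s2"
    then have inp2: "input s2" using input_agree inp1 by fastforce
    have r2: "rmem s2 = rmem s" using s2 r1 by (auto simp: agree_def)
    show "run \<Omega> (Seq IndepX ValueX) s2 (\<mu> * 5 + 3 + (n * 6 + 3))
      (\<lambda>s'. dec s' ''X'' = toggle es (nmem s ''d'') (p * \<mu> + 1) (dec s ''S'') \<and>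
        nmem s' ''ok'' 0 = (if dec s' ''X'' \<in> \<I> then 1 else 0) \<and>
        rmem s' ''v'' 0 = trunc (rmem s ''theta'' 0) (rmem s ''w'') (dec s' ''X''))"
    proof (rule run_Seq[OF run_frame[OF run_IndepX[OF inp2]]])
      fix s3 assume s3: "nmem s3 ''ok'' 0 = (if dec s2 ''X'' \<in> \<I> then 1 else 0) \<and> agree IndepX s2 s3"
      then have inp3: "input s3" using input_agree inp2 by fastforce
      have r3: "rmem s3 = rmem s" using s3 r2 by (auto simp: agree_def)
      have x3: "dec s3 ''X'' = dec s2 ''X''" using s3 decode_agree[of IndepX s2 s3 "''X''"] by simp
      show "run \<Omega> ValueX s3 (n * 6 + 3)
        (\<lambda>s'. dec s' ''X'' = toggle es (nmem s ''d'') (p * \<mu> + 1) (dec s ''S'') \<and>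
          nmem s' ''ok'' 0 = (if dec s' ''X'' \<in> \<I> then 1 else 0) \<and>
          rmem s' ''v'' 0 = trunc (rmem s ''theta'' 0) (rmem s ''w'') (dec s' ''X''))"
      proof (rule run_weaken[OF run_frame[OF run_ValueX[OF inp3]]])
        fix s4 assume s4: "rmem s4 ''v'' 0 = trunc (rmem s3 ''theta'' 0) (rmem s3 ''w'') (dec s3 ''X'') \<and> agree ValueX s3 s4"
        then have "dec s4 ''X'' = dec s3 ''X''" "nmem s4 ''ok'' = nmem s3 ''ok''"
          using decode_agree[of ValueX s3 s4 "''X''"] agree_nmem[of ValueX s3 s4 "''ok''"] by simp_all
        then show "dec s4 ''X'' = toggle es (nmem s ''d'') (p * \<mu> + 1) (dec s ''S'') \<and>
          nmem s4 ''ok'' 0 = (if dec s4 ''X'' \<in> \<I> then 1 else 0) \<and>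
          rmem s4 ''v'' 0 = trunc (rmem s ''theta'' 0) (rmem s ''w'') (dec s4 ''X'')"
          using s1 s2 s3 s4 x3 r3 d1 by simp
      qed simp
    qed
  qed
qed (use inp in simp_all)

lemma run_Accept:
  assumes inp: "input s"
  shows "run \<Omega> (Accept p) s (m * 3 + 2 + (1 + ((p * \<mu> + 2) * 3 + 2)))
    (\<lambda>s'. dec s' ''S'' = dec s ''X'' \<and> rmem s' ''cur'' 0 = rmem s ''v'' 0 \<and> digits (p * \<mu> + 1) 0 s')"
  unfolding Accept_def
proof (rule run_Seq[OF run_frame[OF run_CopySet_dec]])
  fix s1 assume s1: "dec s1 ''S'' = dec s ''X'' \<and> agree (CopySet ''S'' c0 ''X'') s s1"
  then have inp1: "input s1" using input_agree inp by fastforce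
  let ?s2 = "rupd s1 ''cur'' 0 (rmem s1 ''v'' 0)"
  have "rmem s1 = rmem s" using s1 by (auto simp: agree_def)
  moreover have "run \<Omega> (ClearDigits p) ?s2 ((p * \<mu> + 2) * 3 + 2)
      (\<lambda>s'. digits (p * \<mu> + 1) 0 s' \<and> agree (ClearDigits p) ?s2 s')"
    using run_frame[OF run_ClearDigits] inp1 by simp
  then have "run \<Omega> (ClearDigits p) ?s2 ((p * \<mu> + 2) * 3 + 2)
      (\<lambda>s'. dec s' ''S'' = dec s1 ''S'' \<and> rmem s' ''cur'' 0 = rmem s1 ''v'' 0 \<and> digits (p * \<mu> + 1) 0 s')"
  proof (rule run_weaken)
    fix s' assume s': "digits (p * \<mu> + 1) 0 s' \<and> agree (ClearDigits p) ?s2 s'"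
    then have "dec s' ''S'' = dec ?s2 ''S''" "rmem s' = rmem ?s2"
      using decode_agree[of "ClearDigits p" ?s2 s' "''S''"] by (auto simp: agree_def)
    then show "dec s' ''S'' = dec s1 ''S'' \<and> rmem s' ''cur'' 0 = rmem s1 ''v'' 0 \<and> digits (p * \<mu> + 1) 0 s'"
      using s' by simp
  qed simp
  ultimately show "run \<Omega> (Seq (RAssign ''cur'' c0 (rv ''v'')) (ClearDigits p)) s1 (1 + ((p * \<mu> + 2) * 3 + 2))
    (\<lambda>s'. dec s' ''S'' = dec s ''X'' \<and> rmem s' ''cur'' 0 = rmem s ''v'' 0 \<and> digits (p * \<mu> + 1) 0 s')"
    using s1 by (simp add: run_simps)
qed (use inp in simp_all)

abbreviation "step_time \<equiv> step_cost \<mu> n m"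

lemmas step_time_def = step_cost_def

lemma run_SearchStep:
  assumes inp: "input s" and dig: "digits (p * \<mu> + 1) c s"
    and X: "X = toggle es (digit (m + 1) c) (p * \<mu> + 1) (dec s ''S'')"
    and v: "v = trunc (rmem s ''theta'' 0) (rmem s ''w'') X"
  shows "run \<Omega> (SearchStep p) s (step_time p)
    (\<lambda>s'. if X \<in> \<I> \<and> rmem s ''cur'' 0 + rmem s ''kap'' 0 < v
      then dec s' ''S'' = X \<and> rmem s' ''cur'' 0 = v \<and> digits (p * \<mu> + 1) 0 s'
      else dec s' ''S'' = dec s ''S'' \<and> rmem s' ''cur'' 0 = rmem s ''cur'' 0 \<and> digits (p * \<mu> + 1) (c + 1) s')"
  unfolding SearchStep_def step_time_def
proof (rule run_Seq[OF run_frame[OF run_Candidate[OF inp]]])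
  let ?Q = "\<lambda>s'. if X \<in> \<I> \<and> rmem s ''cur'' 0 + rmem s ''kap'' 0 < v
      then dec s' ''S'' = X \<and> rmem s' ''cur'' 0 = v \<and> digits (p * \<mu> + 1) 0 s'
      else dec s' ''S'' = dec s ''S'' \<and> rmem s' ''cur'' 0 = rmem s ''cur'' 0 \<and> digits (p * \<mu> + 1) (c + 1) s'"
  fix s1 assume s1: "(dec s1 ''X'' = toggle es (nmem s ''d'') (p * \<mu> + 1) (dec s ''S'') \<and>
      nmem s1 ''ok'' 0 = (if dec s1 ''X'' \<in> \<I> then 1 else 0) \<and>
      rmem s1 ''v'' 0 = trunc (rmem s ''theta'' 0) (rmem s ''w'') (dec s1 ''X'')) \<and> agree (Candidate p) s s1"
  have inp1: "input s1" using s1 input_agree inp by fastforce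
  have "toggle es (nmem s ''d'') (p * \<mu> + 1) (dec s ''S'') = X"
    unfolding X using dig by (intro toggle_cong) (auto simp: digits_def)
  then have X1: "dec s1 ''X'' = X" "nmem s1 ''ok'' 0 = (if X \<in> \<I> then 1 else 0)" "rmem s1 ''v'' 0 = v"
    using s1 v by auto
  have ag: "nmem s1 ''d'' = nmem s ''d''" "nmem s1 ''S'' = nmem s ''S''" "rmem s1 ''cur'' = rmem s ''cur''" "rmem s1 ''kap'' = rmem s ''kap''"
    using s1 by (auto simp: agree_def)
  have dS: "dec s1 ''S'' = dec s ''S''" using ag by (simp add: decode_def)
  have dig1: "digits (p * \<mu> + 1) c s1" using dig ag by (simp add: digits_def)
  let ?cond = "X \<in> \<I> \<and> rmem s ''cur'' 0 + rmem s ''kap'' 0 < v"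
  have R: "run \<Omega> (if ?cond then Accept p else Increment p) s1 (m * 3 + 2 + (1 + ((p * \<mu> + 2) * 3 + 2))) ?Q"
  proof (cases ?cond)
    case True
    then show ?thesis using run_Accept[OF inp1, of p] X1 by (auto elim!: run_weaken)
  next
    case False
    have "run \<Omega> (Increment p) s1 ((p * \<mu> + 1) * 3 + 3) ?Q"
    proof (rule run_weaken[OF run_frame[OF run_Increment[OF inp1 dig1]]])
      fix s2 assume s2: "digits (p * \<mu> + 1) (c + 1) s2 \<and> agree (Increment p) s1 s2"
      then have "dec s2 ''S'' = dec s1 ''S''" "rmem s2 = rmem s1"
        using decode_agree[of "Increment p" s1 s2 "''S''"] by (auto simp: agree_def)
      then show "?Q s2" using False s2 dS ag by auto
    qed simp
    then show ?thesis using False by (auto elim!: run_weaken)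
  qed
  have bv: "bval (Conj (NLess c0 (nv ''ok'')) (RLess (RAdd (rv ''cur'') (rv ''kap'')) (rv ''v''))) s1 \<longleftrightarrow> ?cond"
    using X1 ag by simp
  show "run \<Omega> (Cond (Conj (NLess c0 (nv ''ok'')) (RLess (RAdd (rv ''cur'') (rv ''kap'')) (rv ''v'')))
       (Accept p) (Increment p)) s1 (m * 3 + 2 + (1 + ((p * \<mu> + 2) * 3 + 2)) + 1) ?Q"
    unfolding run_Cond_iff bv add_diff_cancel_right' by (rule conjI[OF _ R]) simp
qed

lemma run_SumW:
  assumes "input s"
  shows "run \<Omega> SumW s (n * 3 + 3) (\<lambda>s'. rmem s' ''W'' 0 = (\<Sum>k<n. rmem s ''w'' k))"
proof -
  let ?s = "rupd s ''W'' 0 0"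
  define Inv where "Inv i s' \<longleftrightarrow> rmem s' ''W'' 0 = (\<Sum>k<i. rmem s ''w'' k)" for i and s' :: state
  let ?body = "RAssign ''W'' c0 (RAdd (rv ''W'') (RCell ''w'' (nv ''k'')))"
  have "run \<Omega> (For ''k'' (nv ''n'') ?body) ?s (n * (1 + 2) + 2) (Inv n)"
  proof (rule run_For)
    show "Inv 0 (nupd ?s ''k'' 0 0)" by (simp add: Inv_def)
    fix s' assume ag: "agree (For ''k'' (nv ''n'') ?body) ?s s'"
    show "nval (nv ''n'') s' = n" using agree_nmem[OF ag, of "''n''"] assms by (simp add: input_def)
    fix i assume "i < n" "Inv i s'" "nmem s' ''k'' 0 = i"
    moreover have "rmem s' ''w'' = rmem s ''w''"
      using agree_rmem[OF ag] by (simp_all add: rmem_rupd_other)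
    ultimately show "run \<Omega> ?body s' 1 (\<lambda>s''. nmem s'' ''k'' 0 = i \<and> Inv (Suc i) (nupd s'' ''k'' 0 (Suc i)))"
      by (auto simp: run_simps Inv_def)
  qed
  then show ?thesis
    unfolding SumW_def by (auto simp: run_simps Inv_def elim!: run_weaken)
qed

abbreviation "D \<equiv> scale_val \<mu>"

lemmas D_def = scale_val_def

lemma rval_scale: "input s \<Longrightarrow> rval (scale r) s = real (D r)"
  by (simp add: scale_def D_def input_def of_rat_mult algebra_simps)

definition slack :: "nat \<Rightarrow> real \<Rightarrow> (nat \<Rightarrow> real) \<Rightarrow> real" where
  "slack r \<beta> w = (\<Sum>k<n. w k) * \<beta> / (real (D r) * real n * real m)"

lemma run_InitSearch:
  assumes inp: "input s"
  shows "run \<Omega> (InitSearch p r) s (m * 3 + 2 + ((p * \<mu> + 2) * 3 + 2 + (n * 3 + 3 + 2)))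
    (\<lambda>s'. dec s' ''S'' = {} \<and> digits (p * \<mu> + 1) 0 s' \<and> rmem s' ''cur'' 0 = 0 \<and>
       rmem s' ''kap'' 0 = slack r (rmem s ''beta'' 0) (rmem s ''w''))"
  unfolding InitSearch_def
proof (rule run_Seq[OF run_frame[OF run_ClearSet[OF inp]]])
  let ?Q = "\<lambda>s'. dec s' ''S'' = {} \<and> digits (p * \<mu> + 1) 0 s' \<and> rmem s' ''cur'' 0 = 0 \<and>
       rmem s' ''kap'' 0 = slack r (rmem s ''beta'' 0) (rmem s ''w'')"
  fix s1 assume s1: "dec s1 ''S'' = {} \<and> agree (ClearSet ''S'') s s1"
  then have inp1: "input s1" using input_agree inp by fastforce
  let ?last = "Seq (RAssign ''cur'' c0 (RConst 0))
     (RAssign ''kap'' c0 (RDiv (RMul (rv ''W'') (rv ''beta''))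
        (RMul (RMul (scale r) (RNat (nv ''n''))) (RNat (nv ''m'')))))"
  show "run \<Omega> (Seq (ClearDigits p) (Seq SumW ?last)) s1 ((p * \<mu> + 2) * 3 + 2 + (n * 3 + 3 + 2)) ?Q"
  proof (rule run_Seq[OF run_frame[OF run_ClearDigits[OF inp1]]])
    fix s2 assume s2: "digits (p * \<mu> + 1) 0 s2 \<and> agree (ClearDigits p) s1 s2"
    then have inp2: "input s2" using input_agree inp1 by fastforce
    show "run \<Omega> (Seq SumW ?last) s2 (n * 3 + 3 + 2) ?Q"
    proof (rule run_Seq[OF run_frame[OF run_SumW[OF inp2]]])
      fix s3 assume s3: "rmem s3 ''W'' 0 = (\<Sum>k<n. rmem s2 ''w'' k) \<and> agree SumW s2 s3"
      then have inp3: "input s3" using input_agree inp2 by fastforce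
      have w: "rmem s2 ''w'' = rmem s ''w''" "rmem s3 ''beta'' = rmem s ''beta''"
        using s1 s2 s3 by (auto simp: agree_def)
      have "nmem s3 ''S'' = nmem s1 ''S''" "nmem s3 ''d'' = nmem s2 ''d''"
        using s2 s3 by (auto simp: agree_def)
      then have "dec s3 ''S'' = {}" "digits (p * \<mu> + 1) 0 s3"
        using s1 s2 by (auto simp: decode_def digits_def)
      then show "run \<Omega> ?last s3 2 ?Q"
        using s3 w inp3 rval_scale[OF inp3] rval_scale[of "rupd s3 ''cur'' 0 0"]
        by (simp add: run_simps input_def digits_def slack_def)
    qed
  qed
qed simp_all

lemma trunc_le:
  assumes "\<And>k. k < n \<Longrightarrow> w k \<ge> 0"
  shows "trunc \<theta> w X \<le> (\<Sum>k<n. w k) * \<theta>"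
  unfolding trunc_def sum_distrib_right using assms by (intro sum_mono mult_left_mono) auto

text \<open>Every acceptance raises h by more than \<open>\<kappa>\<close>, and h never exceeds
  \<open>K\<close> times \<open>\<kappa>\<close>. Hence there are at most \<open>K\<close>
  acceptances, and between them at most (m + 1) ^ N rejected candidates.\<close>

lemma run_LocalSearch:
  fixes p r :: nat
  assumes inp: "input s" and \<beta>: "rmem s ''beta'' 0 = \<beta>" "\<beta> \<ge> 0" and r: "r > 0"
    and \<theta>: "rmem s ''theta'' 0 = \<theta>" "\<theta> = real n * real m * real (D r) * \<beta>"
    and w: "\<And>k. k < n \<Longrightarrow> rmem s ''w'' k \<ge> 0"
  defines "N \<equiv> p * \<mu> + 1" and "K \<equiv> (n * m * D r)\<^sup>2" and "h \<equiv> trunc \<theta> (rmem s ''w'')" and "\<kappa> \<equiv> slack r \<beta> (rmem s ''w'')"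
  shows "run \<Omega> (LocalSearch p r) s
      (m * 3 + 2 + ((p * \<mu> + 2) * 3 + 2 + (n * 3 + 3 + 2)) +
        ((K * ((m + 1) ^ N + 1) + (m + 1) ^ N) * (step_time p + 1) + 1))
    (\<lambda>s'. dec s' ''S'' \<in> \<I> \<and> (\<forall>S'\<in>\<I>. card ((dec s' ''S'' - S') \<union> (S' - dec s' ''S'')) \<le> N \<longrightarrow>
       h S' \<le> h (dec s' ''S'') + \<kappa>))"
  unfolding LocalSearch_def
proof (rule run_Seq[OF run_frame[OF run_InitSearch[OF inp]]])
  let ?W = "\<Sum>k<n. rmem s ''w'' k"
  fix s0 assume s0: "(dec s0 ''S'' = {} \<and> digits (p * \<mu> + 1) 0 s0 \<and> rmem s0 ''cur'' 0 = 0 \<and>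
       rmem s0 ''kap'' 0 = slack r (rmem s ''beta'' 0) (rmem s ''w'')) \<and> agree (InitSearch p r) s s0"
  have inp0: "input s0" using s0 input_agree inp by fastforce
  have mem0: "rmem s0 ''w'' = rmem s ''w''" "rmem s0 ''theta'' = rmem s ''theta''"
    using s0 by (auto simp: agree_def)
  have W0: "?W \<ge> 0" using w by (intro sum_nonneg) auto
  have "D r > 0" using r by (simp add: D_def)
  then have D0: "real (D r) > 0" by simp
  have \<theta>0: "\<theta> \<ge> 0" using \<theta>(2) \<beta>(2) by simp
  have \<kappa>0: "\<kappa> \<ge> 0" using W0 \<beta>(2) by (simp add: \<kappa>_def slack_def)
  \<comment> \<open>The threshold n m D \<beta> and the slack per unit of weight, \<beta> / (D n m),
    differ by the factor (n m D)^2. For m = 0 both sides vanish, the slack through division by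
    zero.\<close>
  have K\<kappa>: "?W * \<theta> = real K * \<kappa>"
    using D0 n by (cases "m = 0") (simp_all add: \<kappa>_def slack_def K_def \<theta>(2) power2_eq_square field_simps)
  have h_le: "h X \<le> real K * \<kappa>" for X using trunc_le[of "rmem s ''w''" \<theta> X] w K\<kappa> by (simp add: h_def)
  define B where "B = (m + 1) ^ N"
  \<comment> \<open>j counts the acceptances and c the candidates rejected for the current set. The
    variant orders these pairs lexicographically; c takes B + 1 values.\<close>
  define Inv where "Inv k s' \<longleftrightarrow> (\<exists>j c. j \<le> K \<and> c \<le> B \<and> k = (K - j) * (B + 1) + (B - c) \<and> input s' \<and>
      dec s' ''S'' \<in> \<I> \<and> rmem s' ''cur'' 0 = h (dec s' ''S'') \<and> real j * \<kappa> \<le> h (dec s' ''S'') \<and> digits N c s' \<and>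
      (\<forall>c'<c. toggle es (digit (m + 1) c') N (dec s' ''S'') \<in> \<I> \<longrightarrow>
        h (toggle es (digit (m + 1) c') N (dec s' ''S'')) \<le> h (dec s' ''S'') + \<kappa>))" for k s'
  let ?b = "NLess (NCell ''d'' (swaps p)) c1"
  have guard: "bval ?b s' \<longleftrightarrow> c < B" if "input s'" "digits N c s'" for s' c
    using that by (simp add: input_def swaps_def digits_def N_def B_def div_eq_0_iff)
  have "run \<Omega> (While ?b (SearchStep p)) s0 ((K * (B + 1) + B) * (step_time p + 1) + 1)
    (\<lambda>s'. \<not> bval ?b s' \<and> (\<exists>k. Inv k s'))"
  proof (rule run_While)
    have "h {} = 0" using f_empty \<theta>0 by (simp add: h_def trunc_def)
    then show "Inv (K * (B + 1) + B) s0"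
      unfolding Inv_def using s0 inp0 empty_indep by (intro exI[of _ 0]) (auto simp: N_def)
    fix k s1 assume "Inv k s1" and b: "bval ?b s1" and ag: "agree (While ?b (SearchStep p)) s0 s1"
    then obtain j c where j: "j \<le> K" "c \<le> B" "k = (K - j) * (B + 1) + (B - c)" "input s1"
      "dec s1 ''S'' \<in> \<I>" "rmem s1 ''cur'' 0 = h (dec s1 ''S'')" "real j * \<kappa> \<le> h (dec s1 ''S'')" "digits N c s1"
      and seen: "\<forall>c'<c. toggle es (digit (m + 1) c') N (dec s1 ''S'') \<in> \<I> \<longrightarrow>
        h (toggle es (digit (m + 1) c') N (dec s1 ''S'')) \<le> h (dec s1 ''S'') + \<kappa>"
      unfolding Inv_def by blast
    have cB: "c < B" using guard[OF j(4,8)] b by simp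
    have mem1: "rmem s1 ''w'' = rmem s ''w''" "rmem s1 ''theta'' 0 = \<theta>" "rmem s1 ''kap'' 0 = \<kappa>"
      using ag mem0 s0 \<theta>(1) \<beta>(1) by (auto simp: agree_def \<kappa>_def)
    define X where "X = toggle es (digit (m + 1) c) N (dec s1 ''S'')"
    have run: "run \<Omega> (SearchStep p) s1 (step_time p)
      (\<lambda>s'. (if X \<in> \<I> \<and> rmem s1 ''cur'' 0 + rmem s1 ''kap'' 0 < h X
        then dec s' ''S'' = X \<and> rmem s' ''cur'' 0 = h X \<and> digits N 0 s'
        else dec s' ''S'' = dec s1 ''S'' \<and> rmem s' ''cur'' 0 = rmem s1 ''cur'' 0 \<and> digits N (c + 1) s') \<and>
        agree (SearchStep p) s1 s')"
    proof -
      have "digits (p * \<mu> + 1) c s1" "X = toggle es (digit (m + 1) c) (p * \<mu> + 1) (dec s1 ''S'')"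
        using j(8) unfolding X_def N_def by (blast+)
      moreover have "h X = trunc (rmem s1 ''theta'' 0) (rmem s1 ''w'') X" unfolding h_def mem1 ..
      ultimately show ?thesis
        unfolding N_def by (intro run_frame run_SearchStep j(4))
    qed
    show "run \<Omega> (SearchStep p) s1 (step_time p) (\<lambda>s'. \<exists>k'<k. Inv k' s')"
    proof (rule run_weaken[OF run])
      fix s2 assume s2: "(if X \<in> \<I> \<and> rmem s1 ''cur'' 0 + rmem s1 ''kap'' 0 < h X
        then dec s2 ''S'' = X \<and> rmem s2 ''cur'' 0 = h X \<and> digits N 0 s2
        else dec s2 ''S'' = dec s1 ''S'' \<and> rmem s2 ''cur'' 0 = rmem s1 ''cur'' 0 \<and> digits N (c + 1) s2) \<and>
        agree (SearchStep p) s1 s2"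
      then have inp2: "input s2" using input_agree j(4) by fastforce
      show "\<exists>k'<k. Inv k' s2"
      proof (cases "X \<in> \<I> \<and> rmem s1 ''cur'' 0 + rmem s1 ''kap'' 0 < h X")
        case True
        then have new: "dec s2 ''S'' = X" "rmem s2 ''cur'' 0 = h X" "digits N 0 s2" using s2 by auto
        have gain: "real (j + 1) * \<kappa> < h X" using True j(6,7) mem1 by (simp add: algebra_simps)
        then have "real (j + 1) * \<kappa> < real K * \<kappa>" using h_le[of X] by linarith
        \<comment> \<open>This covers \<kappa> = 0 as well, where the preceding inequality is
          contradictory because nothing can be accepted.\<close>
        then have jK: "j + 1 < K" using \<kappa>0 by (simp add: mult_less_cancel_right)
        have "Inv ((K - (j + 1)) * (B + 1) + (B - 0)) s2"
          unfolding Inv_def using jK inp2 True new gain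
          by (intro exI[of _ "j + 1"] exI[of _ 0]) (auto simp: less_imp_le)
        moreover have "(K - (j + 1)) * (B + 1) + (B - 0) < k"
        proof -
          have Kj: "K - j = Suc (K - (j + 1))" using jK by simp
          have "k = (B + 1) + (K - (j + 1)) * (B + 1) + (B - c)" unfolding j(3) Kj mult_Suc ..
          then show ?thesis using cB by linarith
        qed
        ultimately show ?thesis by blast
      next
        case False
        then have new: "dec s2 ''S'' = dec s1 ''S''" "rmem s2 ''cur'' 0 = rmem s1 ''cur'' 0" "digits N (c + 1) s2"
          using s2 by auto
        have "\<forall>c'<c + 1. toggle es (digit (m + 1) c') N (dec s1 ''S'') \<in> \<I> \<longrightarrow>
          h (toggle es (digit (m + 1) c') N (dec s1 ''S'')) \<le> h (dec s1 ''S'') + \<kappa>"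
          using seen False j(6) mem1 by (auto simp: less_Suc_eq X_def)
        then have "Inv ((K - j) * (B + 1) + (B - (c + 1))) s2"
          unfolding Inv_def using j inp2 new cB
          by (intro exI[of _ j] exI[of _ "c + 1"]) simp
        moreover have "(K - j) * (B + 1) + (B - (c + 1)) < k" using j(3) cB by simp
        ultimately show ?thesis by blast
      qed
    qed simp
  qed
  then show "run \<Omega> (While ?b (SearchStep p)) s0
      ((K * ((m + 1) ^ N + 1) + (m + 1) ^ N) * (step_time p + 1) + 1)
    (\<lambda>s'. dec s' ''S'' \<in> \<I> \<and> (\<forall>S'\<in>\<I>. card ((dec s' ''S'' - S') \<union> (S' - dec s' ''S'')) \<le> N \<longrightarrow>
       h S' \<le> h (dec s' ''S'') + \<kappa>))"
  proof (rule run_weaken)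
    fix s' assume "\<not> bval ?b s' \<and> (\<exists>k. Inv k s')"
    then obtain j c where nb: "\<not> bval ?b s'" and j: "c \<le> B" "input s'" "dec s' ''S'' \<in> \<I>" "digits N c s'"
      and seen: "\<forall>c'<c. toggle es (digit (m + 1) c') N (dec s' ''S'') \<in> \<I> \<longrightarrow>
        h (toggle es (digit (m + 1) c') N (dec s' ''S'')) \<le> h (dec s' ''S'') + \<kappa>"
      unfolding Inv_def by blast
    have c: "c = B" using guard[OF j(2,4)] nb j(1) by simp
    let ?S = "dec s' ''S''"
    have "h S' \<le> h ?S + \<kappa>" if S': "S' \<in> \<I>" "card ((?S - S') \<union> (S' - ?S)) \<le> N" for S'
    proof -
      let ?A = "(?S - S') \<union> (S' - ?S)"
      have AE: "?A \<subseteq> set es" using indep_subset[OF S'(1)] indep_subset[OF j(3)] set_es by auto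
      then have "finite ?A" using finite_subset by blast
      then obtain d where d: "\<forall>i. d i \<le> m" "toggle es d N ?S = (?S - ?A) \<union> (?A - ?S)"
        using toggle_surj[OF _ AE S'(2)] by blast
      obtain c' where c': "c' < (m + 1) ^ N" "\<forall>i<N. digit (m + 1) c' i = d i"
        using digits_surj[of d "m + 1" N] d(1) by (auto simp: less_Suc_eq_le)
      have "toggle es (digit (m + 1) c') N ?S = toggle es d N ?S" using c'(2) by (intro toggle_cong) auto
      also have "\<dots> = S'" unfolding d(2) by auto
      finally show ?thesis using seen c'(1) c S'(1) unfolding B_def by metis
    qed
    then show "?S \<in> \<I> \<and> (\<forall>S'\<in>\<I>. card ((?S - S') \<union> (S' - ?S)) \<le> N \<longrightarrow> h S' \<le> h ?S + \<kappa>)"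
      using j(3) by blast
  qed (simp add: B_def)
qed

lemma run_Singletons:
  assumes inp: "input s" and k: "nmem s ''k'' 0 = k" and X0: "\<forall>j<m. nmem s ''X'' j = 0" and mx: "rmem s ''mx'' 0 = 0"
  shows "run \<Omega> Singletons s (m * (\<mu> * 5 + 3 + 5 + 2) + 2)
    (\<lambda>s'. (\<forall>j<m. nmem s' ''X'' j = 0) \<and> rmem s' ''mx'' 0 \<ge> 0 \<and> (\<forall>e. {e} \<in> \<I> \<longrightarrow> f k {e} \<le> rmem s' ''mx'' 0) \<and>
      (rmem s' ''mx'' 0 = 0 \<or> (\<exists>e. {e} \<in> \<I> \<and> rmem s' ''mx'' 0 \<le> f k {e})))"
proof -
  define Inv where "Inv i s' \<longleftrightarrow> (\<forall>j<m. nmem s' ''X'' j = 0) \<and> rmem s' ''mx'' 0 \<ge> 0 \<and>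
      (\<forall>j<i. {es ! j} \<in> \<I> \<longrightarrow> f k {es ! j} \<le> rmem s' ''mx'' 0) \<and>
      (rmem s' ''mx'' 0 = 0 \<or> (\<exists>e. {e} \<in> \<I> \<and> rmem s' ''mx'' 0 \<le> f k {e}))" for i and s' :: state
  let ?rest = "Seq (ValueQuery ''q'' c0 (nv ''k'') ''X'' c0)
       (Seq (Cond (Conj (NLess c0 (nv ''ok'')) (RLess (rv ''mx'') (rv ''q''))) (RAssign ''mx'' c0 (rv ''q'')) Skip)
         (NAssign ''X'' (nv ''e'') c0))"
  let ?body = "Seq (NAssign ''X'' (nv ''e'') c1) (Seq IndepX ?rest)"
  have "run \<Omega> (For ''e'' (nv ''m'') ?body) s (m * (\<mu> * 5 + 3 + 5 + 2) + 2) (Inv m)"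
  proof (rule run_For)
    show "Inv 0 (nupd s ''e'' 0 0)" using X0 mx by (simp add: Inv_def)
    fix s' assume ag: "agree (For ''e'' (nv ''m'') ?body) s s'"
    have inp': "input s'" using input_agree[OF ag inp] by simp
    show "nval (nv ''m'') s' = m" using inp' by (simp add: input_def)
    fix i assume i: "i < m" "Inv i s'" "nmem s' ''e'' 0 = i"
    have k': "nmem s' ''k'' 0 = k" using ag k by (auto simp: agree_def)
    let ?s1 = "nupd s' ''X'' i 1"
    have inp1: "input ?s1" using inp' by simp
    have dec1: "dec ?s1 ''X'' = {es ! i}"
    proof (rule decode_eqI)
      show "{es ! i} \<subseteq> E" using i(1) set_es by auto
      fix j assume "j < m"
      then show "nmem ?s1 ''X'' (0 + j) \<noteq> 0 \<longleftrightarrow> es ! j \<in> {es ! i}"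
        using i distinct_es by (auto simp: Inv_def nth_eq_iff_index_eq)
    qed
    have "run \<Omega> (Seq IndepX ?rest) ?s1 (\<mu> * 5 + 3 + 4) (\<lambda>s''. nmem s'' ''e'' 0 = i \<and> Inv (Suc i) (nupd s'' ''e'' 0 (Suc i)))"
    proof (rule run_Seq[OF run_frame[OF run_IndepX[OF inp1]]])
      fix s2 assume s2: "nmem s2 ''ok'' 0 = (if dec ?s1 ''X'' \<in> \<I> then 1 else 0) \<and> agree IndepX ?s1 s2"
      have mem2: "nmem s2 ''X'' = nmem ?s1 ''X''" "nmem s2 ''e'' = nmem s' ''e''" "nmem s2 ''k'' = nmem s' ''k''" "rmem s2 = rmem s'"
        using s2 by (auto simp: agree_def nmem_nupd_other)
      then have dec2: "dec s2 ''X'' = {es ! i}" using dec1 by (simp add: decode_def)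
      show "run \<Omega> ?rest s2 4 (\<lambda>s''. nmem s'' ''e'' 0 = i \<and> Inv (Suc i) (nupd s'' ''e'' 0 (Suc i)))"
        using s2 mem2 dec1 dec2 i k' by (auto simp: run_simps Inv_def less_Suc_eq)
    qed
    then show "run \<Omega> ?body s' (\<mu> * 5 + 3 + 5) (\<lambda>s''. nmem s'' ''e'' 0 = i \<and> Inv (Suc i) (nupd s'' ''e'' 0 (Suc i)))"
      using i(3) by (simp add: run_simps)
  qed
  then show ?thesis
    unfolding Singletons_def
  proof (rule run_weaken)
    fix s' assume s': "Inv m s'"
    have "f k {e} \<le> rmem s' ''mx'' 0" if "{e} \<in> \<I>" for e
    proof -
      have "e \<in> set es" using indep_subset[OF that] set_es by auto
      then obtain j where "j < m" "es ! j = e" by (auto simp: in_set_conv_nth)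
      then show ?thesis using s' that by (auto simp: Inv_def)
    qed
    then show "(\<forall>j<m. nmem s' ''X'' j = 0) \<and> rmem s' ''mx'' 0 \<ge> 0 \<and> (\<forall>e. {e} \<in> \<I> \<longrightarrow> f k {e} \<le> rmem s' ''mx'' 0) \<and>
      (rmem s' ''mx'' 0 = 0 \<or> (\<exists>e. {e} \<in> \<I> \<and> rmem s' ''mx'' 0 \<le> f k {e}))"
      using s' by (auto simp: Inv_def)
  qed simp
qed

lemma run_Bottleneck:
  assumes inp: "input s" and X0: "\<forall>j<m. nmem s ''X'' j = 0"
  shows "run \<Omega> Bottleneck s (n * (m * (\<mu> * 5 + 3 + 5 + 2) + 2 + 2 + 1 + 2) + 2) (\<lambda>s'. bottleneck (rmem s' ''beta'' 0))"
proof -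
  define P where "P i \<beta> \<longleftrightarrow> \<beta> \<ge> 0 \<and> (\<exists>k<i. \<forall>e. {e} \<in> \<I> \<longrightarrow> f k {e} \<le> \<beta>) \<and>
     (\<forall>k<i. \<beta> = 0 \<or> (\<exists>e. {e} \<in> \<I> \<and> \<beta> \<le> f k {e}))" for i \<beta>
  \<comment> \<open>\<open>P 0\<close> has no solution, as there is no index yet to attain the
    minimum; hence the separate case.\<close>
  define Inv where "Inv i s' \<longleftrightarrow> (\<forall>j<m. nmem s' ''X'' j = 0) \<and> (i = 0 \<or> P i (rmem s' ''beta'' 0))"
    for i and s' :: state
  let ?last = "Cond (Neg (Conj (Neg (NLess (nv ''k'') c1)) (Neg (RLess (rv ''mx'') (rv ''beta'')))))
         (RAssign ''beta'' c0 (rv ''mx'')) Skip"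
  let ?body = "Seq (RAssign ''mx'' c0 (RConst 0)) (Seq Singletons ?last)"
  let ?T = "m * (\<mu> * 5 + 3 + 5 + 2) + 2"
  have "run \<Omega> (For ''k'' (nv ''n'') ?body) s (n * (?T + 2 + 1 + 2) + 2) (Inv n)"
  proof (rule run_For)
    show "Inv 0 (nupd s ''k'' 0 0)" using X0 by (simp add: Inv_def)
    fix s' assume ag: "agree (For ''k'' (nv ''n'') ?body) s s'"
    have inp': "input s'" using input_agree[OF ag inp] by simp
    show "nval (nv ''n'') s' = n" using inp' by (simp add: input_def)
    fix i assume i: "i < n" "Inv i s'" "nmem s' ''k'' 0 = i"
    let ?s1 = "rupd s' ''mx'' 0 0"
    have pre: "input ?s1" "nmem ?s1 ''k'' 0 = i" "\<forall>j<m. nmem ?s1 ''X'' j = 0" "rmem ?s1 ''mx'' 0 = 0"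
      using i inp' by (auto simp: Inv_def)
    have "run \<Omega> (Seq Singletons ?last) ?s1 (?T + 2) (\<lambda>s''. nmem s'' ''k'' 0 = i \<and> Inv (Suc i) (nupd s'' ''k'' 0 (Suc i)))"
    proof (rule run_Seq[OF run_frame[OF run_Singletons[OF pre]]])
      fix s2 assume s2: "((\<forall>j<m. nmem s2 ''X'' j = 0) \<and> rmem s2 ''mx'' 0 \<ge> 0 \<and> (\<forall>e. {e} \<in> \<I> \<longrightarrow> f i {e} \<le> rmem s2 ''mx'' 0) \<and>
        (rmem s2 ''mx'' 0 = 0 \<or> (\<exists>e. {e} \<in> \<I> \<and> rmem s2 ''mx'' 0 \<le> f i {e}))) \<and> agree Singletons ?s1 s2"
      have mem2: "nmem s2 ''k'' 0 = i" "rmem s2 ''beta'' 0 = rmem s' ''beta'' 0"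
        using s2 i(3) by (auto simp: agree_def)
      let ?x = "rmem s2 ''mx'' 0" and ?\<beta> = "rmem s' ''beta'' 0"
      have new: "P (Suc i) ?x" if "i = 0 \<or> ?x < ?\<beta>"
      proof -
        have "?x = 0 \<or> (\<exists>e. {e} \<in> \<I> \<and> ?x \<le> f k {e})" if "k < Suc i" for k
        proof (cases "k = i")
          case True
          then show ?thesis using s2 by blast
        next
          case False
          then have "k < i" using that by simp
          then have "?\<beta> = 0 \<or> (\<exists>e. {e} \<in> \<I> \<and> ?\<beta> \<le> f k {e})" "?x < ?\<beta>"
            using i(2) \<open>i = 0 \<or> ?x < ?\<beta>\<close> by (auto simp: Inv_def P_def)
          then show ?thesis using s2 by force
        qed
        then show ?thesis unfolding P_def using s2 by blast
      qed
      have old: "P (Suc i) ?\<beta>" if "i \<noteq> 0" "\<not> ?x < ?\<beta>"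
      proof -
        have P: "P i ?\<beta>" using i(2) that by (auto simp: Inv_def)
        have "?\<beta> = 0 \<or> (\<exists>e. {e} \<in> \<I> \<and> ?\<beta> \<le> f i {e})"
        proof (cases "?x = 0")
          case True
          then show ?thesis using that P by (auto simp: P_def)
        next
          case False
          then obtain e where "{e} \<in> \<I>" "?x \<le> f i {e}" using s2 by blast
          then show ?thesis using that by force
        qed
        then show ?thesis using P unfolding P_def by (metis less_Suc_eq)
      qed
      show "run \<Omega> ?last s2 2 (\<lambda>s''. nmem s'' ''k'' 0 = i \<and> Inv (Suc i) (nupd s'' ''k'' 0 (Suc i)))"
        using s2 mem2 new old by (auto simp: run_simps Inv_def)
    qed
    then show "run \<Omega> ?body s' (?T + 2 + 1) (\<lambda>s''. nmem s'' ''k'' 0 = i \<and> Inv (Suc i) (nupd s'' ''k'' 0 (Suc i)))"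
      by (simp add: run_simps)
  qed
  then show ?thesis
    unfolding Bottleneck_def
  proof (rule run_weaken)
    fix s' assume "Inv n s'"
    then have "P n (rmem s' ''beta'' 0)" using n by (simp add: Inv_def)
    then show "bottleneck (rmem s' ''beta'' 0)" unfolding P_def bottleneck_def .
  qed simp
qed

end

section \<open>The program\<close>

text \<open>If \<open>\<theta> = 0\<close>, then the quotient in \<open>Update\<close> is \<open>0 / 0 = 0\<close> and the weights stay at \<open>1\<close>.\<close>

definition Update :: "nat \<Rightarrow> com" where
  "Update r = For ''k'' (nv ''n'')
     (Seq (ValueQuery ''q'' c0 (nv ''k'') ''S'' c0)
       (Seq (Cond (RLess (rv ''theta'') (rv ''q'')) (RAssign ''q'' c0 (rv ''theta'')) Skip)
         (RAssign ''w'' (nv ''k'') (RMul (RCell ''w'' (nv ''k''))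
            (RSub (RConst 1) (RDiv (rv ''q'') (RMul (scale r) (rv ''theta''))))))))"

text \<open>The pointer \<open>ptr\<close> replaces the product of \<open>len\<close> and
  \<open>m\<close>, which cannot be formed on natural numbers.\<close>

definition Round :: "nat \<Rightarrow> nat \<Rightarrow> com" where
  "Round p r = Seq (LocalSearch p r) (Seq (CopySet ''supp'' (nv ''ptr'') ''S'')
     (Seq (NAssign ''ptr'' c0 (NAdd (nv ''ptr'') (nv ''m''))) (Seq (NAssign ''len'' c0 (NAdd (nv ''len'') c1)) (Update r))))"

text \<open>A real expression, since only reals can be multiplied. The summand 1 ensures a round
  even for empty E, so that the output is always a distribution.\<close>

definition rounds :: "nat \<Rightarrow> rexp" where
  "rounds r = RAdd (RMul (RMul (RMul (RConst 4) (RAdd (RNat (nv ''mu'')) (RConst 1)))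
       (RMul (RMul (RNat (nv ''n'')) (RMul (RNat (nv ''n'')) (RNat (nv ''n'')))) (RNat (nv ''m''))))
     (RMul (scale r) (RMul (scale r) (scale r)))) (RConst 1)"

definition Prepare :: "nat \<Rightarrow> com" where
  "Prepare r = Seq (RAssign ''theta'' c0 (RMul (RMul (RMul (RNat (nv ''n'')) (RNat (nv ''m''))) (scale r)) (rv ''beta'')))
     (For ''k'' (nv ''n'') (RAssign ''w'' (nv ''k'') (RConst 1)))"

definition Rounds :: "nat \<Rightarrow> nat \<Rightarrow> com" where
  "Rounds p r = While (RLess (RNat (nv ''len'')) (rounds r)) (Round p r)"

definition Finish :: com where
  "Finish = For ''a'' (nv ''len'') (RAssign ''prob'' (nv ''a'') (RDiv (RConst 1) (RNat (nv ''len''))))"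

definition Main :: "nat \<Rightarrow> nat \<Rightarrow> com" where
  "Main p r = Seq Bottleneck (Seq (Prepare r) (Seq (Rounds p r) Finish))"

lemma mods_main [simp]:
  "nmods (Update r) = {''k''}" "rmods (Update r) = {''q'', ''w''}"
  "nmods (Round p r) = {''e'', ''X'', ''i'', ''ok'', ''r'', ''k'', ''S'', ''d'', ''supp'', ''ptr'', ''len''}"
  "rmods (Round p r) = {''v'', ''q'', ''cur'', ''W'', ''kap'', ''w''}"
  "nmods (Prepare r) = {''k''}" "rmods (Prepare r) = {''theta'', ''w''}"
  "nmods (Rounds p r) = nmods (Round p r)" "rmods (Rounds p r) = rmods (Round p r)"
  "nmods Finish = {''a''}" "rmods Finish = {''prob''}"
  by (auto simp: Update_def Round_def Prepare_def Rounds_def Finish_def)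

definition round_count :: "nat \<Rightarrow> nat \<Rightarrow> nat \<Rightarrow> nat \<Rightarrow> nat" where
  "round_count \<mu> n m r = 4 * (\<mu> + 1) * (n * (n * n) * m) * (scale_val \<mu> r * (scale_val \<mu> r * scale_val \<mu> r)) + 1"

definition search_cost :: "nat \<Rightarrow> nat \<Rightarrow> nat \<Rightarrow> nat \<Rightarrow> nat \<Rightarrow> nat" where
  "search_cost \<mu> n m p r = m * 3 + 2 + ((p * \<mu> + 2) * 3 + 2 + (n * 3 + 3 + 2)) +
    (((n * m * scale_val \<mu> r)\<^sup>2 * ((m + 1) ^ (p * \<mu> + 1) + 1) + (m + 1) ^ (p * \<mu> + 1)) * (step_cost \<mu> n m p + 1) + 1)"

definition main_cost :: "nat \<Rightarrow> nat \<Rightarrow> nat \<Rightarrow> nat \<Rightarrow> nat \<Rightarrow> nat" where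
  "main_cost \<mu> n m p r = n * (m * (\<mu> * 5 + 3 + 5 + 2) + 2 + 2 + 1 + 2) + 2 + (n * 3 + 3 +
    ((round_count \<mu> n m r * (search_cost \<mu> n m p r + (m * 3 + 2 + (2 + (n * 6 + 2))) + 1) + 1) + (round_count \<mu> n m r * 3 + 2)))"

section \<open>The main loop and its invariant\<close>

context robust_program
begin

text \<open>The sets found so far determine the weights, so \<open>history\<close> can be a property
  of the output list alone.\<close>

definition weight :: "real \<Rightarrow> real \<Rightarrow> (nat \<Rightarrow> 'a set) \<Rightarrow> nat \<Rightarrow> nat \<Rightarrow> real" where
  "weight \<theta> \<eta> Xs t k = (\<Prod>j<t. 1 - \<eta> * min (f k (Xs j)) \<theta> / \<theta>)"

lemma weight_cong: "(\<And>j. j < t \<Longrightarrow> Xs j = Ys j) \<Longrightarrow> weight \<theta> \<eta> Xs t k = weight \<theta> \<eta> Ys t k"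
  by (simp add: weight_def)

lemma weight_nonneg:
  assumes "k < n" "\<And>j. j < t \<Longrightarrow> Xs j \<in> \<I>" "\<theta> \<ge> 0" "0 \<le> \<eta>" "\<eta> \<le> 1"
  shows "weight \<theta> \<eta> Xs t k \<ge> 0"
  unfolding weight_def
proof (intro prod_nonneg)
  fix j assume j: "j \<in> {..<t}"
  have "f k (Xs j) \<ge> 0" using f_nonneg[OF assms(1)] indep_subset assms(2) j by simp
  then have "min (f k (Xs j)) \<theta> / \<theta> \<le> 1" "0 \<le> min (f k (Xs j)) \<theta> / \<theta>"
    using assms(3) by (auto simp: divide_le_eq_1)
  then have "\<eta> * (min (f k (Xs j)) \<theta> / \<theta>) \<le> 1 * 1" using assms(4,5) by (intro mult_mono) auto
  then show "0 \<le> 1 - \<eta> * min (f k (Xs j)) \<theta> / \<theta>" by simp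
qed

lemma trunc_cong: "(\<And>k. k < n \<Longrightarrow> w k = w' k) \<Longrightarrow> trunc \<theta> w X = trunc \<theta> w' X"
  by (simp add: trunc_def)

lemma run_Update:
  assumes inp: "input s" and \<theta>: "rmem s ''theta'' 0 = \<theta>"
  shows "run \<Omega> (Update r) s (n * 6 + 2)
    (\<lambda>s'. \<forall>k<n. rmem s' ''w'' k = rmem s ''w'' k * (1 - (1 / real (D r)) * min (f k (dec s ''S'')) \<theta> / \<theta>))"
proof -
  define Inv where "Inv i s' \<longleftrightarrow> (\<forall>k. rmem s' ''w'' k =
      (if k < i then rmem s ''w'' k * (1 - (1 / real (D r)) * min (f k (dec s ''S'')) \<theta> / \<theta>) else rmem s ''w'' k))"
    for i and s' :: state
  let ?body = "Seq (ValueQuery ''q'' c0 (nv ''k'') ''S'' c0)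
       (Seq (Cond (RLess (rv ''theta'') (rv ''q'')) (RAssign ''q'' c0 (rv ''theta'')) Skip)
         (RAssign ''w'' (nv ''k'') (RMul (RCell ''w'' (nv ''k''))
            (RSub (RConst 1) (RDiv (rv ''q'') (RMul (scale r) (rv ''theta'')))))))"
  have "run \<Omega> (For ''k'' (nv ''n'') ?body) s (n * (4 + 2) + 2) (Inv n)"
  proof (rule run_For)
    show "Inv 0 (nupd s ''k'' 0 0)" by (simp add: Inv_def)
    fix s' assume ag: "agree (For ''k'' (nv ''n'') ?body) s s'"
    have inp': "input s'" using input_agree[OF ag inp] by simp
    show "nval (nv ''n'') s' = n" using inp' by (simp add: input_def)
    fix i assume i: "i < n" "Inv i s'" "nmem s' ''k'' 0 = i"
    have "dec s' ''S'' = dec s ''S''" using decode_agree[OF ag, of "''S''"] by simp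
    moreover have "rmem s' ''theta'' 0 = \<theta>" using ag \<theta> by (auto simp: agree_def)
    moreover have "rval (scale r) (rupd s' ''q'' 0 x) = real (D r)" "rval (scale r) (rupd (rupd s' ''q'' 0 x) ''q'' 0 y) = real (D r)" for x y
      using inp' by (auto intro!: rval_scale)
    ultimately show "run \<Omega> ?body s' 4 (\<lambda>s''. nmem s'' ''k'' 0 = i \<and> Inv (Suc i) (nupd s'' ''k'' 0 (Suc i)))"
      using i by (auto simp: run_simps Inv_def less_Suc_eq min_def not_less)
  qed
  then show ?thesis unfolding Update_def by (rule run_weaken) (auto simp: Inv_def)
qed

abbreviation "T \<equiv> round_count \<mu> n m"

lemmas T_def = round_count_def

lemma rval_rounds: "input s \<Longrightarrow> rval (rounds r) s = real (T r)"
  using rval_scale[of s r] by (simp add: rounds_def T_def input_def)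

definition guarantee :: "nat \<Rightarrow> nat \<Rightarrow> real \<Rightarrow> real" where
  "guarantee p r \<beta> = (1 - 1 / real (D r)) / (real \<mu> + 1 / real p) * max ((1 - 1 / real (D r)) * \<nu>) (\<beta> / real n)"

definition history :: "nat \<Rightarrow> nat \<Rightarrow> real \<Rightarrow> nat \<Rightarrow> (nat \<Rightarrow> 'a set) \<Rightarrow> bool" where
  "history p r \<beta> t Xs \<longleftrightarrow> (\<forall>j<t. Xs j \<in> \<I> \<and>
     (let \<theta> = real n * real m * real (D r) * \<beta>; w = weight \<theta> (1 / real (D r)) Xs j
      in guarantee p r \<beta> * (\<Sum>k<n. w k) \<le> trunc \<theta> w (Xs j)))"

lemma history_cong:
  assumes "\<And>j. j < t \<Longrightarrow> Xs j = Ys j" "history p r \<beta> t Xs"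
  shows "history p r \<beta> t Ys"
  unfolding history_def
proof (intro allI impI)
  fix j assume j: "j < t"
  have "weight \<theta> \<eta> Xs j = weight \<theta> \<eta> Ys j" for \<theta> \<eta>
    using assms(1) j by (intro ext weight_cong) auto
  moreover have "Xs j \<in> \<I> \<and> (let \<theta> = real n * real m * real (D r) * \<beta>; w = weight \<theta> (1 / real (D r)) Xs j
      in guarantee p r \<beta> * (\<Sum>k<n. w k) \<le> trunc \<theta> w (Xs j))"
    using assms(2) j unfolding history_def by blast
  ultimately show "Ys j \<in> \<I> \<and> (let \<theta> = real n * real m * real (D r) * \<beta>; w = weight \<theta> (1 / real (D r)) Ys j
      in guarantee p r \<beta> * (\<Sum>k<n. w k) \<le> trunc \<theta> w (Ys j))"
    by (simp only: assms(1)[OF j] Let_def)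
qed

abbreviation "search_time \<equiv> search_cost \<mu> n m"

lemmas search_time_def = search_cost_def

definition loop_inv :: "nat \<Rightarrow> nat \<Rightarrow> real \<Rightarrow> nat \<Rightarrow> state \<Rightarrow> bool" where
  "loop_inv p r \<beta> t s \<longleftrightarrow> input s \<and> rmem s ''beta'' 0 = \<beta> \<and> rmem s ''theta'' 0 = real n * real m * real (D r) * \<beta> \<and>
     nmem s ''len'' 0 = t \<and> nmem s ''ptr'' 0 = t * m \<and> history p r \<beta> t (\<lambda>j. decode es s ''supp'' (j * m)) \<and>
     (\<forall>k<n. rmem s ''w'' k = weight (real n * real m * real (D r) * \<beta>) (1 / real (D r)) (\<lambda>j. decode es s ''supp'' (j * m)) t k)"

lemma run_Round:
  assumes \<beta>: "bottleneck \<beta>" and p: "p > 0" and r: "r > 0" and inv: "loop_inv p r \<beta> t s"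
  shows "run \<Omega> (Round p r) s (search_time p r + (m * 3 + 2 + (2 + (n * 6 + 2)))) (loop_inv p r \<beta> (Suc t))"
proof -
  define \<theta> where "\<theta> = real n * real m * real (D r) * \<beta>"
  define \<eta> where "\<eta> = 1 / real (D r)"
  define Xs where "Xs j = decode es s ''supp'' (j * m)" for j
  have inp: "input s" and mem: "rmem s ''beta'' 0 = \<beta>" "rmem s ''theta'' 0 = \<theta>" "nmem s ''len'' 0 = t" "nmem s ''ptr'' 0 = t * m"
    and hist: "history p r \<beta> t Xs" and w: "\<And>k. k < n \<Longrightarrow> rmem s ''w'' k = weight \<theta> \<eta> Xs t k"
    using inv by (auto simp: loop_inv_def \<theta>_def \<eta>_def Xs_def[abs_def])
  have \<beta>0: "\<beta> \<ge> 0" using \<beta> by (simp add: bottleneck_def)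
  have "D r > 0" using r by (simp add: D_def)
  then have D1: "real (D r) \<ge> 1" by simp
  have \<eta>: "0 \<le> \<eta>" "\<eta> \<le> 1" using D1 by (auto simp: \<eta>_def)
  have \<theta>0: "\<theta> \<ge> 0" using \<beta>0 by (simp add: \<theta>_def)
  have w_nonneg: "rmem s ''w'' k \<ge> 0" if "k < n" for k
    unfolding w[OF that] using that hist \<theta>0 \<eta> by (intro weight_nonneg) (auto simp: history_def)
  let ?rest = "Seq (CopySet ''supp'' (nv ''ptr'') ''S'')
     (Seq (NAssign ''ptr'' c0 (NAdd (nv ''ptr'') (nv ''m''))) (Seq (NAssign ''len'' c0 (NAdd (nv ''len'') c1)) (Update r)))"
  show ?thesis
    unfolding Round_def search_time_def
  proof (rule run_Seq[OF run_frame[OF run_LocalSearch[OF inp mem(1) \<beta>0 r mem(2) \<theta>_def w_nonneg]]])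
    fix s1 assume s1: "(dec s1 ''S'' \<in> \<I> \<and> (\<forall>S'\<in>\<I>. card ((dec s1 ''S'' - S') \<union> (S' - dec s1 ''S'')) \<le> p * \<mu> + 1 \<longrightarrow>
        trunc \<theta> (rmem s ''w'') S' \<le> trunc \<theta> (rmem s ''w'') (dec s1 ''S'') + slack r \<beta> (rmem s ''w''))) \<and>
      agree (LocalSearch p r) s s1"
    define S where "S = dec s1 ''S''"
    have inp1: "input s1" using s1 input_agree inp by fastforce
    have mem1: "nmem s1 ''supp'' = nmem s ''supp''" "nmem s1 ''len'' = nmem s ''len''" "nmem s1 ''ptr'' = nmem s ''ptr''"
      "rmem s1 ''beta'' = rmem s ''beta''" "rmem s1 ''theta'' = rmem s ''theta''" "rmem s1 ''w'' = rmem s ''w''"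
      using s1 by (auto simp: agree_def)
    have gain: "guarantee p r \<beta> * (\<Sum>k<n. rmem s ''w'' k) \<le> trunc \<theta> (rmem s ''w'') S"
      unfolding guarantee_def
    proof (rule local_optimum_response[OF \<beta> _ D1 w_nonneg p, where \<kappa> = "slack r \<beta> (rmem s ''w'')"])
      show "\<theta> = real n * real (card E) * real (D r) * \<beta>" by (simp add: \<theta>_def card_E)
      show "S \<in> \<I>" using s1 by (simp add: S_def)
      show "slack r \<beta> (rmem s ''w'') = (\<Sum>k<n. rmem s ''w'' k) * \<beta> / (real (D r) * real n * real (card E))"
        by (simp add: slack_def card_E)
      fix S' assume "S' \<in> \<I>" "card ((S - S') \<union> (S' - S)) \<le> \<mu> * p + 1"
      then show "trunc \<theta> (rmem s ''w'') S' \<le> trunc \<theta> (rmem s ''w'') S + slack r \<beta> (rmem s ''w'')"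
        using s1 by (simp add: S_def mult.commute)
    qed
    have cp: "run \<Omega> (CopySet ''supp'' (nv ''ptr'') ''S'') s1 (m * 3 + 2)
      (\<lambda>s'. \<forall>j. nmem s' ''supp'' j = (if t * m \<le> j \<and> j < t * m + m then nmem s1 ''S'' (j - t * m) else nmem s1 ''supp'' j))"
      by (rule run_CopySet[OF inp1]) (use mem1 mem in \<open>auto simp: agree_def\<close>)
    show "run \<Omega> ?rest s1 (m * 3 + 2 + (2 + (n * 6 + 2))) (loop_inv p r \<beta> (Suc t))"
    proof (rule run_Seq[OF run_frame[OF cp]])
      fix s2 assume s2: "(\<forall>j. nmem s2 ''supp'' j = (if t * m \<le> j \<and> j < t * m + m then nmem s1 ''S'' (j - t * m) else nmem s1 ''supp'' j)) \<and>
        agree (CopySet ''supp'' (nv ''ptr'') ''S'') s1 s2"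
      have inp2: "input s2" using s2 input_agree inp1 by fastforce
      have mem2: "nmem s2 ''S'' = nmem s1 ''S''" "nmem s2 ''len'' = nmem s1 ''len''" "nmem s2 ''ptr'' = nmem s1 ''ptr''" "rmem s2 = rmem s1"
        using s2 by (auto simp: agree_def)
      let ?s3 = "nupd (nupd s2 ''ptr'' 0 (Suc t * m)) ''len'' 0 (Suc t)"
      have inp3: "input ?s3" using inp2 by simp
      have \<theta>3: "rmem ?s3 ''theta'' 0 = \<theta>" using mem mem1 mem2 by simp
      define Ys where "Ys j = decode es s2 ''supp'' (j * m)" for j
      \<comment> \<open>The new block starts at t * m, behind all earlier ones.\<close>
      have Y_old: "Ys j = Xs j" if "j < t" for j
      proof -
        have "j * m + e < t * m" if "e < m" for e
        proof -
          have "j * m + e < Suc j * m" using that by simp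
          also have "\<dots> \<le> t * m" using \<open>j < t\<close> by (intro mult_right_mono) auto
          finally show ?thesis .
        qed
        then have "\<not> t * m \<le> j * m + e" if "e < m" for e using that by (simp only: not_le)
        then have "nmem s2 ''supp'' (j * m + e) = nmem s ''supp'' (j * m + e)" if "e < m" for e
          using s2 mem1 that by simp
        then show ?thesis
          unfolding Ys_def Xs_def using decode_subset[of es s "''supp''" "j * m"] set_es
          by (intro decode_eqI) (auto simp: mem_decode)
      qed
      have Y_new: "Ys t = S" using s2 by (auto simp: Ys_def S_def decode_def)
      have "run \<Omega> (Update r) ?s3 (n * 6 + 2) (loop_inv p r \<beta> (Suc t))"
      proof (rule run_weaken[OF run_frame[OF run_Update[OF inp3 \<theta>3]]])
        fix s4 assume s4: "(\<forall>k<n. rmem s4 ''w'' k = rmem ?s3 ''w'' k * (1 - (1 / real (D r)) * min (f k (dec ?s3 ''S'')) \<theta> / \<theta>)) \<and>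
          agree (Update r) ?s3 s4"
        have inp4: "input s4" using s4 input_agree inp3 by fastforce
        have mem4: "nmem s4 ''len'' 0 = Suc t" "nmem s4 ''ptr'' 0 = Suc t * m" "nmem s4 ''supp'' = nmem s2 ''supp''"
          "rmem s4 ''beta'' 0 = \<beta>" "rmem s4 ''theta'' 0 = \<theta>"
          using s4 mem mem1 mem2 by (auto simp: agree_def nmem_nupd_other)
        have Y4: "(\<lambda>j. decode es s4 ''supp'' (j * m)) = Ys" by (rule ext) (simp add: Ys_def decode_def mem4(3))
        have wt: "weight \<theta> \<eta> Ys t k = weight \<theta> \<eta> Xs t k" for k by (rule weight_cong) (rule Y_old)
        have "dec ?s3 ''S'' = S" using mem2 by (simp add: S_def decode_def)
        then have w4: "rmem s4 ''w'' k = weight \<theta> \<eta> Ys (Suc t) k" if "k < n" for k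
          using s4 that w[OF that] mem1 mem2 wt[of k] by (simp add: weight_def Y_new \<eta>_def)
        have "guarantee p r \<beta> * (\<Sum>k<n. weight \<theta> \<eta> Ys t k) \<le> trunc \<theta> (weight \<theta> \<eta> Ys t) (Ys t)"
          using gain w trunc_cong[of "rmem s ''w''" "weight \<theta> \<eta> Xs t" \<theta> S]
            trunc_cong[of "weight \<theta> \<eta> Ys t" "weight \<theta> \<eta> Xs t" \<theta> S] by (simp add: wt Y_new)
        moreover have "history p r \<beta> t Ys" using Y_old by (intro history_cong[OF _ hist]) simp
        moreover have "Ys t \<in> \<I>" using s1 by (simp add: Y_new S_def)
        ultimately have "history p r \<beta> (Suc t) Ys"
          unfolding history_def less_Suc_eq by (auto simp: Let_def \<theta>_def \<eta>_def)
        then show "loop_inv p r \<beta> (Suc t) s4"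
          unfolding loop_inv_def Y4 using inp4 mem4 w4 by (simp add: \<theta>_def \<eta>_def)
      qed simp
      then show "run \<Omega> (Seq (NAssign ''ptr'' c0 (NAdd (nv ''ptr'') (nv ''m'')))
          (Seq (NAssign ''len'' c0 (NAdd (nv ''len'') c1)) (Update r))) s2 (2 + (n * 6 + 2)) (loop_inv p r \<beta> (Suc t))"
        using mem mem1 mem2 inp2 by (simp add: run_simps input_def add.commute)
    qed
  qed
qed

lemma run_Rounds:
  assumes \<beta>: "bottleneck \<beta>" and p: "p > 0" and r: "r > 0" and inv: "loop_inv p r \<beta> 0 s"
  shows "run \<Omega> (Rounds p r) s (T r * (search_time p r + (m * 3 + 2 + (2 + (n * 6 + 2))) + 1) + 1) (loop_inv p r \<beta> (T r))"
proof -
  define Inv where "Inv k s' \<longleftrightarrow> (\<exists>t\<le>T r. k = T r - t \<and> loop_inv p r \<beta> t s')" for k s'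
  have guard: "bval (RLess (RNat (nv ''len'')) (rounds r)) s' \<longleftrightarrow> t < T r" if "loop_inv p r \<beta> t s'" for t s'
    using that rval_rounds[of s' r] by (simp add: loop_inv_def)
  have "run \<Omega> (While (RLess (RNat (nv ''len'')) (rounds r)) (Round p r)) s
      (T r * (search_time p r + (m * 3 + 2 + (2 + (n * 6 + 2))) + 1) + 1)
      (\<lambda>s'. \<not> bval (RLess (RNat (nv ''len'')) (rounds r)) s' \<and> (\<exists>k. Inv k s'))"
  proof (rule run_While)
    show "Inv (T r) s" unfolding Inv_def using inv by (intro exI[of _ 0]) simp
    fix k s' assume "Inv k s'" and b: "bval (RLess (RNat (nv ''len'')) (rounds r)) s'"
    then obtain t where t: "k = T r - t" "loop_inv p r \<beta> t s'" by (auto simp: Inv_def)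
    then have less: "t < T r" using guard b by blast
    show "run \<Omega> (Round p r) s' (search_time p r + (m * 3 + 2 + (2 + (n * 6 + 2)))) (\<lambda>s''. \<exists>k'<k. Inv k' s'')"
    proof (rule run_weaken[OF run_Round[OF \<beta> p r t(2)]])
      fix s'' assume "loop_inv p r \<beta> (Suc t) s''"
      then have "Inv (T r - Suc t) s''" unfolding Inv_def using less by (intro exI[of _ "Suc t"]) simp
      then show "\<exists>k'<k. Inv k' s''" using less t(1) by (intro exI[of _ "T r - Suc t"]) simp
    qed simp
  qed
  then show ?thesis
    unfolding Rounds_def
  proof (rule run_weaken)
    fix s' assume "\<not> bval (RLess (RNat (nv ''len'')) (rounds r)) s' \<and> (\<exists>k. Inv k s')"
    then obtain t where t: "t \<le> T r" "loop_inv p r \<beta> t s'" "\<not> bval (RLess (RNat (nv ''len'')) (rounds r)) s'"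
      by (auto simp: Inv_def)
    then have "t = T r" using guard[OF t(2)] by simp
    then show "loop_inv p r \<beta> (T r) s'" using t by simp
  qed simp
qed

lemma run_Prepare:
  assumes inp: "input s" and s: "rmem s ''beta'' 0 = \<beta>" "nmem s ''len'' 0 = 0" "nmem s ''ptr'' 0 = 0"
  shows "run \<Omega> (Prepare r) s (n * 3 + 3) (loop_inv p r \<beta> 0)"
proof -
  define \<theta> where "\<theta> = real n * real m * real (D r) * \<beta>"
  let ?s = "rupd s ''theta'' 0 \<theta>"
  define Inv where "Inv i s' \<longleftrightarrow> (\<forall>k<i. rmem s' ''w'' k = 1)" for i and s' :: state
  let ?body = "RAssign ''w'' (nv ''k'') (RConst 1)"
  have "run \<Omega> (For ''k'' (nv ''n'') ?body) ?s (n * (1 + 2) + 2) (Inv n)"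
  proof (rule run_For)
    show "Inv 0 (nupd ?s ''k'' 0 0)" by (simp add: Inv_def)
    fix s' assume ag: "agree (For ''k'' (nv ''n'') ?body) ?s s'"
    have "input s'" using input_agree[OF ag] inp by simp
    then show "nval (nv ''n'') s' = n" by (simp add: input_def)
    fix i assume i: "Inv i s'" "nmem s' ''k'' 0 = i"
    then show "run \<Omega> ?body s' 1 (\<lambda>s''. nmem s'' ''k'' 0 = i \<and> Inv (Suc i) (nupd s'' ''k'' 0 (Suc i)))"
      by (auto simp: run_simps Inv_def less_Suc_eq)
  qed
  then have "run \<Omega> (For ''k'' (nv ''n'') ?body) ?s (n * 3 + 2) (loop_inv p r \<beta> 0)"
  proof (rule run_weaken[OF run_frame])
    fix s' assume s': "Inv n s' \<and> agree (For ''k'' (nv ''n'') ?body) ?s s'"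
    then have "input s'" using input_agree[of "For ''k'' (nv ''n'') ?body" ?s s'] inp by simp
    moreover have "rmem s' ''beta'' 0 = \<beta>" "rmem s' ''theta'' 0 = \<theta>" "nmem s' ''len'' 0 = 0" "nmem s' ''ptr'' 0 = 0"
      using s' s by (auto simp: agree_def)
    ultimately show "loop_inv p r \<beta> 0 s'"
      using s' by (simp add: loop_inv_def history_def weight_def Inv_def \<theta>_def)
  qed simp
  moreover have "rval (scale r) s = real (D r)" using rval_scale[OF inp] .
  ultimately show ?thesis
    using inp s(1) unfolding Prepare_def by (simp add: run_simps input_def \<theta>_def)
qed

lemma run_Finish:
  assumes "nmem s ''len'' 0 = t"
  shows "run \<Omega> Finish s (t * 3 + 2) (\<lambda>s'. \<forall>j<t. rmem s' ''prob'' j = 1 / real t)"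
proof -
  define Inv where "Inv i s' \<longleftrightarrow> (\<forall>j<i. rmem s' ''prob'' j = 1 / real t)" for i and s' :: state
  let ?body = "RAssign ''prob'' (nv ''a'') (RDiv (RConst 1) (RNat (nv ''len'')))"
  have "run \<Omega> (For ''a'' (nv ''len'') ?body) s (t * (1 + 2) + 2) (Inv t)"
  proof (rule run_For)
    show "Inv 0 (nupd s ''a'' 0 0)" by (simp add: Inv_def)
    fix s' assume ag: "agree (For ''a'' (nv ''len'') ?body) s s'"
    have len: "nmem s' ''len'' 0 = t" using ag assms by (auto simp: agree_def)
    then show "nval (nv ''len'') s' = t" by simp
    fix i assume i: "Inv i s'" "nmem s' ''a'' 0 = i"
    then show "run \<Omega> ?body s' 1 (\<lambda>s''. nmem s'' ''a'' 0 = i \<and> Inv (Suc i) (nupd s'' ''a'' 0 (Suc i)))"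
      using len by (auto simp: run_simps Inv_def less_Suc_eq)
  qed
  then show ?thesis unfolding Finish_def Inv_def by (rule run_weaken) auto
qed

abbreviation "main_time \<equiv> main_cost \<mu> n m"

lemmas main_time_def = main_cost_def

lemma run_Main:
  assumes p: "p > 0" and r: "r > 0"
  shows "run \<Omega> (Main p r) (initial_state m n \<mu>) (main_time p r)
    (\<lambda>s. \<exists>\<beta>. bottleneck \<beta> \<and> nmem s ''len'' 0 = T r \<and> (\<forall>j<T r. rmem s ''prob'' j = 1 / real (T r)) \<and>
      history p r \<beta> (T r) (\<lambda>j. decode es s ''supp'' (j * m)))"
  unfolding Main_def main_time_def
proof (rule run_Seq[OF run_frame[OF run_Bottleneck]])
  let ?s = "initial_state m n \<mu>"
  let ?Q = "\<lambda>s. \<exists>\<beta>. bottleneck \<beta> \<and> nmem s ''len'' 0 = T r \<and> (\<forall>j<T r. rmem s ''prob'' j = 1 / real (T r)) \<and>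
      history p r \<beta> (T r) (\<lambda>j. decode es s ''supp'' (j * m))"
  show inp: "input ?s" and "\<forall>j<m. nmem ?s ''X'' j = 0" by (auto simp: initial_state_def input_def)
  fix s1 assume s1: "bottleneck (rmem s1 ''beta'' 0) \<and> agree Bottleneck ?s s1"
  define \<beta> where "\<beta> = rmem s1 ''beta'' 0"
  have inp1: "input s1" using s1 input_agree inp by fastforce
  have mem1: "nmem s1 ''len'' 0 = 0" "nmem s1 ''ptr'' 0 = 0" using s1 by (auto simp: agree_def initial_state_def)
  show "run \<Omega> (Seq (Prepare r) (Seq (Rounds p r) Finish)) s1
    (n * 3 + 3 + ((T r * (search_time p r + (m * 3 + 2 + (2 + (n * 6 + 2))) + 1) + 1) + (T r * 3 + 2))) ?Q"
  proof (rule run_Seq[OF run_Prepare[OF inp1 _ mem1]])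
    show "rmem s1 ''beta'' 0 = \<beta>" by (simp add: \<beta>_def)
    fix s2 assume s2: "loop_inv p r \<beta> 0 s2"
    show "run \<Omega> (Seq (Rounds p r) Finish) s2 ((T r * (search_time p r + (m * 3 + 2 + (2 + (n * 6 + 2))) + 1) + 1) + (T r * 3 + 2)) ?Q"
    proof (rule run_Seq[OF run_Rounds[OF _ p r s2]])
      show \<beta>: "bottleneck \<beta>" using s1 by (simp add: \<beta>_def)
      fix s3 assume s3: "loop_inv p r \<beta> (T r) s3"
      then have len: "nmem s3 ''len'' 0 = T r" by (simp add: loop_inv_def)
      show "run \<Omega> Finish s3 (T r * 3 + 2) ?Q"
      proof (rule run_weaken[OF run_frame[OF run_Finish[OF len]]])
        fix s4 assume s4: "(\<forall>j<T r. rmem s4 ''prob'' j = 1 / real (T r)) \<and> agree Finish s3 s4"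
        then have "nmem s4 ''len'' 0 = T r" "decode es s4 ''supp'' a = decode es s3 ''supp'' a" for a
          using len decode_agree[of Finish s3 s4 "''supp''"] by (auto simp: agree_def)
        then show "?Q s4" using \<beta> s3 s4 by (intro exI[of _ \<beta>]) (auto simp: loop_inv_def)
      qed simp
    qed
  qed
qed

section \<open>Quality of the uniform mixture\<close>

lemma uniform_mixture:
  assumes t: "t \<ge> 1" and Xs: "\<And>j. j < t \<Longrightarrow> Xs j \<in> \<I>"
  defines "q \<equiv> map_pmf Xs (pmf_of_set {..<t})"
  shows "q \<in> \<Delta> \<I>" and "pmf q X = real (card {j. j < t \<and> Xs j = X}) / real t"
    and "(\<Sum>X\<in>\<I>. pmf q X * g X) = (\<Sum>j<t. g (Xs j)) / real t"
proof -
  have ne: "{..<t} \<noteq> {}" using t by (auto simp: lessThan_empty_iff)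
  show "q \<in> \<Delta> \<I>" using ne Xs by (auto simp: q_def \<Delta>_def)
  have pmf: "pmf q X = real (card {j. j < t \<and> Xs j = X}) / real t" for X
  proof -
    have "{..<t} \<inter> Xs -` {X} = {j. j < t \<and> Xs j = X}" by auto
    then show ?thesis using ne by (simp add: q_def pmf_map measure_pmf_of_set)
  qed
  then show "pmf q X = real (card {j. j < t \<and> Xs j = X}) / real t" .
  have "(\<Sum>X\<in>\<I>. pmf q X * g X) = (\<Sum>X\<in>\<I>. \<Sum>j\<in>{j \<in> {..<t}. Xs j = X}. g (Xs j) / real t)"
    by (intro sum.cong refl) (simp add: pmf)
  also have "\<dots> = (\<Sum>j<t. g (Xs j) / real t)"
    using Xs finite_indep by (intro sum.group) auto
  finally show "(\<Sum>X\<in>\<I>. pmf q X * g X) = (\<Sum>j<t. g (Xs j)) / real t"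
    by (simp add: sum_divide_distrib)
qed

text \<open>Three factors 1 - 1 / d are lost, to the truncation, the slack and the regret, and a
  factor 1 + 2 / d to the step size. Together they cost no more than a factor 1 - 5 / d, which the
  gap between \<mu> + 1 / (2 r) and \<mu> + 1 / r covers.\<close>

lemma history_average:
  assumes \<beta>: "bottleneck \<beta>" and r: "r > 0" and hist: "history (2 * r) r \<beta> (T r) Xs" and k: "k < n"
  shows "\<nu> / (real \<mu> + 1 / real r) \<le> (\<Sum>j<T r. f k (Xs j)) / real (T r)"
proof -
  have Xs: "Xs j \<in> \<I>" if "j < T r" for j using hist that by (simp add: history_def)
  have f0: "f k (Xs j) \<ge> 0" if "j < T r" for j using f_nonneg[OF k indep_subset[OF Xs[OF that]]] .
  have avg0: "(\<Sum>j<T r. f k (Xs j)) / real (T r) \<ge> 0"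
    using f0 by (intro divide_nonneg_nonneg sum_nonneg) auto
  have \<mu>r: "real \<mu> + 1 / real r > 0" using \<mu> by (simp add: add_pos_nonneg)
  show ?thesis
  proof (cases "\<nu> \<le> 0")
    case True
    then have "\<nu> / (real \<mu> + 1 / real r) \<le> 0" using \<mu>r by (simp add: divide_le_0_iff)
    then show ?thesis using avg0 by linarith
  next
    case False
    define d where "d = real (D r)"
    have "D r \<ge> 20 * 1 * (2 + 1)" unfolding D_def using r \<mu> by (intro mult_mono) auto
    then have d: "d \<ge> 60" by (simp add: d_def)
    have \<beta>0: "\<beta> \<ge> 0" using \<beta> by (simp add: bottleneck_def)
    have "\<nu> \<le> real (card E) * \<beta>" using \<beta> nu_star_le unfolding bottleneck_def by blast
    then have "real m * \<beta> > 0" using False card_E by simp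
    then have m: "real m > 0" and \<beta>pos: "\<beta> > 0" using \<beta>0 by (auto simp: zero_less_mult_iff)
    have n0: "real n \<ge> 1" using n by simp
    define \<theta> where "\<theta> = real n * real m * d * \<beta>"
    have \<theta>: "\<theta> > 0" using n0 m d \<beta>pos by (simp add: \<theta>_def)
    define a where "a = guarantee (2 * r) r \<beta>"
    define c where "c = real \<mu> + 1 / real (2 * r)"
    have c: "0 < c" "c \<le> real \<mu> + 1" using \<mu> r by (auto simp: c_def add_pos_nonneg field_simps)
    define \<gamma> where "\<gamma> = 1 - 1 / d"
    have \<gamma>: "1 / 2 \<le> \<gamma>" "\<gamma> \<le> 1" using d by (auto simp: \<gamma>_def field_simps)
    have a_eq: "a = \<gamma> / c * max (\<gamma> * \<nu>) (\<beta> / real n)" by (simp add: a_def guarantee_def c_def \<gamma>_def d_def)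
    have a1: "\<gamma> / c * (\<gamma> * \<nu>) \<le> a" and a2: "\<gamma> / c * (\<beta> / real n) \<le> a"
      unfolding a_eq using \<gamma> c by (intro mult_left_mono; simp)+
    define G where "G = (\<Sum>j<T r. min (f k (Xs j)) \<theta>)"
    have regret: "a * real (T r) - \<theta> * real n / (1 / d) \<le> (1 + 2 * (1 / d)) * G"
      unfolding G_def
    proof (rule mwu_regret[where n = n and k = k and w = "weight \<theta> (1 / d) Xs" and g = "\<lambda>t k. min (f k (Xs t)) \<theta>"])
      show "weight \<theta> (1 / d) Xs (Suc t) k = weight \<theta> (1 / d) Xs t k * (1 - 1 / d * min (f k (Xs t)) \<theta> / \<theta>)" for t k
        by (simp add: weight_def)
      show "0 \<le> min (f k (Xs t)) \<theta> \<and> min (f k (Xs t)) \<theta> \<le> \<theta>" if "k < n" "t < T r" for t k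
        using f_nonneg[OF that(1) indep_subset[OF Xs[OF that(2)]]] \<theta> by simp
      show "a * (\<Sum>k<n. weight \<theta> (1 / d) Xs t k) \<le> (\<Sum>k<n. weight \<theta> (1 / d) Xs t k * min (f k (Xs t)) \<theta>)" if "t < T r" for t
        using hist that by (simp add: history_def Let_def trunc_def a_def \<theta>_def d_def)
    qed (use \<theta> d n k in \<open>auto simp: weight_def\<close>)
    have "T r > 0" by (simp add: T_def)
    then have Tpos: "real (T r) > 0" by simp
    have Tge: "real (T r) \<ge> 4 * (real \<mu> + 1) * (real n ^ 3 * real m) * d ^ 3"
      unfolding d_def by (simp add: T_def power3_eq_cube algebra_simps)
    \<comment> \<open>The regret is a multiple of \<beta>, and by \<open>a2\<close> so is a lower
      bound for a; this makes polynomially many rounds enough. The factor 4 (\<mu> + 1) in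
      \<open>T r\<close> compensates for \<gamma> / c, which is at least 1 / (2 (\<mu> +
      1)).\<close>
    have "\<theta> * real n * d \<le> a * real (T r) / d"
    proof -
      have "\<theta> * real n * d * d = real n ^ 2 * real m * d ^ 3 * \<beta>"
        by (simp add: \<theta>_def power2_eq_square power3_eq_cube mult_ac)
      also have "\<dots> \<le> 2 * (real n ^ 2 * real m * d ^ 3 * \<beta>)" using m d \<beta>0 by simp
      also have "\<dots> = (1 / 2 / (real \<mu> + 1) * (\<beta> / real n)) * (4 * (real \<mu> + 1) * (real n ^ 3 * real m) * d ^ 3)"
      proof -
        have id: "2 * (N ^ 2 * M * d ^ 3 * \<beta>) = (1 / 2 / u * (\<beta> / N)) * (4 * u * (N ^ 3 * M) * d ^ 3)"
          if "u > 0" "N > 0" for u N M :: real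
          using that by (simp add: power2_eq_square power3_eq_cube)
        show ?thesis by (rule id) (use n0 in auto)
      qed
      also have "\<dots> \<le> a * real (T r)"
      proof (rule mult_mono[OF order_trans[OF _ a2] Tge])
        show "1 / 2 / (real \<mu> + 1) * (\<beta> / real n) \<le> \<gamma> / c * (\<beta> / real n)"
          using \<gamma> c \<beta>0 by (intro mult_right_mono frac_le) auto
        have "0 \<le> \<gamma> / c * (\<beta> / real n)"
          using \<gamma> c \<beta>0 by (intro mult_nonneg_nonneg divide_nonneg_nonneg) auto
        then show "0 \<le> a" using a2 by linarith
        show "0 \<le> 4 * (real \<mu> + 1) * (real n ^ 3 * real m) * d ^ 3" using d by simp
      qed
      finally show ?thesis using d by (simp add: field_simps)
    qed
    then have "a * real (T r) * (1 - 1 / d) \<le> (1 + 2 / d) * G" using regret by (simp add: algebra_simps)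
    then have "a * \<gamma> \<le> (1 + 2 / d) * (G / real (T r))"
      using Tpos by (simp add: \<gamma>_def pos_le_divide_eq mult_ac)
    moreover have "\<gamma> * \<gamma> * \<gamma> * (\<nu> / c) \<le> a * \<gamma>"
      using mult_right_mono[OF a1, of \<gamma>] \<gamma> by (simp add: mult_ac)
    \<comment> \<open>The constant 5 is 3 + 2: with it the linear terms of both sides agree, and the
      quadratic terms decide.\<close>
    moreover have "(1 + 2 / d) * (1 - 5 / d) \<le> \<gamma> * \<gamma> * \<gamma>"
    proof -
      define x where "x = 1 / d"
      have x: "0 < x" "x \<le> 1 / 60" using d by (auto simp: x_def field_simps)
      have eq: "(1 - x) * (1 - x) * (1 - x) - (1 + 2 * x) * (1 - 5 * x) = x * x * (13 - x)"
        by (simp add: algebra_simps)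
      have nonneg: "x * x * (13 - x) \<ge> 0" using x by (intro mult_nonneg_nonneg) auto
      have in_x: "\<gamma> = 1 - x" "2 / d = 2 * x" "5 / d = 5 * x" by (auto simp: \<gamma>_def x_def)
      show ?thesis unfolding in_x using eq nonneg by linarith
    qed
    then have "(1 + 2 / d) * (1 - 5 / d) * (\<nu> / c) \<le> \<gamma> * \<gamma> * \<gamma> * (\<nu> / c)"
      using False c by (intro mult_right_mono) auto
    ultimately have "(1 + 2 / d) * ((1 - 5 / d) * (\<nu> / c)) \<le> (1 + 2 / d) * (G / real (T r))" by (simp add: mult_ac)
    moreover have "0 < 1 + 2 / d" using d by (simp add: add_pos_pos)
    ultimately have G: "(1 - 5 / d) * (\<nu> / c) \<le> G / real (T r)" by (rule mult_left_le_imp_le)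
    \<comment> \<open>This fixes the constant 20 in \<open>scale_val\<close>: 5 / d is a quarter of
      y / (\<mu> + 1), so the factor takes at most y / 4 from \<mu> + y, while y / 2 may be
      spent.\<close>
    have "\<nu> / (real \<mu> + 1 / real r) \<le> (1 - 5 / d) * (\<nu> / c)"
    proof -
      define y where "y = 1 / real r"
      have y: "0 < y" "y \<le> 1" using r by (auto simp: y_def)
      have d_eq: "d = 20 * real r * (real \<mu> + 1)" by (simp add: d_def D_def algebra_simps)
      have "5 / (20 * R * u) = 1 / R / (4 * u)" for R u :: real by simp
      then have "5 / d = y / (4 * (real \<mu> + 1))" unfolding d_eq y_def .
      moreover have c_y: "c = real \<mu> + y / 2" by (simp add: c_def y_def)
      moreover have "real \<mu> + y / 2 \<le> (1 - y / (4 * (real \<mu> + 1))) * (real \<mu> + y)"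
      proof -
        have "y / (4 * (real \<mu> + 1)) * (real \<mu> + y) \<le> y / (4 * (real \<mu> + 1)) * (real \<mu> + 1)"
          using y by (intro mult_left_mono) auto
        also have "\<dots> = y / 4" by (simp add: field_simps)
        finally show ?thesis unfolding left_diff_distrib mult_1 using y by linarith
      qed
      ultimately have "c \<le> (1 - 5 / d) * (real \<mu> + y)" by simp
      then have "c * \<nu> \<le> (1 - 5 / d) * (real \<mu> + y) * \<nu>" using False by (intro mult_right_mono) auto
      then show ?thesis using c(1) \<mu>r by (simp add: y_def field_simps)
    qed
    also note G
    also have "G / real (T r) \<le> (\<Sum>j<T r. f k (Xs j)) / real (T r)"
      unfolding G_def by (intro divide_right_mono sum_mono) auto
    finally show ?thesis .
  qed
qed

lemma main_correct:
  assumes r: "r > 0"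
  shows "run \<Omega> (Main (2 * r) r) (initial_state m n \<mu>) (main_time (2 * r) r)
    (\<lambda>s. \<exists>q. outputs es s q \<and> q \<in> \<Delta> \<I> \<and> (\<forall>k<n. \<nu> / (real \<mu> + 1 / real r) \<le> (\<Sum>X\<in>\<I>. pmf q X * f k X)))"
proof (rule run_weaken[OF run_Main])
  fix s assume "\<exists>\<beta>. bottleneck \<beta> \<and> nmem s ''len'' 0 = T r \<and> (\<forall>j<T r. rmem s ''prob'' j = 1 / real (T r)) \<and>
      history (2 * r) r \<beta> (T r) (\<lambda>j. decode es s ''supp'' (j * m))"
  then obtain \<beta> where \<beta>: "bottleneck \<beta>" and len: "nmem s ''len'' 0 = T r"
    and prob: "\<forall>j<T r. rmem s ''prob'' j = 1 / real (T r)"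
    and hist: "history (2 * r) r \<beta> (T r) (\<lambda>j. decode es s ''supp'' (j * m))" by blast
  define Xs where "Xs j = decode es s ''supp'' (j * m)" for j
  have Xs: "Xs j \<in> \<I>" if "j < T r" for j using hist that by (simp add: history_def Xs_def)
  have T1: "T r \<ge> 1" by (simp add: T_def)
  define q where "q = map_pmf Xs (pmf_of_set {..<T r})"
  have mix: "q \<in> \<Delta> \<I>" "pmf q X = real (card {j. j < T r \<and> Xs j = X}) / real (T r)"
    "(\<Sum>X\<in>\<I>. pmf q X * g X) = (\<Sum>j<T r. g (Xs j)) / real (T r)" for X g
    unfolding q_def by (rule uniform_mixture[OF T1]; rule Xs; assumption)+
  have "outputs es s q"
    unfolding outputs_def
  proof
    fix X
    have "(\<Sum>j | j < nmem s ''len'' 0 \<and> decode es s ''supp'' (j * m) = X. rmem s ''prob'' j)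
        = (\<Sum>j | j < T r \<and> Xs j = X. 1 / real (T r))"
      using prob by (intro sum.cong) (auto simp: len Xs_def)
    then show "pmf q X = (\<Sum>j | j < nmem s ''len'' 0 \<and> decode es s ''supp'' (j * m) = X. rmem s ''prob'' j)"
      using mix(2) by simp
  qed
  moreover have "\<nu> / (real \<mu> + 1 / real r) \<le> (\<Sum>X\<in>\<I>. pmf q X * f k X)" if "k < n" for k
    unfolding mix(3) using history_average[OF \<beta> r hist that] by (simp add: Xs_def)
  ultimately show "\<exists>q. outputs es s q \<and> q \<in> \<Delta> \<I> \<and> (\<forall>k<n. \<nu> / (real \<mu> + 1 / real r) \<le> (\<Sum>X\<in>\<I>. pmf q X * f k X))"
    using mix(1) by blast
qed (use r in auto)

end

section \<open>Polynomial running time\<close>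

definition poly_bounded :: "(nat \<Rightarrow> nat \<Rightarrow> nat) \<Rightarrow> bool" where
  "poly_bounded g \<longleftrightarrow> (\<exists>C d. \<forall>n m. g n m \<le> C * (m + n + 1) ^ d)"

lemma poly_bounded_const: "poly_bounded (\<lambda>n m. c)"
  unfolding poly_bounded_def by (intro exI[of _ c] exI[of _ 0]) simp

lemma poly_bounded_fst: "poly_bounded (\<lambda>n m. n)" and poly_bounded_snd: "poly_bounded (\<lambda>n m. m)"
  unfolding poly_bounded_def by (intro exI[of _ 1]; simp)+

text \<open>The common base m + n + 1 is at least 1, so powers can be raised to a joint
  exponent.\<close>

lemma poly_bounded_add:
  assumes "poly_bounded g" "poly_bounded h"
  shows "poly_bounded (\<lambda>n m. g n m + h n m)"
proof -
  obtain C d where g: "g n m \<le> C * (m + n + 1) ^ d" for n m using assms(1) unfolding poly_bounded_def by blast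
  obtain C' d' where h: "h n m \<le> C' * (m + n + 1) ^ d'" for n m using assms(2) unfolding poly_bounded_def by blast
  have "g n m + h n m \<le> (C + C') * (m + n + 1) ^ (d + d')" for n m
  proof -
    have "C * (m + n + 1) ^ d \<le> C * (m + n + 1) ^ (d + d')" "C' * (m + n + 1) ^ d' \<le> C' * (m + n + 1) ^ (d + d')"
      by (intro mult_left_mono power_increasing; simp)+
    then show ?thesis using g[of n m] h[of n m] unfolding distrib_right by linarith
  qed
  then show ?thesis unfolding poly_bounded_def by blast
qed

lemma poly_bounded_mult:
  assumes "poly_bounded g" "poly_bounded h"
  shows "poly_bounded (\<lambda>n m. g n m * h n m)"
proof -
  obtain C d where g: "g n m \<le> C * (m + n + 1) ^ d" for n m using assms(1) unfolding poly_bounded_def by blast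
  obtain C' d' where h: "h n m \<le> C' * (m + n + 1) ^ d'" for n m using assms(2) unfolding poly_bounded_def by blast
  have "g n m * h n m \<le> (C * C') * (m + n + 1) ^ (d + d')" for n m
    using mult_mono[OF g[of n m] h[of n m]] by (simp add: power_add mult_ac)
  then show ?thesis unfolding poly_bounded_def by blast
qed

lemma poly_bounded_power: "poly_bounded g \<Longrightarrow> poly_bounded (\<lambda>n m. g n m ^ k)"
  by (induction k) (simp_all add: poly_bounded_const poly_bounded_mult)

text \<open>The number of candidate exchanges is a power of m + 1 whose exponent involves neither n
  nor m.\<close>

lemma poly_bounded_main_cost: "poly_bounded (\<lambda>n m. main_cost \<mu> n m p r)"
  unfolding main_cost_def round_count_def search_cost_def step_cost_def
  by (intro poly_bounded_const poly_bounded_fst poly_bounded_snd poly_bounded_add poly_bounded_mult poly_bounded_power)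

text \<open>The program depends on \<epsilon> alone, through r, and reads \<mu> from its input. The
  constants of the time bound vary with \<mu>, because the search tries all exchanges of up to 2 r
  \<mu> + 1 elements.\<close>

theorem mainTheorem7:
  fixes \<epsilon> :: real
  assumes "\<epsilon> > 0"
  shows "\<exists>prog :: com. \<forall>\<mu>\<ge>2. \<exists>(C :: nat) (d :: nat).
    \<forall>(E :: 'a set) (es :: 'a list) (n :: nat)
      (f :: nat \<Rightarrow> 'a set \<Rightarrow> real) (Ind :: nat \<Rightarrow> 'a set set) \<I>.
      finite E \<and> distinct es \<and> set es = E \<and> n \<ge> 1 \<and>
      (\<forall>k<n. (\<forall>X. X \<subseteq> E \<longrightarrow> f k X \<ge> 0) \<and> f k {} = 0 \<and>
             monotone_setfun E (f k) \<and> submodular E (f k)) \<and>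
      (\<forall>i<\<mu>. matroid E (Ind i)) \<and> \<I> = matroid_intersection \<mu> Ind
      \<longrightarrow>
      (\<exists>t s p.
         exec \<lparr>elements = es, value_oracle = f, indep_oracle = Ind\<rparr>
              prog (initial_state (card E) n \<mu>) t s \<and>
         t \<le> C * (card E + n + 1) ^ d \<and>
         outputs es s p \<and> p \<in> \<Delta> \<I> \<and>
         Min ((\<lambda>k. \<Sum>X\<in>\<I>. pmf p X * f k X) ` {..<n}) \<ge> 1 / (real \<mu> + \<epsilon>) * nu_star \<I> n f)"
proof -
  obtain r :: nat where r: "r > 0" "1 / real r \<le> \<epsilon>"
    using reals_Archimedean[OF assms] by (metis inverse_eq_divide less_imp_le zero_less_Suc)
  show ?thesis
  proof (intro exI[of _ "Main (2 * r) r"] allI impI)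
    fix \<mu> :: nat assume \<mu>: "\<mu> \<ge> 2"
    obtain C d where bound: "main_cost \<mu> n m (2 * r) r \<le> C * (m + n + 1) ^ d" for n m
      using poly_bounded_main_cost[of \<mu> "2 * r" r] unfolding poly_bounded_def by blast
    show "\<exists>C d. \<forall>(E :: 'a set) es n f Ind \<I>.
      finite E \<and> distinct es \<and> set es = E \<and> n \<ge> 1 \<and>
      (\<forall>k<n. (\<forall>X. X \<subseteq> E \<longrightarrow> f k X \<ge> 0) \<and> f k {} = 0 \<and>
             monotone_setfun E (f k) \<and> submodular E (f k)) \<and>
      (\<forall>i<\<mu>. matroid E (Ind i)) \<and> \<I> = matroid_intersection \<mu> Ind
      \<longrightarrow>
      (\<exists>t s p.
         exec \<lparr>elements = es, value_oracle = f, indep_oracle = Ind\<rparr>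
              (Main (2 * r) r) (initial_state (card E) n \<mu>) t s \<and>
         t \<le> C * (card E + n + 1) ^ d \<and>
         outputs es s p \<and> p \<in> \<Delta> \<I> \<and>
         Min ((\<lambda>k. \<Sum>X\<in>\<I>. pmf p X * f k X) ` {..<n}) \<ge> 1 / (real \<mu> + \<epsilon>) * nu_star \<I> n f)"
    proof (rule exI[of _ C], rule exI[of _ d], intro allI impI, elim conjE)
      fix E :: "'a set" and es :: "'a list" and n :: nat and f :: "nat \<Rightarrow> 'a set \<Rightarrow> real"
        and Ind :: "nat \<Rightarrow> 'a set set" and \<I>
      assume inst: "finite E" "distinct es" "set es = E" "n \<ge> 1"
        "\<forall>k<n. (\<forall>X. X \<subseteq> E \<longrightarrow> f k X \<ge> 0) \<and> f k {} = 0 \<and> monotone_setfun E (f k) \<and> submodular E (f k)"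
        "\<forall>i<\<mu>. matroid E (Ind i)" and \<I>: "\<I> = matroid_intersection \<mu> Ind"
      interpret robust_program E n f Ind \<mu> es
        by unfold_locales (use inst \<mu> in auto)
      obtain t s q where run: "exec \<Omega> (Main (2 * r) r) (initial_state m n \<mu>) t s" "t \<le> main_cost \<mu> n m (2 * r) r"
        and q: "outputs es s q" "q \<in> \<Delta> \<I>"
          "\<And>k. k < n \<Longrightarrow> nu_star \<I> n f / (real \<mu> + 1 / real r) \<le> (\<Sum>X\<in>\<I>. pmf q X * f k X)"
        using main_correct[OF r(1)] unfolding run_def \<I> by blast
      have time: "t \<le> C * (card E + n + 1) ^ d" using run(2) bound[of n m] by (simp add: card_E)
      \<comment> \<open>The sign is needed to replace 1 / r by the larger \<epsilon> in the
        denominator; the point mass on the empty set supplies it.\<close>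
      have \<nu>0: "nu_star \<I> n f \<ge> 0"
      proof -
        have "robust_value \<I> n f (return_pmf {}) \<ge> 0"
          unfolding robust_value_def using n f_nonneg indep_subset
          by (subst Min_ge_iff) (auto simp: \<I> lessThan_empty_iff intro!: sum_nonneg mult_nonneg_nonneg)
        moreover have "return_pmf {} \<in> \<Delta> \<I>" using empty_indep by (simp add: \<Delta>_def \<I>)
        ultimately show ?thesis
          using nu_star_is_max[of \<I> n f] finite_indep empty_indep n unfolding \<I> by fastforce
      qed
      have "1 / (real \<mu> + \<epsilon>) * nu_star \<I> n f \<le> nu_star \<I> n f / (real \<mu> + 1 / real r)"
        using r \<nu>0 \<mu> assms by (simp add: frac_le add_pos_nonneg)
      then have "1 / (real \<mu> + \<epsilon>) * nu_star \<I> n f \<le> Min ((\<lambda>k. \<Sum>X\<in>\<I>. pmf q X * f k X) ` {..<n})"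
        using q(3) n by (subst Min_ge_iff) (auto simp: lessThan_empty_iff intro: order_trans)
      then show "\<exists>t s p.
         exec \<lparr>elements = es, value_oracle = f, indep_oracle = Ind\<rparr>
              (Main (2 * r) r) (initial_state (card E) n \<mu>) t s \<and>
         t \<le> C * (card E + n + 1) ^ d \<and>
         outputs es s p \<and> p \<in> \<Delta> \<I> \<and>
         Min ((\<lambda>k. \<Sum>X\<in>\<I>. pmf p X * f k X) ` {..<n}) \<ge> 1 / (real \<mu> + \<epsilon>) * nu_star \<I> n f"
        using run(1) q(1,2) time unfolding card_E by blast
    qed
  qed
qed

end
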